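(* Let $X$ be a Banach space. Then $X$ is isomorphic to a Hilbert space if and only if every convex and compact (nonempty) subset $K\subset X$ is a Lipschitz retract of $X$.
   Context: All Banach spaces are real; isomorphic means linearly homeomorphic. $K\subset X$ is a Lipschitz retract of $X$ if there is a Lipschitz map $R:X\to K$ with $R|_K=\mathrm{Id}_K$. *)

theory Defs
  imports "HOL-Analysis.Analysis" "HOL-Algebra.Module"
begin

section \<open>Real Hilbert spaces with explicit carrier\<close>

text \<open>The theorem asks for the existence of some Hilbert space. HOL cannot quantify over types
  inside a formula, so the sort \<^class>\<open>real_inner\<close> does not suffice, and Hilbert spaces are described
  as structures on a carrier set. Vector spaces are modules over the field of reals; the record
  fields \<open>mult\<close> and \<open>one\<close> that a module inherits from \<open>ring\<close> are irrelevant.\<close>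

definition real_ring :: "real ring"
  where "real_ring = \<lparr>carrier = UNIV, monoid.mult = (*), one = 1, ring.zero = 0, add = (+)\<rparr>"

lemma real_ring_simps [simp]:
  "carrier real_ring = UNIV" "x \<otimes>\<^bsub>real_ring\<^esub> y = x * y" "\<one>\<^bsub>real_ring\<^esub> = 1"
  "\<zero>\<^bsub>real_ring\<^esub> = 0" "x \<oplus>\<^bsub>real_ring\<^esub> y = x + y"
  by (simp_all add: real_ring_def)

lemma cring_real_ring: "cring real_ring"
proof (intro cringI abelian_groupI comm_monoidI)
  fix x :: real
  show "\<exists>y\<in>carrier real_ring. y \<oplus>\<^bsub>real_ring\<^esub> x = \<zero>\<^bsub>real_ring\<^esub>"
    by (intro bexI[of _ "- x"]) auto
qed (auto simp: algebra_simps)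

text \<open>The distance induced by an inner product. It is set to 0 off the carrier because the library
  locale \<^locale>\<open>Metric_space\<close> wants nonnegativity and symmetry for all elements of the type.\<close>

definition ip_dist :: "(real, 'h) module \<Rightarrow> ('h \<Rightarrow> 'h \<Rightarrow> real) \<Rightarrow> 'h \<Rightarrow> 'h \<Rightarrow> real"
  where "ip_dist H ip x y =
    (if x \<in> carrier H \<and> y \<in> carrier H then sqrt (ip (x \<ominus>\<^bsub>H\<^esub> y) (x \<ominus>\<^bsub>H\<^esub> y)) else 0)"

locale real_hilbert_space = module real_ring H
  for H :: "(real, 'h) module" (structure) +
  fixes ip :: "'h \<Rightarrow> 'h \<Rightarrow> real"
  assumes ip_commute: "\<lbrakk>x \<in> carrier H; y \<in> carrier H\<rbrakk> \<Longrightarrow> ip x y = ip y x"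
    and ip_add_left: "\<lbrakk>x \<in> carrier H; y \<in> carrier H; z \<in> carrier H\<rbrakk>
      \<Longrightarrow> ip (x \<oplus> y) z = ip x z + ip y z"
    and ip_smult_left: "\<lbrakk>x \<in> carrier H; y \<in> carrier H\<rbrakk> \<Longrightarrow> ip (c \<odot> x) y = c * ip x y"
    and ip_ge_zero: "x \<in> carrier H \<Longrightarrow> 0 \<le> ip x x"
    and ip_eq_zero: "\<lbrakk>x \<in> carrier H; ip x x = 0\<rbrakk> \<Longrightarrow> x = \<zero>"
    and complete: "Metric_space.mcomplete (carrier H) (ip_dist H ip)"

definition linear_homeomorphism ::
    "(real, 'h) module \<Rightarrow> ('h \<Rightarrow> 'h \<Rightarrow> real) \<Rightarrow> ('a::real_normed_vector \<Rightarrow> 'h) \<Rightarrow> bool"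
  where "linear_homeomorphism H ip T \<longleftrightarrow>
    (\<forall>x y. T (x + y) = T x \<oplus>\<^bsub>H\<^esub> T y) \<and>
    (\<forall>c x. T (c *\<^sub>R x) = c \<odot>\<^bsub>H\<^esub> T x) \<and>
    homeomorphic_map euclidean (Metric_space.mtopology (carrier H) (ip_dist H ip)) T"

text \<open>The carrier of the Hilbert space is a subset of the type \<open>'a\<close>. This is no restriction, since
  a Hilbert space isomorphic to \<open>'a\<close> is in bijection with \<open>'a\<close>; see the lemmas
  \<open>isomorphic_to_hilbert_space_any_carrier\<close> and \<open>isomorphic_to_hilbert_space_class\<close> below.\<close>

definition isomorphic_to_hilbert_space :: "'a::real_normed_vector itself \<Rightarrow> bool"
  where "isomorphic_to_hilbert_space _ \<longleftrightarrow>
    (\<exists>(H :: (real, 'a) module) ip (T :: 'a \<Rightarrow> 'a).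
       real_hilbert_space H ip \<and> linear_homeomorphism H ip T)"

definition lipschitz_retract :: "'a::metric_space set \<Rightarrow> bool"
  where "lipschitz_retract K \<longleftrightarrow>
    (\<exists>R L. L-lipschitz_on UNIV R \<and> range R \<subseteq> K \<and> (\<forall>x\<in>K. R x = x))"

section \<open>The metric of a Hilbert space\<close>

context real_hilbert_space
begin

lemma ip_zero_left: "y \<in> carrier H \<Longrightarrow> ip \<zero> y = 0"
  using ip_add_left[of \<zero> \<zero> y] by simp

lemma ip_minus_left:
  assumes "x \<in> carrier H" "y \<in> carrier H"
  shows "ip (\<ominus> x) y = - ip x y"
  using ip_add_left[of x "\<ominus> x" y] ip_zero_left[of y] assms by (simp add: M.r_neg)

lemma ip_add_right:
  "\<lbrakk>x \<in> carrier H; y \<in> carrier H; z \<in> carrier H\<rbrakk> \<Longrightarrow> ip z (x \<oplus> y) = ip z x + ip z y"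
  by (simp add: ip_commute[of z] ip_add_left)

lemma ip_smult_right:
  "\<lbrakk>x \<in> carrier H; y \<in> carrier H\<rbrakk> \<Longrightarrow> ip y (c \<odot> x) = c * ip y x"
  by (simp add: ip_commute[of y] ip_smult_left)

lemma ip_minus_right:
  "\<lbrakk>x \<in> carrier H; y \<in> carrier H\<rbrakk> \<Longrightarrow> ip y (\<ominus> x) = - ip y x"
  by (simp add: ip_commute[of y] ip_minus_left)

lemma ip_cauchy_schwarz:
  assumes x: "x \<in> carrier H" and y: "y \<in> carrier H"
  shows "ip x y \<le> sqrt (ip x x) * sqrt (ip y y)"
proof -
  let ?a = "sqrt (ip x x)" and ?b = "sqrt (ip y y)"
  have a: "?a\<^sup>2 = ip x x" "?b\<^sup>2 = ip y y" "0 \<le> ?a" "0 \<le> ?b"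
    using ip_ge_zero x y by auto
  show ?thesis
  proof (cases "?a = 0 \<or> ?b = 0")
    case True
    then have "x = \<zero> \<or> y = \<zero>" using ip_eq_zero x y by auto
    then have "ip x y = 0" using ip_zero_left ip_commute[of x y] x y by auto
    then show ?thesis using a by simp
  next
    case False
    have expand: "ip ((b \<odot> x) \<oplus> (\<ominus> (a \<odot> y))) ((b \<odot> x) \<oplus> (\<ominus> (a \<odot> y))) =
        b\<^sup>2 * ip x x - 2 * a * b * ip x y + a\<^sup>2 * ip y y" for a b
      using x y by (simp add: ip_add_left ip_add_right ip_minus_left ip_minus_right
        ip_smult_left ip_smult_right ip_commute[of y x] power2_eq_square)
        (simp add: algebra_simps)
    have "0 \<le> ip ((?b \<odot> x) \<oplus> (\<ominus> (?a \<odot> y))) ((?b \<odot> x) \<oplus> (\<ominus> (?a \<odot> y)))"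
      using x y by (intro ip_ge_zero) auto
    also have "\<dots> = ?b\<^sup>2 * ?a\<^sup>2 - 2 * ?a * ?b * ip x y + ?a\<^sup>2 * ?b\<^sup>2"
      unfolding expand a(1,2) ..
    also have "\<dots> = 2 * ((?a * ?b) * (?a * ?b - ip x y))"
    proof -
      have "q\<^sup>2 * p\<^sup>2 - 2 * p * q * r + p\<^sup>2 * q\<^sup>2 = 2 * ((p * q) * (p * q - r))" for p q r :: real
        by (simp add: power2_eq_square algebra_simps)
      then show ?thesis .
    qed
    finally have "0 \<le> (?a * ?b) * (?a * ?b - ip x y)" by simp
    moreover have "0 < ?a * ?b" using False a(3,4) by (metis less_eq_real_def mult_pos_pos)
    ultimately show ?thesis by (simp add: zero_le_mult_iff)
  qed
qed

lemma ip_minkowski: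
  assumes x: "x \<in> carrier H" and y: "y \<in> carrier H"
  shows "sqrt (ip (x \<oplus> y) (x \<oplus> y)) \<le> sqrt (ip x x) + sqrt (ip y y)"
proof (rule real_le_lsqrt)
  have "ip (x \<oplus> y) (x \<oplus> y) = ip x x + 2 * ip x y + ip y y"
    using x y by (simp add: ip_add_left ip_add_right ip_commute[of y x])
  also have "\<dots> \<le> ip x x + 2 * (sqrt (ip x x) * sqrt (ip y y)) + ip y y"
    using ip_cauchy_schwarz[OF x y] by simp
  also have "\<dots> = (sqrt (ip x x) + sqrt (ip y y))\<^sup>2"
    using ip_ge_zero x y by (simp add: power2_sum)
  finally show "ip (x \<oplus> y) (x \<oplus> y) \<le> (sqrt (ip x x) + sqrt (ip y y))\<^sup>2" .
  show "0 \<le> sqrt (ip x x) + sqrt (ip y y)"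
    using ip_ge_zero x y by simp
qed

lemma Metric_space_ip_dist: "Metric_space (carrier H) (ip_dist H ip)"
proof
  show "0 \<le> ip_dist H ip x y" for x y
    by (auto simp: ip_dist_def intro!: ip_ge_zero)
  show "ip_dist H ip x y = ip_dist H ip y x" for x y
  proof (cases "x \<in> carrier H \<and> y \<in> carrier H")
    case True
    then have "x \<ominus> y = \<ominus> (y \<ominus> x)"
      by (simp add: M.minus_add M.a_comm a_minus_def)
    then show ?thesis
      using True by (simp add: ip_dist_def ip_minus_left ip_minus_right)
  qed (auto simp: ip_dist_def)
  show "ip_dist H ip x y = 0 \<longleftrightarrow> x = y" if "x \<in> carrier H" "y \<in> carrier H" for x y
  proof
    assume "ip_dist H ip x y = 0"
    then have "x \<ominus> y = \<zero>"
      using that by (intro ip_eq_zero) (auto simp: ip_dist_def)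
    then have "x \<oplus> \<ominus> y = y \<oplus> \<ominus> y" using that by (simp add: a_minus_def M.r_neg)
    then show "x = y" using that by simp
  next
    assume "x = y"
    then have "x \<ominus> y = \<zero>" using that by (simp add: a_minus_def M.r_neg)
    then show "ip_dist H ip x y = 0"
      using that by (simp add: ip_dist_def ip_zero_left)
  qed
  show "ip_dist H ip x z \<le> ip_dist H ip x y + ip_dist H ip y z"
    if "x \<in> carrier H" "y \<in> carrier H" "z \<in> carrier H" for x y z
  proof -
    have "(x \<ominus> y) \<oplus> (y \<ominus> z) = x \<oplus> ((\<ominus> y \<oplus> y) \<oplus> \<ominus> z)"
      using that by (simp add: a_minus_def M.a_assoc del: M.l_neg)
    also have "\<dots> = x \<ominus> z"
      using that by (simp add: a_minus_def M.l_neg)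
    finally show ?thesis
      using ip_minkowski[of "x \<ominus> y" "y \<ominus> z"] that by (simp add: ip_dist_def)
  qed
qed

end

section \<open>Independence of the carrier type\<close>

lemma linear_homeomorphism_minus:
  assumes "real_hilbert_space H ip" and T: "linear_homeomorphism H ip T"
  shows "T (x - y) = T x \<ominus>\<^bsub>H\<^esub> T y"
proof -
  interpret real_hilbert_space H ip by fact
  interpret D: Metric_space "carrier H" "ip_dist H ip" by (rule Metric_space_ip_dist)
  have c: "T z \<in> carrier H" for z
    using T homeomorphic_imp_surjective_map[of euclidean D.mtopology T]
    by (auto simp: linear_homeomorphism_def)
  have "T x = T (x - y) \<oplus>\<^bsub>H\<^esub> T y"
    using T unfolding linear_homeomorphism_def by (metis diff_add_cancel)
  then show ?thesis
    using c by (simp add: a_minus_def M.a_assoc M.r_neg)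
qed

theorem isomorphic_to_hilbert_space_any_carrier:
  fixes H :: "(real, 'h) module" and T :: "'a::real_normed_vector \<Rightarrow> 'h"
  assumes HH: "real_hilbert_space H ip" and T: "linear_homeomorphism H ip T"
  shows "isomorphic_to_hilbert_space TYPE('a)"
proof -
  interpret real_hilbert_space H ip by fact
  interpret D: Metric_space "carrier H" "ip_dist H ip" by (rule Metric_space_ip_dist)
  have hom: "homeomorphic_map euclidean D.mtopology T"
    and Tadd: "T (x + y) = T x \<oplus>\<^bsub>H\<^esub> T y" and Tsc: "T (c *\<^sub>R x) = c \<odot>\<^bsub>H\<^esub> T x" for x y c
    using T by (auto simp: linear_homeomorphism_def)
  have im: "range T = carrier H" and injT: "inj T"
    using homeomorphic_imp_surjective_map[OF hom] homeomorphic_imp_injective_map[OF hom] by auto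
  have c: "T z \<in> carrier H" for z using im by auto
  have T0: "T 0 = \<zero>\<^bsub>H\<^esub>"
    using linear_homeomorphism_minus[OF HH T, of 0 0] c by (simp add: a_minus_def M.r_neg)
  define G :: "(real, 'a) module"
    where "G = \<lparr>carrier = UNIV, monoid.mult = (\<lambda>_ _. 0), one = 0, ring.zero = 0, add = (+),
      smult = (*\<^sub>R)\<rparr>"
  have G [simp]: "carrier G = UNIV" "x \<oplus>\<^bsub>G\<^esub> y = x + y" "\<zero>\<^bsub>G\<^esub> = 0" "r \<odot>\<^bsub>G\<^esub> x = r *\<^sub>R x" for x y r
    by (simp_all add: G_def)
  define jp where "jp = (\<lambda>x y. ip (T x) (T y))"
  have mod: "module real_ring G"
  proof (intro moduleI abelian_groupI cring_real_ring)
    show "\<exists>y\<in>carrier G. y \<oplus>\<^bsub>G\<^esub> x = \<zero>\<^bsub>G\<^esub>" for x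
      by (intro bexI[of _ "- x"]) auto
  qed (auto simp: algebra_simps)
  interpret G: module real_ring G by (rule mod)
  have Gm: "x \<ominus>\<^bsub>G\<^esub> y = x - y" for x y
  proof -
    have "(x \<ominus>\<^bsub>G\<^esub> y) \<oplus>\<^bsub>G\<^esub> y = x"
      by (simp only: a_minus_def) (metis G(1) G.M.a_assoc G.M.a_inv_closed G.M.l_neg G.M.r_zero UNIV_I)
    then show ?thesis by (simp add: eq_diff_eq)
  qed
  have d: "ip_dist G jp x y = ip_dist H ip (T x) (T y)" for x y
    using c by (simp add: ip_dist_def jp_def Gm linear_homeomorphism_minus[OF HH T])
  interpret E: Metric_space UNIV "ip_dist G jp"
    using injT c by unfold_locales (auto simp: d D.commute inj_eq D.triangle)
  have bal: "T ` E.mball x r = D.mball (T x) r" for x r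
    using im c by (auto simp: d) (metis D.in_mball E.in_mball UNIV_I d imageI imageE)
  have "openin euclidean U \<longleftrightarrow> openin E.mtopology U" for U
  proof -
    have "openin euclidean U \<longleftrightarrow> openin D.mtopology (T ` U)"
      using homeomorphic_map_openness[OF hom, of U] by simp
    also have "\<dots> \<longleftrightarrow> (\<forall>x\<in>U. \<exists>r>0. T ` E.mball x r \<subseteq> T ` U)"
      using c by (auto simp: D.openin_mtopology bal)
    also have "\<dots> \<longleftrightarrow> openin E.mtopology U"
      by (auto simp: E.openin_mtopology inj_image_subset_iff[OF injT])
    finally show ?thesis .
  qed
  then have top: "E.mtopology = euclidean" by (metis topology_eq)
  have "E.mcomplete"
    unfolding E.mcomplete_def
  proof (intro allI impI)
    fix s assume "E.MCauchy s"
    then have "D.MCauchy (T \<circ> s)" using c by (auto simp: E.MCauchy_def D.MCauchy_def d)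
    then obtain y where y: "limitin D.mtopology (T \<circ> s) y sequentially"
      using complete by (auto simp: D.mcomplete_def)
    then have "y \<in> carrier H" using limitin_topspace by fastforce
    then obtain x where x: "y = T x" using im by auto
    have "limitin E.mtopology s x sequentially"
      using y unfolding x by (simp add: D.limit_metric_sequentially E.limit_metric_sequentially d)
        meson
    then show "\<exists>x. limitin E.mtopology s x sequentially" ..
  qed
  then have "real_hilbert_space G jp"
    using mod c injT T0
    by (auto intro!: real_hilbert_space.intro real_hilbert_space_axioms.intro ip_ge_zero
      simp: jp_def Tadd Tsc ip_add_left ip_smult_left dest!: ip_eq_zero[rotated] intro: ip_commute)
      (metis injD)
  moreover have "linear_homeomorphism G jp id"
    using top by (simp add: linear_homeomorphism_def)
  ultimately show ?thesis
    unfolding isomorphic_to_hilbert_space_def by blast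
qed

corollary isomorphic_to_hilbert_space_class:
  fixes T :: "'a::real_normed_vector \<Rightarrow> 'h::{real_inner,complete_space}"
  assumes "linear T" and hom: "homeomorphism UNIV UNIV T S"
  shows "isomorphic_to_hilbert_space TYPE('a)"
proof -
  define G :: "(real, 'h) module"
    where "G = \<lparr>carrier = UNIV, monoid.mult = (\<lambda>_ _. 0), one = 0, ring.zero = 0, add = (+),
      smult = (*\<^sub>R)\<rparr>"
  have G [simp]: "carrier G = UNIV" "x \<oplus>\<^bsub>G\<^esub> y = x + y" "\<zero>\<^bsub>G\<^esub> = 0" "r \<odot>\<^bsub>G\<^esub> x = r *\<^sub>R x" for x y r
    by (simp_all add: G_def)
  have mod: "module real_ring G"
  proof (intro moduleI abelian_groupI cring_real_ring)
    show "\<exists>y\<in>carrier G. y \<oplus>\<^bsub>G\<^esub> x = \<zero>\<^bsub>G\<^esub>" for x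
      by (intro bexI[of _ "- x"]) auto
  qed (auto simp: algebra_simps)
  interpret G: module real_ring G by (rule mod)
  have Gm: "x \<ominus>\<^bsub>G\<^esub> y = x - y" for x y
  proof -
    have "(x \<ominus>\<^bsub>G\<^esub> y) \<oplus>\<^bsub>G\<^esub> y = x"
      by (simp only: a_minus_def) (metis G(1) G.M.a_assoc G.M.a_inv_closed G.M.l_neg G.M.r_zero UNIV_I)
    then show ?thesis by (simp add: eq_diff_eq)
  qed
  have d: "ip_dist G inner = dist"
    by (intro ext) (simp add: ip_dist_def Gm dist_norm norm_eq_sqrt_inner)
  have "Metric_space.mcomplete (UNIV :: 'h set) dist"
    using complete_UNIV by (simp add: mcomplete_iff_complete)
  then have "real_hilbert_space G inner"
    using mod by (auto intro!: real_hilbert_space.intro real_hilbert_space_axioms.intro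
      intro: inner_commute simp: d inner_add_left)
  moreover have "homeomorphic_map euclidean euclidean T"
    using hom by (auto simp: homeomorphic_map_maps homeomorphic_maps_def homeomorphism_def)
  then have "linear_homeomorphism G inner T"
    using \<open>linear T\<close> by (simp add: linear_homeomorphism_def d linear_add linear_scale)
  ultimately show ?thesis by (rule isomorphic_to_hilbert_space_any_carrier)
qed

end

theory Submission
  imports Defs "HOL-Library.Function_Algebras"
begin

text \<open>If \<open>X\<close> carries an equivalent inner product, the nearest point map is a Lipschitz retraction.

  Conversely, all finite-dimensional subspaces of some finite-codimensional subspace are uniformly
  complemented: otherwise small balls of badly complemented subspaces that form a
  finite-dimensional decomposition have a compact convex sum, and a retraction onto it gives
  retractions onto these balls with uniform Lipschitz constants, which Lindenstrauss' averaging
  turns into linear projections.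

  Uniform complementation yields Euclidean structure by projecting onto graphs, as in the proof of
  Lindenstrauss and Tzafriri, but without Dvoretzky's theorem. A greedy argument provides a system
  \<open>e : \<ell>\<^sub>2\<^sup>m \<rightarrow> X\<close> with an upper and a system \<open>j : F \<rightarrow> \<ell>\<^sub>2\<^sup>m\<close> with a lower 2-estimate, both almost
  normalized; projecting onto the graph of a multiple of \<open>e j\<close> yields an operator between them whose
  compression to \<open>\<ell>\<^sub>2\<^sup>m\<close> has large trace, so that \<open>X\<close> contains uniformly isomorphic copies of all
  \<open>\<ell>\<^sub>2\<^sup>n\<close>. Projecting onto the graph of a map from \<open>E\<close> into such a copy improves a Euclidean
  distortion \<open>d\<close> of \<open>E\<close> to a multiple of \<open>sqrt d\<close> (Kadec and Mityagin), hence the distortions are bounded,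
  and a generalized limit of the inner products along the finite-dimensional subspaces gives an
  equivalent inner product.\<close>

section \<open>Sublinear functionals\<close>

text \<open>Uniformity of the constants is the crux. Compactness forces the radii of the balls to
  tend to 0, but conjugating a retraction with a dilation keeps its Lipschitz constant, so the
  linear projections do not feel the radii. All of them come from one retraction, hence share one
  bound. A single finite-dimensional subspace is always complemented with some constant; only a
  sequence of ever worse ones, each inside the kernels of functionals norming its predecessors, is
  contradictory. This is why a finite-codimensional subspace appears.

  A projection onto the graph of \<open>T\<close> over \<open>E\<close> gives \<open>A\<close> with
  \<open>x = A x + A (T x)\<close> on \<open>E\<close>, where \<open>A\<close> and
  \<open>T A\<close> are bounded independently of the size of \<open>T\<close>. If \<open>T\<close>
  is a large multiple of a map into \<open>W\<close>, the first summand, seen through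
  \<open>W\<close>, becomes small, so the second must carry the trace. If \<open>T\<close> is
  \<open>sqrt d\<close> times an embedding, the two summands cost \<open>d / sqrt d\<close> and
  \<open>sqrt d\<close>, whence the passage from \<open>d\<close> to a multiple of
  \<open>sqrt d\<close>. The Euclidean copies used there need only fixed constants, since these
  enter just the factor in front of \<open>sqrt d\<close>; almost isometric copies would gain
  nothing.\<close>

definition sublinear_on :: "'v::real_vector set \<Rightarrow> ('v \<Rightarrow> real) \<Rightarrow> bool"
  where "sublinear_on W q \<longleftrightarrow> (\<forall>x\<in>W. \<forall>y\<in>W. q (x + y) \<le> q x + q y) \<and>
    (\<forall>x\<in>W. \<forall>c>0. q (c *\<^sub>R x) \<le> c * q x)"

text \<open>The definition gives only an inequality for positive factors. Using it for
  \<open>1 / c\<close> gives the converse; at 0, the factor \<open>1 / 2\<close> and subadditivity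
  squeeze \<open>q 0\<close> to 0.\<close>

lemma sublinear_on_scale:
  assumes "sublinear_on W q" "subspace W" "x \<in> W" "c \<ge> 0"
  shows "q (c *\<^sub>R x) = c * q x"
proof (cases "c = 0")
  case True
  have "0 \<in> W" using assms subspace_0 by blast
  then have "q (0 + 0) \<le> q 0 + q 0"
    using assms(1) unfolding sublinear_on_def by blast
  moreover have "q ((1/2) *\<^sub>R 0) \<le> 1/2 * q 0"
    using assms(1) \<open>0 \<in> W\<close> unfolding sublinear_on_def by (metis half_gt_zero zero_less_one)
  ultimately show ?thesis using True by auto
next
  case False
  then have c: "c > 0" using assms by auto
  have "c *\<^sub>R x \<in> W" using assms by (simp add: subspace_scale)
  then have "q ((1/c) *\<^sub>R (c *\<^sub>R x)) \<le> (1/c) * q (c *\<^sub>R x)"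
    using assms(1) c unfolding sublinear_on_def by (meson divide_pos_pos zero_less_one)
  then have "c * q x \<le> q (c *\<^sub>R x)" using c by (simp add: field_simps)
  moreover have "q (c *\<^sub>R x) \<le> c * q x"
    using assms c unfolding sublinear_on_def by auto
  ultimately show ?thesis by simp
qed

lemma sublinear_on_lower:
  assumes "sublinear_on W q" "subspace W" "x \<in> W"
  shows "- q (- x) \<le> q x"
proof -
  have "q (0 *\<^sub>R x) = 0 * q x" using assms by (intro sublinear_on_scale) auto
  moreover have "q (x + - x) \<le> q x + q (- x)"
    using assms subspace_neg unfolding sublinear_on_def by blast
  ultimately show ?thesis by simp
qed

text \<open>This is the device that makes a sublinear functional linear in the direction of
  \<open>z\<close>: \<open>t = 0\<close> shows that \<open>q'\<close> lies below \<open>q\<close>,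
  and \<open>t = 1\<close> that \<open>q' (- z) \<le> - q z\<close>. The infimum is finite because
  subadditivity bounds it below by \<open>- q (- x)\<close>.\<close>

lemma sublinear_on_shift:
  fixes q :: "'v::real_vector \<Rightarrow> real"
  assumes q: "sublinear_on W q" and W: "subspace W" and z: "z \<in> W"
  defines "q' \<equiv> \<lambda>x. INF t\<in>{0..}. q (x + t *\<^sub>R z) - t * q z"
  shows "sublinear_on W q'" "\<And>x t. x \<in> W \<Longrightarrow> 0 \<le> t \<Longrightarrow> q' x \<le> q (x + t *\<^sub>R z) - t * q z"
proof -
  have q'_eq: "q' x = (INF t\<in>{0..}. q (x + t *\<^sub>R z) - t * q z)" for x
    by (simp add: q'_def)
  have sub: "q (x + y) \<le> q x + q y" if "x \<in> W" "y \<in> W" for x y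
    using q that by (auto simp: sublinear_on_def)
  have scl: "t *\<^sub>R x \<in> W" if "x \<in> W" for t x using W that subspace_scale by blast
  have add: "x + y \<in> W" if "x \<in> W" "y \<in> W" for x y using W that subspace_add by blast
  have neg: "- x \<in> W" if "x \<in> W" for x using W that subspace_neg by blast
  have bdd: "bdd_below ((\<lambda>t. q (x + t *\<^sub>R z) - t * q z) ` {0..})" if x: "x \<in> W" for x
  proof (rule bdd_belowI2[where m = "- q (- x)"])
    fix t :: real assume t: "t \<in> {0..}"
    have "q ((x + t *\<^sub>R z) + - x) \<le> q (x + t *\<^sub>R z) + q (- x)"
      using x z by (intro sub add scl neg)
    moreover have "q (t *\<^sub>R z) = t * q z" using t z W q by (intro sublinear_on_scale) auto
    ultimately show "- q (- x) \<le> q (x + t *\<^sub>R z) - t * q z" by simp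
  qed
  show le: "q' x \<le> q (x + t *\<^sub>R z) - t * q z" if "x \<in> W" "0 \<le> t" for x t
    unfolding q'_def using bdd that by (intro cINF_lower) auto
  have "q' (x + y) \<le> q' x + q' y" if x: "x \<in> W" and y: "y \<in> W" for x y
  proof -
    have *: "q' (x + y) \<le> (q (x + s *\<^sub>R z) - s * q z) + (q (y + t *\<^sub>R z) - t * q z)" if "0 \<le> s" "0 \<le> t" for s t
    proof -
      have "q' (x + y) \<le> q ((x + y) + (s + t) *\<^sub>R z) - (s + t) * q z"
        using that x y add by (intro le) auto
      also have "(x + y) + (s + t) *\<^sub>R z = (x + s *\<^sub>R z) + (y + t *\<^sub>R z)"
        by (simp add: algebra_simps)
      also have "q \<dots> - (s + t) * q z \<le> q (x + s *\<^sub>R z) + q (y + t *\<^sub>R z) - (s + t) * q z"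
        using sub[of "x + s *\<^sub>R z" "y + t *\<^sub>R z"] x y z add scl by simp
      finally show ?thesis by (simp add: algebra_simps)
    qed
    have "q' (x + y) - (q (y + t *\<^sub>R z) - t * q z) \<le> q' x" if "0 \<le> t" for t
      unfolding q'_eq[of x]
    proof (rule cINF_greatest)
      fix s :: real assume "s \<in> {0..}"
      then show "q' (x + y) - (q (y + t *\<^sub>R z) - t * q z) \<le> q (x + s *\<^sub>R z) - s * q z"
        using *[of s t] that by simp
    qed auto
    then have "q' (x + y) - q' x \<le> q (y + t *\<^sub>R z) - t * q z" if "0 \<le> t" for t
      using that by (smt (verit))
    then have "q' (x + y) - q' x \<le> q' y"
      unfolding q'_eq[of y] by (intro cINF_greatest) auto
    then show ?thesis by simp
  qed
  moreover have "q' (c *\<^sub>R x) \<le> c * q' x" if x: "x \<in> W" and c: "c > 0" for x c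
  proof -
    have "q' (c *\<^sub>R x) / c \<le> q' x"
      unfolding q'_eq[of x]
    proof (rule cINF_greatest)
      fix s :: real assume s: "s \<in> {0..}"
      have "q' (c *\<^sub>R x) \<le> q (c *\<^sub>R x + (c * s) *\<^sub>R z) - (c * s) * q z"
        using s c x scl by (intro le) auto
      also have "c *\<^sub>R x + (c * s) *\<^sub>R z = c *\<^sub>R (x + s *\<^sub>R z)"
        by (simp add: algebra_simps)
      also have "q \<dots> = c * q (x + s *\<^sub>R z)"
        using x z c W q add scl by (intro sublinear_on_scale) auto
      finally show "q' (c *\<^sub>R x) / c \<le> q (x + s *\<^sub>R z) - s * q z"
        using c by (simp add: field_simps)
    qed auto
    then show ?thesis using c by (simp add: field_simps)
  qed
  ultimately show "sublinear_on W q'" by (auto simp: sublinear_on_def)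
qed

text \<open>A minimal sublinear functional \<open>q\<close> agrees with each of its shifts, that is,
  \<open>q (x + z) \<ge> q x + q z\<close>, and hence is linear.\<close>

lemma hahn_banach_sublinear:
  fixes p :: "'v::real_vector \<Rightarrow> real"
  assumes p: "sublinear_on W p" and W: "subspace W" and z: "z \<in> W"
  shows "\<exists>g. (\<forall>x\<in>W. \<forall>y\<in>W. g (x + y) = g x + g y) \<and> (\<forall>x\<in>W. \<forall>c. g (c *\<^sub>R x) = c * g x) \<and>
    (\<forall>x\<in>W. g x \<le> p x) \<and> g z = p z"
proof -
  have scl: "t *\<^sub>R x \<in> W" if "x \<in> W" for t x using W that subspace_scale by blast
  have add: "x + y \<in> W" if "x \<in> W" "y \<in> W" for x y using W that subspace_add by blast
  have neg: "- x \<in> W" if "x \<in> W" for x using W that subspace_neg by blast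
  \<comment> \<open>Starting below \<open>p'\<close> instead of \<open>p\<close> secures the value
    at \<open>z\<close>: \<open>t = 1\<close> will give \<open>g (- z) \<le> - p z\<close>.\<close>
  define p' where "p' = (\<lambda>x. INF t\<in>{0..}. p (x + t *\<^sub>R z) - t * p z)"
  have p': "sublinear_on W p'" "p' x \<le> p (x + t *\<^sub>R z) - t * p z" if "x \<in> W" "0 \<le> t" for x t
    using sublinear_on_shift[OF p W z] that unfolding p'_def by auto
  define A where "A = {q. sublinear_on W q \<and> (\<forall>x\<in>W. q x \<le> p' x) \<and> (\<forall>x. x \<notin> W \<longrightarrow> q x = 0)}"
  \<comment> \<open>The order is reversed, so that a maximal element in the sense of Zorn's lemma is
    a minimal functional.\<close>
  define P where "P = (\<lambda>(a::'v \<Rightarrow> real) u. \<forall>x. u x \<le> a x)"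
  have P_iff: "P a u \<longleftrightarrow> u \<le> a" for a u by (simp add: P_def le_fun_def)
  have "\<exists>m\<in>A. \<forall>a\<in>A. P m a \<longrightarrow> a = m"
  proof (rule predicate_Zorn)
    show "partial_order_on A (relation_of P A)"
      by (rule partial_order_on_relation_ofI) (auto simp: P_iff)
    fix C assume C: "C \<in> Chains (relation_of P A)"
    have CA: "C \<subseteq> A" using C by (auto simp: Chains_def relation_of_def)
    have tot: "P a b \<or> P b a" if "a \<in> C" "b \<in> C" for a b
      using C that by (auto simp: Chains_def relation_of_def)
    show "\<exists>u\<in>A. \<forall>a\<in>C. P a u"
    proof (cases "C = {}")
      case True
      have "sublinear_on W (\<lambda>x. if x \<in> W then p' x else 0)"
        using p'(1)[OF z, of 0] add scl by (auto simp: sublinear_on_def)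
      then have "(\<lambda>x. if x \<in> W then p' x else 0) \<in> A" by (auto simp: A_def)
      then show ?thesis using True by blast
    next
      case False
      define u where "u = (\<lambda>x. if x \<in> W then INF a\<in>C. a x else 0)"
      have lb: "- p' (- x) \<le> a x" if "a \<in> C" "x \<in> W" for a x
        using sublinear_on_lower[of W a x] that CA W neg[of x] unfolding A_def by force
      have le: "u x \<le> a x" if "a \<in> C" for a x
      proof (cases "x \<in> W")
        case True
        then show ?thesis unfolding u_def using lb that
          by (auto intro!: cINF_lower bdd_belowI2)
      next
        case False
        then show ?thesis using that CA by (auto simp: A_def u_def)
      qed
      have gr: "c \<le> u x" if "x \<in> W" "\<And>a. a \<in> C \<Longrightarrow> c \<le> a x" for c x
        unfolding u_def using that False by (auto intro!: cINF_greatest)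
      have "u (x + y) \<le> u x + u y" if x: "x \<in> W" and y: "y \<in> W" for x y
      proof -
        have "u (x + y) \<le> a x + b y" if a: "a \<in> C" and b: "b \<in> C" for a b
        proof -
          obtain c where c: "c \<in> C" "c x \<le> a x" "c y \<le> b y"
            using tot[OF a b] a b unfolding P_def by blast
          have "u (x + y) \<le> c (x + y)" using c le by auto
          also have "\<dots> \<le> c x + c y"
            using c CA x y unfolding A_def sublinear_on_def by blast
          finally show ?thesis using c by simp
        qed
        then have "u (x + y) - b y \<le> u x" if "b \<in> C" for b
          using that x by (intro gr) (auto simp: algebra_simps)
        then have "u (x + y) - u x \<le> u y"
          using y by (intro gr) (auto simp: algebra_simps)
        then show ?thesis by simp
      qed
      moreover have "u (c *\<^sub>R x) \<le> c * u x" if x: "x \<in> W" and c: "c > 0" for x c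
      proof -
        have "u (c *\<^sub>R x) / c \<le> u x"
        proof (rule gr[OF x])
          fix a assume a: "a \<in> C"
          have "u (c *\<^sub>R x) \<le> a (c *\<^sub>R x)" using a le by auto
          also have "\<dots> \<le> c * a x" using a CA x c unfolding A_def sublinear_on_def by blast
          finally show "u (c *\<^sub>R x) / c \<le> a x" using c by (simp add: field_simps)
        qed
        then show ?thesis using c by (simp add: field_simps)
      qed
      ultimately have "sublinear_on W u" by (auto simp: sublinear_on_def)
      moreover have "u x \<le> p' x" if x: "x \<in> W" for x
      proof -
        obtain a where "a \<in> C" using False by auto
        then show ?thesis using le[of a x] CA x unfolding A_def by force
      qed
      ultimately have "u \<in> A" by (auto simp: A_def u_def)
      then show ?thesis using le unfolding P_def by blast
    qed
  qed
  then obtain g where g: "g \<in> A" and min: "\<And>a. a \<in> A \<Longrightarrow> \<forall>x. a x \<le> g x \<Longrightarrow> a = g"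
    unfolding P_def by blast
  have gs: "sublinear_on W g" and gle: "\<And>x. x \<in> W \<Longrightarrow> g x \<le> p' x" using g by (auto simp: A_def)
  have super: "g x + g y \<le> g (x + y)" if x: "x \<in> W" and y: "y \<in> W" for x y
  proof -
    define h where "h = (\<lambda>x. if x \<in> W then INF t\<in>{0..}. g (x + t *\<^sub>R y) - t * g y else 0)"
    have h: "sublinear_on W (\<lambda>x. INF t\<in>{0..}. g (x + t *\<^sub>R y) - t * g y)"
      "h x \<le> g (x + t *\<^sub>R y) - t * g y" if "x \<in> W" "0 \<le> t" for x t
      using sublinear_on_shift[OF gs W y] that unfolding h_def by auto
    have hs: "sublinear_on W h"
      using h(1)[OF z order_refl] add scl unfolding sublinear_on_def h_def by auto
    have hg: "h x \<le> g x" if "x \<in> W" for x using h(2)[OF that order_refl] by simp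
    then have "h \<in> A" using hs gle g unfolding A_def h_def by force
    moreover have "h x \<le> g x" for x using hg[of x] g unfolding A_def h_def by auto
    ultimately have "h = g" by (intro min) auto
    then show ?thesis using h(2)[OF x, of 1] by simp
  qed
  have gadd: "g (x + y) = g x + g y" if "x \<in> W" "y \<in> W" for x y
    using super[OF that] gs that unfolding sublinear_on_def by (meson order_antisym)
  have gpos: "g (c *\<^sub>R x) = c * g x" if "x \<in> W" "c \<ge> 0" for c x
    using sublinear_on_scale[OF gs W] that by auto
  have gneg: "g (- x) = - g x" if "x \<in> W" for x
    using gadd[OF that neg[OF that]] gpos[OF that, of 0] by simp
  have gscale: "g (c *\<^sub>R x) = c * g x" if "x \<in> W" for c x
    using gpos[OF that, of c] gpos[OF neg[OF that], of "- c"] gneg[OF that]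
    by (cases "c \<ge> 0") auto
  have glep: "g x \<le> p x" if "x \<in> W" for x
    using gle[OF that] p'(2)[OF that order_refl] by simp
  have "p 0 = 0" using sublinear_on_scale[OF p W z, of 0] by simp
  then have "g (- z) \<le> - p z"
    using gle[OF neg[OF z]] p'(2)[OF neg[OF z], of 1] by simp
  then have "g z = p z" using gneg[OF z] glep[OF z] by simp
  then show ?thesis using gadd gscale glep by blast
qed

section \<open>Functionals vanishing on a subspace and norming functionals\<close>

lemma sublinear_on_infdist:
  fixes S :: "'a::real_normed_vector set"
  assumes S: "subspace S"
  shows "sublinear_on UNIV (\<lambda>x. infdist x S)"
proof -
  have ne: "S \<noteq> {}" using S subspace_0 by blast
  have att: "\<exists>a\<in>S. dist x a < c" if "infdist x S < c" for x c
    using cInf_lessD[of "dist x ` S" c] ne that by (auto simp: infdist_notempty)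
  have "infdist (x + y) S \<le> infdist x S + infdist y S" for x y
  proof (rule field_le_epsilon)
    fix e :: real assume e: "e > 0"
    obtain a where a: "a \<in> S" "dist x a < infdist x S + e/2"
      using att[of x "infdist x S + e/2"] e by auto
    obtain b where b: "b \<in> S" "dist y b < infdist y S + e/2"
      using att[of y "infdist y S + e/2"] e by auto
    have "infdist (x + y) S \<le> dist (x + y) (a + b)"
      using a b S subspace_add by (intro infdist_le) blast
    also have "\<dots> \<le> dist x a + dist y b" by (rule dist_triangle_add)
    finally show "infdist (x + y) S \<le> infdist x S + infdist y S + e" using a b by simp
  qed
  moreover have "infdist (c *\<^sub>R x) S \<le> c * infdist x S" if c: "c > 0" for c x
  proof (rule field_le_epsilon)
    fix e :: real assume e: "e > 0"
    obtain a where a: "a \<in> S" "dist x a < infdist x S + e/c"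
      using att[of x "infdist x S + e/c"] e c by auto
    have "infdist (c *\<^sub>R x) S \<le> dist (c *\<^sub>R x) (c *\<^sub>R a)"
      using a S subspace_scale by (intro infdist_le) blast
    also have "\<dots> = c * dist x a"
      using c by (simp add: dist_norm flip: scaleR_diff_right)
    also have "\<dots> \<le> c * (infdist x S + e/c)" using a c by simp
    also have "\<dots> = c * infdist x S + e" using c by (simp add: algebra_simps)
    finally show "infdist (c *\<^sub>R x) S \<le> c * infdist x S + e" .
  qed
  ultimately show ?thesis by (auto simp: sublinear_on_def)
qed

text \<open>The distance to \<open>S\<close> vanishes on \<open>S\<close> and is at most the norm. A
  linear functional below it that touches it at \<open>z\<close> inherits both properties, since it
  can be estimated at \<open>x\<close> and at \<open>- x\<close>.\<close>

lemma hahn_banach_infdist: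
  fixes S :: "'a::real_normed_vector set"
  assumes S: "subspace S"
  obtains g :: "'a \<Rightarrow> real" where "linear g" "\<And>x. \<bar>g x\<bar> \<le> norm x" "\<And>x. x \<in> S \<Longrightarrow> g x = 0"
    "g z = infdist z S"
proof -
  obtain g where g: "\<And>x y. g (x + y) = g x + g y" "\<And>c x. g (c *\<^sub>R x) = c * g x"
      "\<And>x. g x \<le> infdist x S" "g z = infdist z S"
    using hahn_banach_sublinear[OF sublinear_on_infdist[OF S] subspace_UNIV UNIV_I[of z]]
    by (metis UNIV_I)
  have lin: "linear g" using g by (intro linearI) auto
  have le: "infdist x S \<le> norm x" for x
    using infdist_le[of 0 S x] subspace_0[OF S] by simp
  have neg: "g (- x) = - g x" for x using lin by (rule linear_neg)
  have "\<bar>g x\<bar> \<le> norm x" for x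
    using g(3)[of x] g(3)[of "- x"] le[of x] le[of "- x"] by (auto simp: neg)
  moreover have "g x = 0" if "x \<in> S" for x
  proof -
    have "g x \<le> 0" "g (- x) \<le> 0"
      using g(3)[of x] g(3)[of "- x"] that subspace_neg[OF S that] by auto
    then show ?thesis by (simp add: neg)
  qed
  ultimately show thesis using that lin g(4) by blast
qed

corollary norming_functional:
  fixes z :: "'a::real_normed_vector"
  obtains g :: "'a \<Rightarrow> real" where "linear g" "\<And>x. \<bar>g x\<bar> \<le> norm x" "g z = norm z"
proof -
  have "infdist z {0} = norm z" by simp
  then show thesis using hahn_banach_infdist[OF subspace_single_0, of z] that by metis
qed

text \<open>This makes \<open>hahn_banach_sublinear\<close> applicable to spaces of bounded
  functions.\<close>

instantiation "fun" :: (type, real_vector) real_vector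
begin

definition "c *\<^sub>R f = (\<lambda>x. c *\<^sub>R f x)"

instance
  by standard (simp_all add: scaleR_fun_def fun_eq_iff scaleR_add_right scaleR_add_left)

end

section \<open>Generalized limits and invariant means\<close>

text \<open>Positivity and normalization are packed into the one-sided clause: applied to
  \<open>- f\<close> it gives the lower bound, and both bounds together evaluate constants.\<close>

definition is_mean :: "'i filter \<Rightarrow> (('i \<Rightarrow> real) \<Rightarrow> real) \<Rightarrow> bool"
  where "is_mean F m \<longleftrightarrow>
    (\<forall>f g. Bfun f F \<longrightarrow> Bfun g F \<longrightarrow> m (\<lambda>i. f i + g i) = m f + m g) \<and>
    (\<forall>f c. Bfun f F \<longrightarrow> m (\<lambda>i. c * f i) = c * m f) \<and>
    (\<forall>f c. Bfun f F \<longrightarrow> (\<forall>\<^sub>F i in F. f i \<le> c) \<longrightarrow> m f \<le> c)"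

text \<open>Let \<open>p f\<close> be the infimum of all eventual upper bounds of \<open>T f\<close>
  with \<open>T \<in> A\<close>, and take a linear functional below \<open>p\<close>. Subadditivity
  of \<open>p\<close> is where commutativity enters: if \<open>T\<close> is good for
  \<open>f\<close> and \<open>U\<close> for \<open>g\<close>, then \<open>T \<circ> U\<close> is
  good for both. The choice \<open>A = {id}\<close> gives generalized limits; averaging operators
  give invariant means.\<close>

lemma mean_exists:
  fixes F :: "'i filter" and A :: "(('i \<Rightarrow> real) \<Rightarrow> 'i \<Rightarrow> real) set"
  assumes F: "F \<noteq> bot" and id: "id \<in> A"
    and comp: "\<And>T U. T \<in> A \<Longrightarrow> U \<in> A \<Longrightarrow> T \<circ> U \<in> A \<and> T \<circ> U = U \<circ> T"
    and add: "\<And>T f g. T \<in> A \<Longrightarrow> T (\<lambda>i. f i + g i) = (\<lambda>i. T f i + T g i)"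
    and scale: "\<And>T c f. T \<in> A \<Longrightarrow> T (\<lambda>i. c * f i) = (\<lambda>i. c * T f i)"
    and mono: "\<And>T f c. T \<in> A \<Longrightarrow> \<forall>\<^sub>F i in F. f i \<le> c \<Longrightarrow> \<forall>\<^sub>F i in F. T f i \<le> c"
  obtains m where "is_mean F m"
    "\<And>T f c. T \<in> A \<Longrightarrow> Bfun f F \<Longrightarrow> \<forall>\<^sub>F i in F. T f i \<le> c \<Longrightarrow> m f \<le> c"
proof -
  define W :: "('i \<Rightarrow> real) set" where "W = {f. Bfun f F}"
  have Bf: "Bfun f F \<longleftrightarrow> (\<exists>C. \<forall>\<^sub>F i in F. \<bar>f i\<bar> \<le> C)" for f :: "'i \<Rightarrow> real"
  proof
    assume "Bfun f F"
    then show "\<exists>C. \<forall>\<^sub>F i in F. \<bar>f i\<bar> \<le> C" by (rule BfunE) auto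
  next
    assume "\<exists>C. \<forall>\<^sub>F i in F. \<bar>f i\<bar> \<le> C"
    then obtain C where "\<forall>\<^sub>F i in F. norm (f i) \<le> C" by auto
    then show "Bfun f F" by (rule BfunI)
  qed
  have W: "subspace W"
    unfolding subspace_def
  proof (intro conjI ballI allI)
    show "0 \<in> W" by (auto simp: W_def Bf zero_fun_def intro!: exI[of _ 0])
    fix f g :: "'i \<Rightarrow> real" assume "f \<in> W"
    then obtain C where C: "\<forall>\<^sub>F i in F. \<bar>f i\<bar> \<le> C" by (auto simp: W_def Bf)
    show "c *\<^sub>R f \<in> W" for c
    proof -
      have "\<forall>\<^sub>F i in F. \<bar>c * f i\<bar> \<le> \<bar>c\<bar> * C"
        using C by eventually_elim (auto simp: abs_mult intro: mult_left_mono)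
      then show ?thesis by (auto simp: W_def Bf scaleR_fun_def)
    qed
    assume "g \<in> W"
    then obtain D where D: "\<forall>\<^sub>F i in F. \<bar>g i\<bar> \<le> D" by (auto simp: W_def Bf)
    have "\<forall>\<^sub>F i in F. \<bar>f i + g i\<bar> \<le> C + D" using C D by eventually_elim linarith
    then show "f + g \<in> W" by (auto simp: W_def Bf plus_fun_def)
  qed
  define p where "p = (\<lambda>f. Inf {c. \<exists>T\<in>A. \<forall>\<^sub>F i in F. T f i \<le> c})"
  have ne: "{c. \<exists>T\<in>A. \<forall>\<^sub>F i in F. T f i \<le> c} \<noteq> {}" if f: "f \<in> W" for f
  proof -
    obtain C where C: "\<forall>\<^sub>F i in F. \<bar>f i\<bar> \<le> C" using f by (auto simp: W_def Bf)
    then have "\<forall>\<^sub>F i in F. f i \<le> C" by eventually_elim linarith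
    then show ?thesis using id by (auto intro!: exI[of _ C] bexI[of _ id])
  qed
  have bdd: "bdd_below {c. \<exists>T\<in>A. \<forall>\<^sub>F i in F. T f i \<le> c}" if f: "f \<in> W" for f
  proof -
    obtain C where C: "\<forall>\<^sub>F i in F. \<bar>f i\<bar> \<le> C" using f by (auto simp: W_def Bf)
    then have *: "\<forall>\<^sub>F i in F. (-1) * f i \<le> C" by eventually_elim linarith
    have "- C \<le> c" if T: "T \<in> A" and c: "\<forall>\<^sub>F i in F. T f i \<le> c" for T c
    proof -
      have "\<forall>\<^sub>F i in F. (-1) * T f i \<le> C"
        using mono[OF T *] unfolding scale[OF T] .
      with c have "\<forall>\<^sub>F i in F. - C \<le> c" by eventually_elim linarith
      then show ?thesis using F by (simp add: eventually_const)
    qed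
    then show ?thesis by (auto intro!: bdd_belowI[of _ "- C"])
  qed
  have ple: "p f \<le> c" if "f \<in> W" "T \<in> A" "\<forall>\<^sub>F i in F. T f i \<le> c" for f T c
    unfolding p_def using bdd that by (auto intro!: cInf_lower)
  have pgt: "\<exists>T\<in>A. \<forall>\<^sub>F i in F. T f i \<le> p f + e" if fe: "f \<in> W" "e > 0" for f e
  proof -
    obtain c T where c: "T \<in> A" "\<forall>\<^sub>F i in F. T f i \<le> c" "c < p f + e"
      using cInf_lessD[OF ne[OF fe(1)], of "p f + e"] fe unfolding p_def by auto
    from c(2) have "\<forall>\<^sub>F i in F. T f i \<le> p f + e"
      by eventually_elim (use c(3) in simp)
    then show ?thesis using c(1) by blast
  qed
  have "p (f + g) \<le> p f + p g" if f: "f \<in> W" and g: "g \<in> W" for f g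
  proof (rule field_le_epsilon)
    fix e :: real assume e: "e > 0"
    obtain T where T: "T \<in> A" "\<forall>\<^sub>F i in F. T f i \<le> p f + e/2" using pgt[OF f, of "e/2"] e by auto
    obtain U where U: "U \<in> A" "\<forall>\<^sub>F i in F. U g i \<le> p g + e/2" using pgt[OF g, of "e/2"] e by auto
    have TU: "T \<circ> U \<in> A" "T \<circ> U = U \<circ> T" using comp T U by auto
    have "\<forall>\<^sub>F i in F. U (T f) i \<le> p f + e/2" "\<forall>\<^sub>F i in F. T (U g) i \<le> p g + e/2"
      using mono T U by auto
    then have "\<forall>\<^sub>F i in F. U (T f) i + T (U g) i \<le> p f + p g + e"
      by eventually_elim simp
    moreover have TU_eq: "(T \<circ> U) (f + g) i = U (T f) i + T (U g) i" for i
    proof -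
      have "(T \<circ> U) (f + g) i = (T \<circ> U) f i + (T \<circ> U) g i"
        using add[OF TU(1), of f g] by (simp add: plus_fun_def)
      also have "(T \<circ> U) f = U (T f)" using TU(2) by (metis comp_apply)
      finally show ?thesis by (simp only: comp_apply)
    qed
    ultimately have "\<forall>\<^sub>F i in F. (T \<circ> U) (f + g) i \<le> p f + p g + e"
      by simp
    then show "p (f + g) \<le> p f + p g + e"
      using ple[OF _ TU(1)] subspace_add[OF W f g] by blast
  qed
  moreover have "p (c *\<^sub>R f) \<le> c * p f" if f: "f \<in> W" and c: "c > 0" for c f
  proof (rule field_le_epsilon)
    fix e :: real assume e: "e > 0"
    obtain T where T: "T \<in> A" "\<forall>\<^sub>F i in F. T f i \<le> p f + e/c" using pgt[OF f, of "e/c"] e c by auto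
    have Tc: "T (c *\<^sub>R f) i = c * T f i" for i
      using scale[OF T(1), of c f] by (simp add: scaleR_fun_def)
    from T(2) have "\<forall>\<^sub>F i in F. T (c *\<^sub>R f) i \<le> c * p f + e"
      by eventually_elim (use c in \<open>simp add: Tc field_simps\<close>)
    then show "p (c *\<^sub>R f) \<le> c * p f + e"
      using ple[OF _ T(1)] subspace_scale[OF W f] by blast
  qed
  ultimately have "sublinear_on W p" by (auto simp: sublinear_on_def)
  then obtain m where m: "\<And>f g. f \<in> W \<Longrightarrow> g \<in> W \<Longrightarrow> m (f + g) = m f + m g"
    "\<And>c f. f \<in> W \<Longrightarrow> m (c *\<^sub>R f) = c * m f" "\<And>f. f \<in> W \<Longrightarrow> m f \<le> p f"
    using hahn_banach_sublinear[OF _ W subspace_0[OF W], of p] by metis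
  have le: "m f \<le> c" if "T \<in> A" "Bfun f F" "\<forall>\<^sub>F i in F. T f i \<le> c" for T f c
    using m(3)[of f] ple[of f T c] that by (auto simp: W_def)
  have "is_mean F m"
    using m le[OF id] by (auto simp: is_mean_def W_def plus_fun_def scaleR_fun_def)
  then show thesis using that le by blast
qed

lemma generalized_limit:
  assumes "F \<noteq> bot"
  obtains m where "is_mean F m"
  by (rule mean_exists[of F "{id}"]) (use assms in auto)

lemma is_mean_add: "is_mean F m \<Longrightarrow> Bfun f F \<Longrightarrow> Bfun g F \<Longrightarrow> m (\<lambda>i. f i + g i) = m f + m g"
  and is_mean_scale: "is_mean F m \<Longrightarrow> Bfun f F \<Longrightarrow> m (\<lambda>i. c * f i) = c * m f"
  and is_mean_le: "is_mean F m \<Longrightarrow> Bfun f F \<Longrightarrow> \<forall>\<^sub>F i in F. f i \<le> c \<Longrightarrow> m f \<le> c"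
  by (simp_all add: is_mean_def)

lemma is_mean_ge:
  assumes m: "is_mean F m" and f: "Bfun f F" and ge: "\<forall>\<^sub>F i in F. c \<le> f i"
  shows "c \<le> m f"
proof -
  have "m (\<lambda>i. (-1) * f i) = (-1) * m f" by (rule is_mean_scale[OF m f])
  moreover have "Bfun (\<lambda>i. (-1) * f i) F" using f unfolding Bfun_def by simp
  moreover have "\<forall>\<^sub>F i in F. (-1) * f i \<le> - c" using ge by eventually_elim simp
  ultimately show ?thesis using is_mean_le[OF m, of "\<lambda>i. (-1) * f i" "- c"] by simp
qed

lemma Bfun_add:
  fixes f g :: "'i \<Rightarrow> 'b::real_normed_vector"
  assumes "Bfun f F" "Bfun g F"
  shows "Bfun (\<lambda>i. f i + g i) F"
proof -
  obtain C D where "\<forall>\<^sub>F i in F. norm (f i) \<le> C" "\<forall>\<^sub>F i in F. norm (g i) \<le> D"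
    using assms by (metis BfunE)
  then have "\<forall>\<^sub>F i in F. norm (f i + g i) \<le> C + D"
    by eventually_elim (meson add_mono norm_triangle_le)
  then show ?thesis by (rule BfunI)
qed

lemma Bfun_bounded_linear:
  assumes "bounded_linear h" "Bfun f F"
  shows "Bfun (\<lambda>i. h (f i)) F"
proof -
  obtain C where C: "\<forall>\<^sub>F i in F. norm (f i) \<le> C" using assms(2) by (metis BfunE)
  obtain K where K: "K \<ge> 0" "\<And>x. norm (h x) \<le> norm x * K"
    using bounded_linear.nonneg_bounded[OF assms(1)] by auto
  from C have "\<forall>\<^sub>F i in F. norm (h (f i)) \<le> C * K"
    by eventually_elim (meson K mult_right_mono order_trans)
  then show ?thesis by (rule BfunI)
qed

lemma Bfun_minus: "Bfun f F \<Longrightarrow> Bfun (\<lambda>i. - f i :: 'b::real_normed_vector) F"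
  by (simp add: Bfun_def)

lemma Bfun_diff:
  "Bfun f F \<Longrightarrow> Bfun g F \<Longrightarrow> Bfun (\<lambda>i. f i - g i :: 'b::real_normed_vector) F"
  using Bfun_add[OF _ Bfun_minus] by fastforce

lemma is_mean_diff:
  assumes "is_mean F m" "Bfun f F" "Bfun g F"
  shows "m (\<lambda>i. f i - g i) = m f - m g"
  using is_mean_add[OF assms(1,2) Bfun_minus[OF assms(3)]] is_mean_scale[OF assms(1,3), of "-1"]
  by simp

lemma is_mean_cong:
  assumes m: "is_mean F m" and f: "Bfun f F" and eq: "\<forall>\<^sub>F i in F. g i = f i"
  shows "m g = m f"
proof -
  obtain C where C: "\<forall>\<^sub>F i in F. norm (f i) \<le> C" using f by (rule BfunE)
  have "\<forall>\<^sub>F i in F. norm (g i) \<le> C" using C eq by eventually_elim simp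
  then have g: "Bfun g F" by (rule BfunI)
  have d: "Bfun (\<lambda>i. g i - f i) F" using Bfun_diff[OF g f] .
  have "m (\<lambda>i. g i - f i) \<le> 0"
    by (rule is_mean_le[OF m d]) (use eq in eventually_elim, simp)
  moreover have "0 \<le> m (\<lambda>i. g i - f i)"
    by (rule is_mean_ge[OF m d]) (use eq in eventually_elim, simp)
  ultimately show ?thesis using is_mean_diff[OF m g f] by simp
qed

section \<open>Translation-invariant means\<close>

definition shift_average :: "nat \<times> 'a::real_vector \<Rightarrow> ('a \<Rightarrow> real) \<Rightarrow> 'a \<Rightarrow> real"
  where "shift_average p f y = (\<Sum>i<fst p. f (y + real i *\<^sub>R snd p)) / real (fst p)"

text \<open>A pair holds the length of an average and the translation it runs along. Lists of pairs
  form a commuting family closed under composition, as \<open>mean_exists\<close> demands: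
  composition is \<open>append\<close>.\<close>

primrec shift_averages :: "(nat \<times> 'a::real_vector) list \<Rightarrow> ('a \<Rightarrow> real) \<Rightarrow> 'a \<Rightarrow> real"
  where "shift_averages [] f = f"
  | "shift_averages (p # ps) f = shift_average p (shift_averages ps f)"

lemma shift_average_commute: "shift_average p (shift_average q f) = shift_average q (shift_average p f)"
proof
  fix y
  have "(\<Sum>i<fst p. \<Sum>j<fst q. f (y + real i *\<^sub>R snd p + real j *\<^sub>R snd q)) =
    (\<Sum>j<fst q. \<Sum>i<fst p. f (y + real j *\<^sub>R snd q + real i *\<^sub>R snd p))"
    by (subst sum.swap) (simp add: add_ac)
  then show "shift_average p (shift_average q f) y = shift_average q (shift_average p f) y"
    by (simp add: shift_average_def flip: sum_divide_distrib)
qed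

lemma shift_averages_append: "shift_averages (ps @ qs) f = shift_averages ps (shift_averages qs f)"
  by (induction ps) auto

lemma shift_average_averages: "shift_average p (shift_averages ps f) = shift_averages ps (shift_average p f)"
  by (induction ps) (auto simp: shift_average_commute)

lemma shift_averages_commute:
  "shift_averages ps (shift_averages qs f) = shift_averages qs (shift_averages ps f)"
  by (induction ps) (auto simp: shift_average_averages)

text \<open>Averaging \<open>f (y + s) - f y\<close> over \<open>N + 1\<close> successive translates
  by \<open>s\<close> telescopes to a difference of two values of \<open>f\<close> divided by
  \<open>N + 1\<close>, so its mean is at most 0. The same for \<open>- s\<close> gives
  equality.\<close>

lemma invariant_mean:
  fixes E :: "'a::real_vector set"
  assumes E: "subspace E"
  shows "\<exists>m. is_mean (principal E) m \<and>
    (\<forall>f s. Bfun f (principal E) \<longrightarrow> s \<in> E \<longrightarrow> m (\<lambda>y. f (y + s)) = m f)"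
proof -
  define A where "A = {shift_averages ps | ps. \<forall>p\<in>set ps. fst p > 0 \<and> snd p \<in> E}"
  have AE: "\<exists>ps. T = shift_averages ps \<and> (\<forall>p\<in>set ps. fst p > 0 \<and> snd p \<in> E)" if "T \<in> A" for T
    using that by (auto simp: A_def)
  have mono: "\<forall>\<^sub>F y in principal E. shift_averages ps f y \<le> c"
    if "\<forall>\<^sub>F y in principal E. f y \<le> c" "\<forall>p\<in>set ps. fst p > 0 \<and> snd p \<in> E" for ps f and c :: real
    using that
  proof (induction ps)
    case (Cons p ps)
    then have *: "\<And>y. y \<in> E \<Longrightarrow> shift_averages ps f y \<le> c" and p: "fst p > 0" "snd p \<in> E"
      by (auto simp: eventually_principal)
    have "shift_average p (shift_averages ps f) y \<le> c" if "y \<in> E" for y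
    proof -
      have "(\<Sum>i<fst p. shift_averages ps f (y + real i *\<^sub>R snd p)) \<le> (\<Sum>i<fst p. c)"
        using E p that by (intro sum_mono *) (simp add: subspace_add subspace_scale)
      then show ?thesis using p by (simp add: shift_average_def field_simps)
    qed
    then show ?case by (simp add: eventually_principal)
  qed simp
  obtain m where m: "is_mean (principal E) m"
    "\<And>T f c. T \<in> A \<Longrightarrow> Bfun f (principal E) \<Longrightarrow> \<forall>\<^sub>F y in principal E. T f y \<le> c \<Longrightarrow> m f \<le> c"
  proof (rule mean_exists[of "principal E" A])
    show "principal E \<noteq> bot" using subspace_0[OF E] by (auto simp: principal_eq_bot_iff)
    have "shift_averages [] \<in> A" unfolding A_def by (intro CollectI exI[of _ "[]"]) auto
    moreover have "shift_averages [] = (id :: ('a \<Rightarrow> real) \<Rightarrow> _)" by (auto simp: fun_eq_iff)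
    ultimately show "id \<in> A" by simp
    fix T assume "T \<in> A"
    then obtain ps where T: "T = shift_averages ps" and ps: "\<forall>p\<in>set ps. fst p > 0 \<and> snd p \<in> E"
      using AE by blast
    show "T (\<lambda>i. f i + g i) = (\<lambda>i. T f i + T g i)" for f g
      unfolding T
      by (induction ps) (auto simp: shift_average_def sum.distrib add_divide_distrib fun_eq_iff)
    show "T (\<lambda>i. c * f i) = (\<lambda>i. c * T f i)" for c f
      unfolding T
      by (induction ps) (auto simp: shift_average_def sum_distrib_left fun_eq_iff)
    show "\<forall>\<^sub>F i in principal E. T f i \<le> c" if "\<forall>\<^sub>F i in principal E. f i \<le> c" for f c
      unfolding T using mono that ps by blast
    fix U assume "U \<in> A"
    then obtain qs where U: "U = shift_averages qs" and qs: "\<forall>p\<in>set qs. fst p > 0 \<and> snd p \<in> E"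
      using AE by blast
    have "T \<circ> U \<in> A"
      using ps qs unfolding A_def T U by (intro CollectI exI[of _ "ps @ qs"])
        (auto simp: shift_averages_append fun_eq_iff)
    then show "T \<circ> U \<in> A \<and> T \<circ> U = U \<circ> T"
      unfolding T U by (auto simp: fun_eq_iff shift_averages_commute)
  qed blast
  have le: "m (\<lambda>y. f (y + s) - f y) \<le> 0" and bd: "Bfun (\<lambda>y. f (y + s)) (principal E)"
    if f: "Bfun f (principal E)" and s: "s \<in> E" for f s
  proof -
    obtain C where C: "\<And>y. y \<in> E \<Longrightarrow> \<bar>f y\<bar> \<le> C"
      using f by (auto simp: Bfun_def eventually_principal)
    show bd: "Bfun (\<lambda>y. f (y + s)) (principal E)"
      by (rule BfunI[where K = C]) (use C E s in \<open>simp add: eventually_principal subspace_add\<close>)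
    have "m (\<lambda>y. f (y + s) - f y) \<le> 2 * C / real (Suc N)" for N
    proof (rule m(2))
      show "shift_averages [(Suc N, s)] \<in> A"
        unfolding A_def using s by (intro CollectI exI[of _ "[(Suc N, s)]"]) auto
      show "Bfun (\<lambda>y. f (y + s) - f y) (principal E)" using Bfun_diff[OF bd f] .
      have "shift_averages [(Suc N, s)] (\<lambda>y. f (y + s) - f y) y \<le> 2 * C / real (Suc N)" if y: "y \<in> E" for y
      proof -
        have "(\<Sum>i<Suc N. f (y + real i *\<^sub>R s + s) - f (y + real i *\<^sub>R s)) =
            (\<Sum>i<Suc N. f (y + real (Suc i) *\<^sub>R s) - f (y + real i *\<^sub>R s))"
          by (intro sum.cong) (auto simp: algebra_simps)
        also have "\<dots> = f (y + real (Suc N) *\<^sub>R s) - f y"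
          by (subst sum_lessThan_telescope) simp
        also have "\<dots> \<le> 2 * C"
          using C[of "y + real (Suc N) *\<^sub>R s"] C[of y] y s E
          by (simp add: subspace_add subspace_scale abs_le_iff)
        finally show ?thesis by (simp add: shift_average_def divide_right_mono)
      qed
      then show "\<forall>\<^sub>F y in principal E. shift_averages [(Suc N, s)] (\<lambda>y. f (y + s) - f y) y \<le> 2 * C / real (Suc N)"
        by (simp add: eventually_principal)
    qed
    moreover have "(\<lambda>N. 2 * C / real (Suc N)) \<longlonglongrightarrow> 0"
      using tendsto_mult_left[OF LIMSEQ_inverse_real_of_nat, of "2 * C"] by (simp add: divide_inverse)
    ultimately show "m (\<lambda>y. f (y + s) - f y) \<le> 0"
      by (meson LIMSEQ_le_const)
  qed
  have "m (\<lambda>y. f (y + s)) = m f" if f: "Bfun f (principal E)" and s: "s \<in> E" for f s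
  proof -
    have *: "m (\<lambda>y. f (y + s)) \<le> m f" if f: "Bfun f (principal E)" and s: "s \<in> E" for f s
      using le[OF f s] is_mean_diff[OF m(1) bd[OF f s] f] by simp
    have "m (\<lambda>y. f (y + s + - s)) \<le> m (\<lambda>y. f (y + s))"
      using *[OF bd[OF f s], of "- s"] s E by (simp add: subspace_neg)
    then show ?thesis using *[OF f s] by simp
  qed
  then show ?thesis using m(1) by blast
qed

section \<open>Finite-dimensional subspaces\<close>

text \<open>In effect a bounded projection onto \<open>span B\<close>, with coordinate functionals
  that are continuous on the whole space. The span is thus the fixed point set of a continuous map,
  and scalar means can act coordinatewise.\<close>

definition span_coordinates ::
    "'a::real_normed_vector set \<Rightarrow> nat \<Rightarrow> (nat \<Rightarrow> 'a) \<Rightarrow> (nat \<Rightarrow> 'a \<Rightarrow> real) \<Rightarrow> bool"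
  where "span_coordinates B n b \<phi> \<longleftrightarrow> (\<forall>i<n. b i \<in> span B \<and> bounded_linear (\<phi> i)) \<and>
    (\<forall>x\<in>span B. x = (\<Sum>i<n. \<phi> i x *\<^sub>R b i))"

lemma span_coordinatesD:
  assumes "span_coordinates B n b \<phi>"
  shows "\<And>i. i < n \<Longrightarrow> b i \<in> span B" "\<And>i. i < n \<Longrightarrow> bounded_linear (\<phi> i)"
    "\<And>x. x \<in> span B \<Longrightarrow> x = (\<Sum>i<n. \<phi> i x *\<^sub>R b i)"
  using assms by (auto simp: span_coordinates_def)

lemma closed_if_span_coordinates:
  assumes "span_coordinates B n b \<phi>"
  shows "closed (span B)"
proof -
  note D = span_coordinatesD[OF assms]
  have cont: "continuous_on UNIV (\<lambda>x. \<Sum>i<n. \<phi> i x *\<^sub>R b i)"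
    using D(2) by (intro continuous_intros) (auto intro!: linear_continuous_on)
  have "(\<Sum>i<n. \<phi> i x *\<^sub>R b i) \<in> span B" for x
    using D(1) by (intro span_sum span_scale) auto
  then have "span B = {x. x = (\<Sum>i<n. \<phi> i x *\<^sub>R b i)}"
    using D(3) by auto metis
  then show ?thesis using closed_Collect_eq[OF continuous_on_id cont] by simp
qed

text \<open>For \<open>a\<close> outside the span, which is closed by induction, there is a
  functional vanishing on the span with value 1 at \<open>a\<close>. It is the new coordinate; the
  old ones are applied after removing the component along \<open>a\<close>.\<close>

lemma finite_span_coordinates:
  fixes B :: "'a::real_normed_vector set"
  assumes "finite B"
  shows "\<exists>n b \<phi>. span_coordinates B n b \<phi>"
  using assms
proof (induction B)
  case empty
  show ?case by (intro exI[of _ 0]) (auto simp: span_coordinates_def)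
next
  case (insert a B)
  then obtain n b \<phi> where co: "span_coordinates B n b \<phi>" by blast
  note b = span_coordinatesD(1)[OF co] and \<phi> = span_coordinatesD(2)[OF co]
    and eq = span_coordinatesD(3)[OF co]
  show ?case
  proof (cases "a \<in> span B")
    case True
    then have "span (insert a B) = span B" by (simp add: span_redundant)
    then show ?thesis using co unfolding span_coordinates_def by metis
  next
    case False
    have "closed (span B)" using co by (rule closed_if_span_coordinates)
    then have pos: "infdist a (span B) > 0"
      using False in_closed_iff_infdist_zero[of "span B" a] span_zero
      by (metis empty_iff infdist_nonneg less_eq_real_def)
    obtain g :: "'a \<Rightarrow> real" where g: "linear g" "\<And>x. \<bar>g x\<bar> \<le> norm x" "\<And>x. x \<in> span B \<Longrightarrow> g x = 0"
        "g a = infdist a (span B)"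
      using hahn_banach_infdist[OF subspace_span[of B]] by metis
    define \<psi> where "\<psi> = (\<lambda>x. g x / infdist a (span B))"
    have "bounded_linear g"
      using g(1,2) by (intro bounded_linear.intro bounded_linear_axioms.intro exI[of _ 1]) auto
    then have \<psi>: "bounded_linear \<psi>" unfolding \<psi>_def by (rule bounded_linear_divide[THEN bounded_linear_compose])
    have \<psi>a: "\<psi> a = 1" and \<psi>0: "\<And>x. x \<in> span B \<Longrightarrow> \<psi> x = 0"
      using pos g by (auto simp: \<psi>_def)
    define b' where "b' = (\<lambda>i. if i < n then b i else a)"
    define \<phi>' where "\<phi>' = (\<lambda>i. if i < n then (\<lambda>x. \<phi> i (x - \<psi> x *\<^sub>R a)) else \<psi>)"
    have "b' i \<in> span (insert a B)" for i
      using b span_mono[of B "insert a B"] by (auto simp: b'_def span_base)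
    moreover have "bounded_linear (\<phi>' i)" for i
    proof -
      have "bounded_linear (\<lambda>x. x - \<psi> x *\<^sub>R a)"
        using bounded_linear_compose[OF bounded_linear_scaleR_left \<psi>]
        by (intro bounded_linear_sub bounded_linear_ident)
      then show ?thesis
        using bounded_linear_compose[OF \<phi>[of i]] \<psi> by (auto simp: \<phi>'_def)
    qed
    moreover have "x = (\<Sum>i<Suc n. \<phi>' i x *\<^sub>R b' i)" if x: "x \<in> span (insert a B)" for x
    proof -
      obtain k where k: "x - k *\<^sub>R a \<in> span B" using x by (auto simp: span_insert)
      have "\<psi> (x - k *\<^sub>R a) = \<psi> x - k"
        using \<psi>a \<psi> by (simp add: bounded_linear.linear linear_diff linear_scale)
      then have "\<psi> x = k" using \<psi>0[OF k] by simp
      then have "x - \<psi> x *\<^sub>R a = (\<Sum>i<n. \<phi> i (x - \<psi> x *\<^sub>R a) *\<^sub>R b i)" using eq k by simp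
      then show ?thesis by (simp add: \<phi>'_def b'_def algebra_simps)
    qed
    ultimately have "span_coordinates (insert a B) (Suc n) b' \<phi>'"
      unfolding span_coordinates_def by blast
    then show ?thesis by blast
  qed
qed

lemma compact_coordinate_box:
  fixes b :: "nat \<Rightarrow> 'a::real_normed_vector"
  shows "compact {\<Sum>i<n. t i *\<^sub>R b i | t. \<forall>i<n. \<bar>t i\<bar> \<le> (c i::real)}"
proof (induction n)
  case (Suc n)
  let ?K = "\<lambda>n. {\<Sum>i<n. t i *\<^sub>R b i | t. \<forall>i<n. \<bar>t i\<bar> \<le> (c i::real)}"
  have "compact ((\<lambda>s. s *\<^sub>R b n) ` {- c n..c n})"
    by (intro compact_continuous_image continuous_intros) auto
  from compact_sums[OF Suc this]
  have "compact {x + y |x y. x \<in> ?K n \<and> y \<in> (\<lambda>s. s *\<^sub>R b n) ` {- c n..c n}}" .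
  also have "\<dots> = ?K (Suc n)"
  proof (intro equalityI subsetI)
    fix z assume "z \<in> {x + y |x y. x \<in> ?K n \<and> y \<in> (\<lambda>s. s *\<^sub>R b n) ` {- c n..c n}}"
    then obtain x y where z: "z = x + y" and x: "x \<in> ?K n" and y: "y \<in> (\<lambda>s. s *\<^sub>R b n) ` {- c n..c n}"
      by blast
    obtain t where t: "\<forall>i<n. \<bar>t i\<bar> \<le> c i" "x = (\<Sum>i<n. t i *\<^sub>R b i)" using x by blast
    obtain s where s: "y = s *\<^sub>R b n" "s \<in> {- c n..c n}" using y by blast
    then show "z \<in> ?K (Suc n)"
      using z t s by (intro CollectI exI[of _ "t(n := s)"]) (auto simp: less_Suc_eq abs_le_iff)
  next
    fix z assume "z \<in> ?K (Suc n)"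
    then obtain t where t: "\<forall>i<Suc n. \<bar>t i\<bar> \<le> c i" "z = (\<Sum>i<Suc n. t i *\<^sub>R b i)" by auto
    have "(\<Sum>i<n. t i *\<^sub>R b i) \<in> ?K n" using t(1) by (intro CollectI exI[of _ t]) auto
    moreover have "t n \<in> {- c n..c n}" using t(1)[rule_format, of n] by (simp add: abs_le_iff)
    moreover have "z = (\<Sum>i<n. t i *\<^sub>R b i) + t n *\<^sub>R b n" using t(2) by simp
    ultimately show "z \<in> {x + y |x y. x \<in> ?K n \<and> y \<in> (\<lambda>s. s *\<^sub>R b n) ` {- c n..c n}}"
      by blast
  qed
  finally show ?case .
qed simp

text \<open>The ball is a closed part of a compact box of coordinates, whose sides come from the
  operator norms of the coordinate functionals.\<close>

lemma
  fixes B :: "'a::real_normed_vector set"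
  assumes "finite B"
  shows closed_span_finite: "closed (span B)"
    and compact_span_ball: "compact {x \<in> span B. norm x \<le> r}"
proof -
  obtain n b \<phi> where co: "span_coordinates B n b \<phi>" using finite_span_coordinates[OF assms] by blast
  note \<phi> = span_coordinatesD(2)[OF co] and eq = span_coordinatesD(3)[OF co]
  show cl: "closed (span B)" using co by (rule closed_if_span_coordinates)
  define c where "c = (\<lambda>i. onorm (\<phi> i) * r)"
  let ?K = "{\<Sum>i<n. t i *\<^sub>R b i | t. \<forall>i<n. \<bar>t i\<bar> \<le> c i}"
  have sub: "{x \<in> span B. norm x \<le> r} \<subseteq> ?K"
  proof
    fix x assume x: "x \<in> {x \<in> span B. norm x \<le> r}"
    have "\<bar>\<phi> i x\<bar> \<le> c i" if "i < n" for i
      using onorm[OF \<phi>[OF that], of x] x onorm_pos_le[OF \<phi>[OF that]]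
        mult_left_mono[of "norm x" r "onorm (\<phi> i)"]
      by (simp add: c_def)
    then show "x \<in> ?K" using eq[of x] x
      by (intro CollectI exI[of _ "\<lambda>i. \<phi> i x"]) auto
  qed
  have ball: "{x \<in> span B. norm x \<le> r} = span B \<inter> cball 0 r" by auto
  have "compact (?K \<inter> {x \<in> span B. norm x \<le> r})"
    unfolding ball by (intro compact_Int_closed compact_coordinate_box closed_Int cl closed_cball)
  moreover have "?K \<inter> {x \<in> span B. norm x \<le> r} = {x \<in> span B. norm x \<le> r}"
    using sub by blast
  ultimately show "compact {x \<in> span B. norm x \<le> r}" by simp
qed

text \<open>The last clause says that \<open>M f\<close> depends only on the scalar means of
  \<open>f\<close> under bounded functionals; through it, invariance of \<open>m\<close> passes to
  \<open>M\<close>. Of linearity only additivity is recorded: real homogeneity of the final operator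
  is recovered from its boundedness.\<close>

definition is_vector_mean ::
    "'i filter \<Rightarrow> (('i \<Rightarrow> real) \<Rightarrow> real) \<Rightarrow> 'a::real_normed_vector set \<Rightarrow> (('i \<Rightarrow> 'a) \<Rightarrow> 'a) \<Rightarrow> bool"
  where "is_vector_mean F m V M \<longleftrightarrow> (\<forall>f. M f \<in> V) \<and>
    (\<forall>f g. Bfun f F \<longrightarrow> Bfun g F \<longrightarrow> M (\<lambda>i. f i + g i) = M f + M g) \<and>
    (\<forall>f c. (\<forall>\<^sub>F i in F. f i \<in> V \<and> norm (f i) \<le> c) \<longrightarrow> norm (M f) \<le> c) \<and>
    (\<forall>f. \<forall>e\<in>V. (\<forall>\<^sub>F i in F. f i = e) \<longrightarrow> M f = e) \<and>
    (\<forall>f g. (\<forall>\<phi>. bounded_linear \<phi> \<longrightarrow> m (\<lambda>i. \<phi> (f i)) = m (\<lambda>i. \<phi> (g i))) \<longrightarrow> M f = M g)"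

lemma is_vector_meanD:
  assumes "is_vector_mean F m V M"
  shows "M f \<in> V" "Bfun f F \<Longrightarrow> Bfun g F \<Longrightarrow> M (\<lambda>i. f i + g i) = M f + M g"
    "\<forall>\<^sub>F i in F. f i \<in> V \<and> norm (f i) \<le> c \<Longrightarrow> norm (M f) \<le> c"
    "e \<in> V \<Longrightarrow> \<forall>\<^sub>F i in F. f i = e \<Longrightarrow> M f = e"
    "(\<And>\<phi>. bounded_linear \<phi> \<Longrightarrow> m (\<lambda>i. \<phi> (f i)) = m (\<lambda>i. \<phi> (g i))) \<Longrightarrow> M f = M g"
  using assms unfolding is_vector_mean_def by blast+

text \<open>\<open>M\<close> applies \<open>m\<close> to each coordinate. Coordinates alone would
  spoil the constant in the norm bound, so a functional \<open>g\<close> norming \<open>M f\<close>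
  is used: \<open>g (M f)\<close> is the mean of \<open>g (f i)\<close>, which is eventually at most
  \<open>c\<close>.\<close>

lemma vector_mean_exists:
  fixes B :: "'a::real_normed_vector set"
  assumes m: "is_mean F m" and B: "finite B"
  shows "\<exists>M. is_vector_mean F m (span B) M"
proof -
  obtain n b \<phi> where co: "span_coordinates B n b \<phi>" using finite_span_coordinates[OF B] by blast
  note b = span_coordinatesD(1)[OF co] and \<phi> = span_coordinatesD(2)[OF co]
    and eq = span_coordinatesD(3)[OF co]
  define M where "M = (\<lambda>f. \<Sum>k<n. m (\<lambda>i. \<phi> k (f i)) *\<^sub>R b k)"
  have M1: "M f \<in> span B" for f
    unfolding M_def using b by (intro span_sum span_scale) auto
  have M2: "M (\<lambda>i. f i + g i) = M f + M g" if f: "Bfun f F" and g: "Bfun g F" for f g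
  proof -
    have "m (\<lambda>i. \<phi> k (f i + g i)) = m (\<lambda>i. \<phi> k (f i)) + m (\<lambda>i. \<phi> k (g i))" if "k < n" for k
      using is_mean_add[OF m Bfun_bounded_linear[OF \<phi>[OF that] f] Bfun_bounded_linear[OF \<phi>[OF that] g]]
        \<phi>[OF that] by (simp add: linear_add bounded_linear.linear)
    then show ?thesis by (simp add: M_def scaleR_add_left sum.distrib)
  qed
  have M3: "norm (M f) \<le> c" if f: "\<forall>\<^sub>F i in F. f i \<in> span B \<and> norm (f i) \<le> c" for f c
  proof -
    have Bf: "Bfun f F" using f by (auto intro!: BfunI elim!: eventually_mono)
    obtain g :: "'a \<Rightarrow> real" where g: "linear g" "\<And>x. \<bar>g x\<bar> \<le> norm x" "g (M f) = norm (M f)"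
      using norming_functional[of "M f"] by metis
    have gb: "bounded_linear g"
      using g(1,2) by (intro bounded_linear.intro bounded_linear_axioms.intro exI[of _ 1]) auto
    have *: "m (\<lambda>i. \<Sum>k<j. g (b k) * \<phi> k (f i)) = (\<Sum>k<j. g (b k) * m (\<lambda>i. \<phi> k (f i))) \<and>
        Bfun (\<lambda>i. \<Sum>k<j. g (b k) * \<phi> k (f i)) F" if "j \<le> n" for j
      using that
    proof (induction j)
      case 0
      have "m (\<lambda>i. 0 * 0) = 0 * m (\<lambda>i. 0)" by (rule is_mean_scale[OF m]) (simp add: Bfun_const)
      then show ?case by (simp add: Bfun_const)
    next
      case (Suc j)
      have p: "Bfun (\<lambda>i. \<phi> j (f i)) F"
        using Suc.prems by (intro Bfun_bounded_linear[OF \<phi> Bf]) auto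
      then have q: "Bfun (\<lambda>i. g (b j) * \<phi> j (f i)) F"
        using Bfun_bounded_linear[OF bounded_linear_mult_right] by blast
      show ?case
        using is_mean_add[OF m _ q] is_mean_scale[OF m p] Suc Bfun_add[OF _ q] by simp
    qed
    have "\<forall>\<^sub>F i in F. (\<Sum>k<n. g (b k) * \<phi> k (f i)) \<le> c"
      using f
    proof eventually_elim
      case (elim i)
      have "(\<Sum>k<n. g (b k) * \<phi> k (f i)) = g (\<Sum>k<n. \<phi> k (f i) *\<^sub>R b k)"
        using g(1) by (simp add: linear_sum linear_scale mult.commute)
      also have "\<dots> = g (f i)" using eq[of "f i"] elim by simp
      also have "\<dots> \<le> c" using g(2)[of "f i"] conjunct2[OF elim] by linarith
      finally show ?case .
    qed
    then have "m (\<lambda>i. \<Sum>k<n. g (b k) * \<phi> k (f i)) \<le> c"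
      using is_mean_le[OF m] * by blast
    moreover have "m (\<lambda>i. \<Sum>k<n. g (b k) * \<phi> k (f i)) = g (M f)"
      using *[of n] g(1) by (simp add: M_def linear_sum linear_scale mult.commute)
    ultimately show ?thesis using g(3) by simp
  qed
  have M4: "M f = e" if e: "e \<in> span B" and f: "\<forall>\<^sub>F i in F. f i = e" for f e
  proof -
    have "m (\<lambda>i. \<phi> k (f i)) = \<phi> k e" for k
    proof -
      have "m (\<lambda>i. \<phi> k (f i)) = m (\<lambda>i. \<phi> k e)"
        using f by (intro is_mean_cong[OF m]) (auto simp: Bfun_const elim: eventually_mono)
      also have "\<dots> = \<phi> k e"
        using is_mean_le[OF m, of "\<lambda>i. \<phi> k e" "\<phi> k e"] is_mean_ge[OF m, of "\<lambda>i. \<phi> k e" "\<phi> k e"]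
        by (simp add: Bfun_const)
      finally show ?thesis .
    qed
    then show ?thesis using eq[OF e] by (simp add: M_def)
  qed
  have M5: "M f = M g" if "\<forall>\<phi>. bounded_linear \<phi> \<longrightarrow> m (\<lambda>i. \<phi> (f i)) = m (\<lambda>i. \<phi> (g i))" for f g
    unfolding M_def using that \<phi> by (intro sum.cong) auto
  have "is_vector_mean F m (span B) M"
    unfolding is_vector_mean_def using M1 M2 M3 M4 M5 by blast
  then show ?thesis by blast
qed

text \<open>Additive maps commute with integers. Writing \<open>n * c\<close> as an integer plus
  \<open>r\<close> with \<open>0 \<le> r \<le> 1\<close>, the defect of homogeneity multiplied by
  \<open>n\<close> equals the defect for the factor \<open>r\<close>, which is bounded independently
  of \<open>n\<close>.\<close>

lemma additive_bounded_imp_linear: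
  fixes f :: "'a::real_normed_vector \<Rightarrow> 'b::real_normed_vector"
  assumes add: "\<And>x y. f (x + y) = f x + f y" and bd: "\<And>x. norm (f x) \<le> K * norm x"
  shows "linear f"
proof (rule linearI[OF add])
  fix c :: real and x :: 'a
  have f0: "f 0 = 0" using add[of 0 0] by simp
  have neg: "f (- x) = - f x" for x using add[of x "- x"] f0 by (simp add: eq_neg_iff_add_eq_0 add.commute)
  have nat: "f (real n *\<^sub>R y) = real n *\<^sub>R f y" for n y
    by (induction n) (auto simp: f0 add algebra_simps)
  have int: "f (of_int k *\<^sub>R y) = of_int k *\<^sub>R f y" for k :: int and y
    by (cases k rule: int_cases2) (auto simp: nat neg)
  have K: "0 \<le> K * norm x" by (rule order_trans[OF norm_ge_zero bd])
  have "real n * norm (f (c *\<^sub>R x) - c *\<^sub>R f x) \<le> 2 * (K * norm x)" for n :: nat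
  proof -
    define k where "k = \<lfloor>real n * c\<rfloor>"
    define r where "r = real n * c - of_int k"
    have r: "0 \<le> r" "r \<le> 1" unfolding r_def k_def by linarith+
    have "real n *\<^sub>R f (c *\<^sub>R x) = f (of_int k *\<^sub>R x + r *\<^sub>R x)"
      unfolding nat[symmetric] r_def by (simp add: algebra_simps)
    also have "\<dots> = of_int k *\<^sub>R f x + f (r *\<^sub>R x)" by (simp add: add int)
    finally have "real n *\<^sub>R (f (c *\<^sub>R x) - c *\<^sub>R f x) = f (r *\<^sub>R x) - r *\<^sub>R f x"
      unfolding r_def by (simp add: algebra_simps)
    then have "real n * norm (f (c *\<^sub>R x) - c *\<^sub>R f x) = norm (f (r *\<^sub>R x) - r *\<^sub>R f x)"
      by (metis abs_of_nat norm_scaleR)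
    also have "\<dots> \<le> norm (f (r *\<^sub>R x)) + norm (r *\<^sub>R f x)" by (rule norm_triangle_ineq4)
    also have "\<dots> \<le> r * (K * norm x) + r * (K * norm x)"
      using bd[of "r *\<^sub>R x"] mult_left_mono[OF bd[of x] r(1)] r by (simp add: mult.left_commute)
    also have "\<dots> \<le> 2 * (K * norm x)"
      using mult_right_mono[OF r(2) K] by (simp add: mult.left_commute)
    finally show ?thesis .
  qed
  then have "norm (f (c *\<^sub>R x) - c *\<^sub>R f x) = 0"
    by (metis reals_Archimedean3 norm_ge_zero less_eq_real_def mult.commute not_le)
  then show "f (c *\<^sub>R x) = c *\<^sub>R f x" by simp
qed

text \<open>Lindenstrauss' linearization: rescaling turns a retraction onto a ball of a
  finite-dimensional subspace into a retraction onto the subspace, averaging over the subspace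
  makes it equivariant, and averaging its increments over the whole space makes it additive.\<close>

lemma linear_projection_from_retraction:
  fixes r :: "'a::real_normed_vector \<Rightarrow> 'a"
  assumes B: "finite B" and lip: "L-lipschitz_on UNIV r" and ran: "\<And>x. r x \<in> span B"
    and \<rho>: "\<rho> > 0" and ret: "\<And>x. x \<in> span B \<Longrightarrow> norm x \<le> \<rho> \<Longrightarrow> r x = x"
  obtains P where "linear P" "\<And>x. P x \<in> span B" "\<And>x. x \<in> span B \<Longrightarrow> P x = x"
    "\<And>x. norm (P x) \<le> L * norm x"
proof -
  have rl: "norm (r x - r y) \<le> L * norm (x - y)" for x y
    using lipschitz_onD[OF lip, of x y] by (simp add: dist_norm)
  obtain lim where lim: "is_mean sequentially lim"
    using generalized_limit[of sequentially] by auto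
  obtain M0 where "is_vector_mean (sequentially) lim (span B) M0"
    using vector_mean_exists[OF lim B] by blast
  note M0 = is_vector_meanD[OF this]
  \<comment> \<open>The outer factor cancels the inner one in Lipschitz estimates, so
    \<open>L\<close> is kept, while the radius up to which \<open>s n\<close> fixes the points of
    the span grows to \<open>real (Suc n) * \<rho>\<close>.\<close>
  define s where "s = (\<lambda>(n::nat) x. real (Suc n) *\<^sub>R r ((1 / real (Suc n)) *\<^sub>R x))"
  have sl: "norm (s n x - s n y) \<le> L * norm (x - y)" for n x y
  proof -
    have "norm (s n x - s n y) = real (Suc n) * norm (r ((1 / real (Suc n)) *\<^sub>R x) - r ((1 / real (Suc n)) *\<^sub>R y))"
      unfolding s_def by (simp flip: scaleR_diff_right)
    also have "\<dots> \<le> real (Suc n) * (L * norm ((1 / real (Suc n)) *\<^sub>R x - (1 / real (Suc n)) *\<^sub>R y))"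
      by (intro mult_left_mono rl) simp
    also have "\<dots> = L * norm (x - y)"
      by (simp flip: scaleR_diff_right)
    finally show ?thesis .
  qed
  have sB: "s n x \<in> span B" for n x unfolding s_def by (intro span_scale ran)
  have s0: "s n 0 = 0" for n using ret[of 0] \<rho> by (simp add: s_def span_zero)
  have sbd: "norm (s n x) \<le> L * norm x" for n x using sl[of n x 0] s0 by simp
  have sBf: "Bfun (\<lambda>n. s n x) sequentially" for x by (rule BfunI[of _ "L * norm x"]) (simp add: sbd)
  define R where "R = (\<lambda>x. M0 (\<lambda>n. s n x))"
  have Rl: "norm (R x - R y) \<le> L * norm (x - y)" for x y
  proof -
    have "M0 (\<lambda>n. s n x) = M0 (\<lambda>n. (s n x - s n y) + s n y)" by simp
    also have "\<dots> = M0 (\<lambda>n. s n x - s n y) + M0 (\<lambda>n. s n y)"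
      by (intro M0(2) Bfun_diff sBf)
    finally have "R x - R y = M0 (\<lambda>n. s n x - s n y)" by (simp add: R_def)
    also have "norm \<dots> \<le> L * norm (x - y)"
      by (rule M0(3)) (auto intro!: always_eventually span_diff sB sl)
    finally show ?thesis .
  qed
  have Rid: "R x = x" if x: "x \<in> span B" for x
    unfolding R_def
  proof (rule M0(4)[OF x])
    obtain N :: nat where N: "norm x / \<rho> < real N" using reals_Archimedean2 by blast
    show "\<forall>\<^sub>F n in sequentially. s n x = x"
    proof (rule eventually_sequentiallyI[of N])
      fix n assume "n \<ge> N"
      then have "norm x / \<rho> \<le> real (Suc n)" using N by linarith
      then have "norm ((1 / real (Suc n)) *\<^sub>R x) \<le> \<rho>" using \<rho> by (simp add: field_simps)
      then have "r ((1 / real (Suc n)) *\<^sub>R x) = (1 / real (Suc n)) *\<^sub>R x" using x by (intro ret span_scale)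
      then show "s n x = x" by (simp add: s_def)
    qed
  qed
  have RB: "R x \<in> span B" for x unfolding R_def by (rule M0)
  obtain m1 where m1: "is_mean (principal (span B)) m1"
    "\<And>f s. Bfun f (principal (span B)) \<Longrightarrow> s \<in> span B \<Longrightarrow> m1 (\<lambda>y. f (y + s)) = m1 f"
    using invariant_mean[OF subspace_span[of B]] by blast
  obtain M1 where "is_vector_mean (principal (span B)) m1 (span B) M1"
    using vector_mean_exists[OF m1(1) B] by blast
  note M1 = is_vector_meanD[OF this]
  have Rbd: "norm (R (x + y) - y) \<le> L * norm x" if "y \<in> span B" for x y
    using Rl[of "x + y" y] Rid[OF that] by simp
  have RBf: "Bfun (\<lambda>y. R (x + y) - y) (principal (span B))" for x
    by (rule BfunI[of _ "L * norm x"]) (simp add: eventually_principal Rbd)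
  \<comment> \<open>Subtracting \<open>y\<close> keeps the averaged function bounded, because
    \<open>R\<close> fixes \<open>y\<close>; the shift of the variable by \<open>e\<close> then
    leaves just the summand \<open>e\<close>.\<close>
  define S where "S = (\<lambda>x. M1 (\<lambda>y. R (x + y) - y))"
  have Sl: "norm (S x - S x') \<le> L * norm (x - x')" for x x'
  proof -
    have "M1 (\<lambda>y. R (x + y) - y) = M1 (\<lambda>y. (R (x + y) - R (x' + y)) + (R (x' + y) - y))" by simp
    also have "\<dots> = M1 (\<lambda>y. R (x + y) - R (x' + y)) + M1 (\<lambda>y. R (x' + y) - y)"
    proof (intro M1(2) RBf)
      show "Bfun (\<lambda>y. R (x + y) - R (x' + y)) (principal (span B))"
        using Bfun_diff[OF RBf[of x] RBf[of x']] by simp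
    qed
    finally have "S x - S x' = M1 (\<lambda>y. R (x + y) - R (x' + y))" by (simp add: S_def)
    also have "norm \<dots> \<le> L * norm (x - x')"
    proof (rule M1(3))
      have "norm (R (x + y) - R (x' + y)) \<le> L * norm (x - x')" for y
        using Rl[of "x + y" "x' + y"] by simp
      then show "\<forall>\<^sub>F y in principal (span B). R (x + y) - R (x' + y) \<in> span B \<and>
          norm (R (x + y) - R (x' + y)) \<le> L * norm (x - x')"
        by (auto simp: eventually_principal intro: span_diff RB)
    qed
    finally show ?thesis .
  qed
  have SB: "S x \<in> span B" for x unfolding S_def by (rule M1)
  have Se: "S (x + e) = S x + e" if e: "e \<in> span B" for x e
  proof -
    have "S (x + e) = M1 (\<lambda>y. (R (x + (y + e)) - (y + e)) + e)"
      by (simp add: S_def algebra_simps)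
    also have "\<dots> = M1 (\<lambda>y. R (x + (y + e)) - (y + e)) + M1 (\<lambda>y. e)"
    proof (intro M1(2) Bfun_const)
      show "Bfun (\<lambda>y. R (x + (y + e)) - (y + e)) (principal (span B))"
        by (rule BfunI[of _ "L * norm x"]) (auto simp: eventually_principal intro!: Rbd span_add e)
    qed
    also have "M1 (\<lambda>y. R (x + (y + e)) - (y + e)) = M1 (\<lambda>y. R (x + y) - y)"
      by (rule M1(5)) (rule m1(2)[OF Bfun_bounded_linear[OF _ RBf] e])
    also have "M1 (\<lambda>y. e) = e" by (rule M1(4)[OF e]) simp
    finally show ?thesis by (simp add: S_def)
  qed
  obtain m2 where m2: "is_mean (principal (UNIV :: 'a set)) m2"
    "\<And>f s. Bfun f (principal UNIV) \<Longrightarrow> s \<in> UNIV \<Longrightarrow> m2 (\<lambda>y::'a. f (y + s)) = m2 f"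
    using invariant_mean[OF subspace_UNIV] by blast
  obtain M2 where "is_vector_mean (principal (UNIV :: 'a set)) m2 (span B) M2"
    using vector_mean_exists[OF m2(1) B] by blast
  note M2 = is_vector_meanD[OF this]
  define P where "P = (\<lambda>x. M2 (\<lambda>z. S (x + z) - S z))"
  have bd: "norm (S (x + z) - S z) \<le> L * norm x" for x z using Sl[of "x + z" z] by simp
  have SBf: "Bfun (\<lambda>z. S (x + z) - S z) (principal (UNIV :: 'a set))" for x
    by (rule BfunI[of _ "L * norm x"]) (simp add: eventually_principal bd)
  have Pbd: "norm (P x) \<le> L * norm x" for x
    unfolding P_def by (rule M2(3)) (auto simp: bd intro: span_diff SB)
  have "P (x + x') = P x + P x'" for x x'
  proof -
    \<comment> \<open>The increment over \<open>x + x'\<close> is split at \<open>z + x'\<close>;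
      invariance of \<open>m2\<close> removes this shift from the first part.\<close>
    have "P (x + x') = M2 (\<lambda>z. (S (x + (z + x')) - S (z + x')) + (S (x' + z) - S z))"
      by (simp add: P_def algebra_simps)
    also have "\<dots> = M2 (\<lambda>z. S (x + (z + x')) - S (z + x')) + M2 (\<lambda>z. S (x' + z) - S z)"
    proof (intro M2(2) SBf)
      show "Bfun (\<lambda>z. S (x + (z + x')) - S (z + x')) (principal UNIV)"
        by (rule BfunI[of _ "L * norm x"]) (simp add: eventually_principal bd)
    qed
    also have "M2 (\<lambda>z. S (x + (z + x')) - S (z + x')) = M2 (\<lambda>z. S (x + z) - S z)"
      by (rule M2(5)) (rule m2(2)[OF Bfun_bounded_linear[OF _ SBf] UNIV_I])
    finally show ?thesis by (simp add: P_def)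
  qed
  then have "linear P" using Pbd by (rule additive_bounded_imp_linear)
  moreover have "P x \<in> span B" for x unfolding P_def by (rule M2)
  moreover have "P e = e" if e: "e \<in> span B" for e
    unfolding P_def using Se[OF e] by (intro M2(4)[OF e]) (simp add: add.commute)
  ultimately show thesis using that Pbd by blast
qed

section \<open>Finitely supported sequences\<close>

text \<open>One inner product space that contains every Euclidean space, as the subspace of
  sequences supported below \<open>n\<close>. The dimensions are found and doubled inside proofs, so
  they must be numbers and not types.\<close>

typedef fin_seq = "{f :: nat \<Rightarrow> real. finite {i. f i \<noteq> 0}}"
  morphisms coord Abs_fin_seq
  by (intro exI[of _ "\<lambda>_. 0"]) simp

setup_lifting type_definition_fin_seq

lemma finite_support: "finite {i. coord a i \<noteq> 0}"
  using coord by auto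

instantiation fin_seq :: real_vector
begin

lift_definition zero_fin_seq :: fin_seq is "\<lambda>_. 0" by simp

lift_definition plus_fin_seq :: "fin_seq \<Rightarrow> fin_seq \<Rightarrow> fin_seq" is "\<lambda>f g i. f i + g i"
  by (erule (1) finite_subset[OF _ finite_UnI, rotated]) auto

lift_definition uminus_fin_seq :: "fin_seq \<Rightarrow> fin_seq" is "\<lambda>f i. - f i" by simp

lift_definition minus_fin_seq :: "fin_seq \<Rightarrow> fin_seq \<Rightarrow> fin_seq" is "\<lambda>f g i. f i - g i"
  by (erule (1) finite_subset[OF _ finite_UnI, rotated]) auto

lift_definition scaleR_fin_seq :: "real \<Rightarrow> fin_seq \<Rightarrow> fin_seq" is "\<lambda>c f i. c * f i"
  by (rule finite_subset[rotated]) auto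

instance
  by standard (transfer; simp add: algebra_simps)+

end

lemma coord_simps [simp]:
  "coord 0 i = 0" "coord (a + b) i = coord a i + coord b i" "coord (- a) i = - coord a i"
  "coord (a - b) i = coord a i - coord b i" "coord (c *\<^sub>R a) i = c * coord a i"
  by (transfer; simp)+

lemma coord_sum: "coord (\<Sum>x\<in>S. f x) i = (\<Sum>x\<in>S. coord (f x) i)"
  by (induction S rule: infinite_finite_induct) auto

lemma fin_seq_eqI: "(\<And>i. coord a i = coord b i) \<Longrightarrow> a = b"
  by (metis coord_inject ext)

instantiation fin_seq :: real_inner
begin

definition inner_fin_seq :: "fin_seq \<Rightarrow> fin_seq \<Rightarrow> real"
  where "inner_fin_seq a b = (\<Sum>i | coord a i \<noteq> 0. coord a i * coord b i)"

definition norm_fin_seq :: "fin_seq \<Rightarrow> real" where "norm_fin_seq a = sqrt (inner a a)"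

definition dist_fin_seq :: "fin_seq \<Rightarrow> fin_seq \<Rightarrow> real" where "dist_fin_seq a b = norm (a - b)"

definition sgn_fin_seq :: "fin_seq \<Rightarrow> fin_seq" where "sgn_fin_seq a = a /\<^sub>R norm a"

definition uniformity_fin_seq :: "(fin_seq \<times> fin_seq) filter"
  where "uniformity_fin_seq = (INF e\<in>{0 <..}. principal {(x, y). dist x y < e})"

definition open_fin_seq :: "fin_seq set \<Rightarrow> bool"
  where "open_fin_seq U \<longleftrightarrow> (\<forall>x\<in>U. eventually (\<lambda>(x', y). x' = x \<longrightarrow> y \<in> U) uniformity)"

text \<open>The defining sum runs over the support of the left argument only; any finite set outside
  which the products vanish restores the symmetry.\<close>

lemma inner_fin_seq_superset:
  assumes "finite S" "\<And>i. i \<notin> S \<Longrightarrow> coord a i = 0 \<or> coord b i = 0"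
  shows "inner a b = (\<Sum>i\<in>S. coord a i * coord b i)"
proof -
  have "(\<Sum>i\<in>S. coord a i * coord b i) = (\<Sum>i\<in>S \<union> {i. coord a i \<noteq> 0}. coord a i * coord b i)"
    using assms finite_support[of a] by (intro sum.mono_neutral_left) auto
  also have "\<dots> = inner a b"
    unfolding inner_fin_seq_def using assms(1) finite_support[of a]
    by (intro sum.mono_neutral_right) auto
  finally show ?thesis by simp
qed

instance
proof
  fix x y z :: fin_seq and r :: real and U :: "fin_seq set"
  let ?S = "{i. coord x i \<noteq> 0} \<union> {i. coord y i \<noteq> 0}"
  have S: "finite ?S" using finite_support by simp
  show "dist x y = norm (x - y)" by (rule dist_fin_seq_def)
  show "sgn x = x /\<^sub>R norm x" by (rule sgn_fin_seq_def)
  show "uniformity = (INF e\<in>{0<..}. principal {(x, y). dist (x::fin_seq) y < e})"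
    by (rule uniformity_fin_seq_def)
  show "open U = (\<forall>x\<in>U. \<forall>\<^sub>F (x', y) in uniformity. x' = x \<longrightarrow> y \<in> U)"
    by (rule open_fin_seq_def)
  show "inner x y = inner y x"
    using inner_fin_seq_superset[OF S, of x y] inner_fin_seq_superset[OF S, of y x]
    by (simp add: mult.commute)
  show "inner (x + y) z = inner x z + inner y z"
    using inner_fin_seq_superset[OF S, of x z] inner_fin_seq_superset[OF S, of y z]
      inner_fin_seq_superset[OF S, of "x + y" z]
    by (simp add: distrib_right sum.distrib)
  show "inner (r *\<^sub>R x) y = r * inner x y"
    using inner_fin_seq_superset[OF S, of x y] inner_fin_seq_superset[OF S, of "r *\<^sub>R x" y]
    by (simp add: sum_distrib_left mult.assoc)
  show "0 \<le> inner x x" unfolding inner_fin_seq_def by (intro sum_nonneg) simp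
  show "(inner x x = 0) = (x = 0)"
  proof
    assume "inner x x = 0"
    then have "\<forall>i\<in>{i. coord x i \<noteq> 0}. coord x i * coord x i = 0"
      unfolding inner_fin_seq_def using finite_support[of x]
      by (subst (asm) sum_nonneg_eq_0_iff) auto
    then show "x = 0" by (intro fin_seq_eqI) auto
  qed (simp add: inner_fin_seq_def)
  show "norm x = sqrt (inner x x)" by (rule norm_fin_seq_def)
qed

end

definition first_coords :: "nat \<Rightarrow> fin_seq set"
  where "first_coords n = {a. \<forall>i\<ge>n. coord a i = 0}"

lemma subspace_first_coords: "subspace (first_coords n)"
  by (auto simp: subspace_def first_coords_def)

lemma first_coords_exists: "\<exists>n. a \<in> first_coords n"
proof -
  obtain n where "\<forall>i\<in>{i. coord a i \<noteq> 0}. i < n"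
    using finite_support[of a] finite_nat_set_iff_bounded by blast
  then show ?thesis by (intro exI[of _ n]) (force simp: first_coords_def)
qed

lemma first_coords_mono: "a \<in> first_coords n \<Longrightarrow> n \<le> m \<Longrightarrow> a \<in> first_coords m"
  by (auto simp: first_coords_def)

lift_definition ax :: "nat \<Rightarrow> fin_seq" is "\<lambda>k i. if i = k then 1 else 0"
  by simp

lemma coord_ax: "coord (ax k) i = (if i = k then 1 else 0)"
  by transfer simp

lemma ax_first_coords: "i < n \<Longrightarrow> ax i \<in> first_coords n"
  by (auto simp: first_coords_def coord_ax)

lemma inner_first_coords:
  "a \<in> first_coords n \<Longrightarrow> inner a b = (\<Sum>i<n. coord a i * coord b i)"
  by (rule inner_fin_seq_superset) (auto simp: first_coords_def)

lemma inner_ax [simp]: "inner (ax i) a = coord a i" "inner a (ax i) = coord a i"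
proof -
  have "inner (ax i) a = (\<Sum>k\<in>{i}. coord (ax i) k * coord a k)"
    by (rule inner_fin_seq_superset) (auto simp: coord_ax)
  then show "inner (ax i) a = coord a i" by (simp add: coord_ax)
  then show "inner a (ax i) = coord a i" by (simp add: inner_commute)
qed

lemma norm_ax [simp]: "norm (ax i) = 1"
  by (simp add: norm_eq_sqrt_inner coord_ax)

text \<open>The linear map that sends \<open>ax i\<close> to \<open>v i\<close>; every linear map on
  \<open>fin_seq\<close> has this form.\<close>

definition comb :: "(nat \<Rightarrow> 'b::real_vector) \<Rightarrow> fin_seq \<Rightarrow> 'b"
  where "comb v a = (\<Sum>i | coord a i \<noteq> 0. coord a i *\<^sub>R v i)"

lemma comb_first_coords:
  assumes "a \<in> first_coords n"
  shows "comb v a = (\<Sum>i<n. coord a i *\<^sub>R v i)"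
  unfolding comb_def using assms
  by (intro sum.mono_neutral_left) (auto simp: first_coords_def not_less, metis not_less)

lemma linear_comb: "linear (comb v)"
proof (rule linearI)
  fix a b :: fin_seq and c :: real
  obtain m n where "a \<in> first_coords m" "b \<in> first_coords n" using first_coords_exists by metis
  then have *: "a \<in> first_coords (max m n)" "b \<in> first_coords (max m n)"
    using first_coords_mono by auto
  then have "a + b \<in> first_coords (max m n)" "c *\<^sub>R a \<in> first_coords (max m n)"
    using subspace_first_coords[of "max m n"] by (auto simp: subspace_def)
  then show "comb v (a + b) = comb v a + comb v b" "comb v (c *\<^sub>R a) = c *\<^sub>R comb v a"
    using * by (simp_all add: comb_first_coords scaleR_add_left sum.distrib scaleR_sum_right)
qed

lemma comb_ax [simp]: "comb v (ax i) = v i"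
proof -
  have "comb v (ax i) = (\<Sum>k<Suc i. coord (ax i) k *\<^sub>R v k)"
    by (intro comb_first_coords ax_first_coords) simp
  also have "\<dots> = v i" by (simp add: coord_ax)
  finally show ?thesis .
qed

lemma comb_ax_id: "comb ax a = a"
proof -
  obtain n where n: "a \<in> first_coords n" using first_coords_exists by blast
  have "coord (\<Sum>k<n. coord a k *\<^sub>R ax k) i = coord a i" for i
    using n by (auto simp: coord_sum coord_ax first_coords_def if_distrib[of "\<lambda>x. _ * x"] cong: if_cong)
  then show ?thesis using comb_first_coords[OF n, of ax] by (intro fin_seq_eqI) simp
qed

lemma linear_eq_comb:
  assumes "linear f"
  shows "f a = comb (\<lambda>i. f (ax i)) a"
proof -
  have "f a = f (\<Sum>i | coord a i \<noteq> 0. coord a i *\<^sub>R ax i)" using comb_ax_id[of a] by (simp add: comb_def)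
  then show ?thesis using assms by (simp add: comb_def linear_sum linear_scale)
qed

lemma comb_in_subspace:
  assumes "subspace V" "\<And>i. i < n \<Longrightarrow> v i \<in> V" "a \<in> first_coords n"
  shows "comb v a \<in> V"
  unfolding comb_first_coords[OF assms(3)] using assms by (intro subspace_sum subspace_scale) auto

lemma inner_comb_orthogonal:
  fixes v w :: "nat \<Rightarrow> 'b::real_inner"
  assumes "\<And>i j. i < n \<Longrightarrow> j < n \<Longrightarrow> i \<noteq> j \<Longrightarrow> inner (v i) (w j) = 0"
    and a: "a \<in> first_coords n" and b: "b \<in> first_coords n"
  shows "inner (comb v a) (comb w b) = (\<Sum>i<n. coord a i * coord b i * inner (v i) (w i))"
proof -
  have "inner (comb v a) (comb w b) = (\<Sum>i<n. \<Sum>j<n. coord a i * (coord b j * inner (v i) (w j)))"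
    unfolding comb_first_coords[OF a] comb_first_coords[OF b] inner_sum_left
    by (simp add: inner_sum_right sum_distrib_left mult.left_commute)
  also have "\<dots> = (\<Sum>i<n. coord a i * (coord b i * inner (v i) (w i)))"
  proof (rule sum.cong[OF refl])
    fix i assume i: "i \<in> {..<n}"
    have "(\<Sum>j<n. coord a i * (coord b j * inner (v i) (w j))) =
        (\<Sum>j<n. if j = i then coord a i * (coord b i * inner (v i) (w i)) else 0)"
      using assms(1) i by (intro sum.cong) auto
    then show "(\<Sum>j<n. coord a i * (coord b j * inner (v i) (w j))) = coord a i * (coord b i * inner (v i) (w i))"
      using i by simp
  qed
  finally show ?thesis by (simp add: mult.assoc)
qed

lemma norm_comb_orthonormal:
  fixes v :: "nat \<Rightarrow> 'b::real_inner"
  assumes orth: "\<And>i j. i < n \<Longrightarrow> j < n \<Longrightarrow> i \<noteq> j \<Longrightarrow> inner (v i) (v j) = 0"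
    and unit: "\<And>i. i < n \<Longrightarrow> norm (v i) = 1" and a: "a \<in> first_coords n"
  shows "norm (comb v a) = norm a"
proof -
  have u: "inner (v i) (v i) = 1" if "i < n" for i using unit[OF that] by (simp add: dot_square_norm)
  have "inner (comb v a) (comb v a) = inner a a"
    using inner_comb_orthogonal[OF orth a a] u by (simp add: inner_first_coords[OF a])
  then show ?thesis by (simp add: norm_eq_sqrt_inner)
qed

section \<open>Orthonormal systems and traces\<close>

definition orthonormal :: "'b::real_inner set \<Rightarrow> bool"
  where "orthonormal U \<longleftrightarrow> (\<forall>u\<in>U. norm u = 1) \<and> (\<forall>u\<in>U. \<forall>v\<in>U. u \<noteq> v \<longrightarrow> inner u v = 0)"

text \<open>The trace of \<open>B\<close> is computed by splitting each basis vector into its components along and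
  orthogonal to the span of \<open>U\<close>.\<close>

lemma trace_le:
  assumes U: "finite U" "orthonormal U" "U \<subseteq> first_coords n" and B: "linear B"
    and s: "0 \<le> s" "\<And>i a. i < n \<Longrightarrow> a \<in> first_coords n \<Longrightarrow> \<forall>u\<in>U. inner u a = 0 \<Longrightarrow> coord (B a) i \<le> s * norm a"
    and c: "\<And>u. u \<in> U \<Longrightarrow> inner u (B u) \<le> c"
  shows "(\<Sum>i<n. coord (B (ax i)) i) \<le> s * real n + c * real (card U)"
proof -
  define p where "p = (\<lambda>i. ax i - (\<Sum>u\<in>U. coord u i *\<^sub>R u))"
  have le: "coord (B (ax i)) i \<le> s + (\<Sum>u\<in>U. coord u i * coord (B u) i)" if i: "i < n" for i
  proof -
    have "(\<Sum>u\<in>U. coord u i *\<^sub>R u) \<in> first_coords n"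
      using U by (intro subspace_sum subspace_scale subspace_first_coords) auto
    then have pn: "p i \<in> first_coords n"
      unfolding p_def using i by (intro subspace_diff subspace_first_coords ax_first_coords) auto
    have orth: "inner u (p i) = 0" if u: "u \<in> U" for u
    proof -
      have "(\<Sum>w\<in>U. coord w i * inner u w) = (\<Sum>w\<in>U. if w = u then coord u i else 0)"
        using U(2) u by (intro sum.cong) (auto simp: orthonormal_def dot_square_norm)
      then show ?thesis using U(1) u by (simp add: p_def inner_diff_right inner_sum_right)
    qed
    \<comment> \<open>Since \<open>p i\<close> is orthogonal to \<open>U\<close>, its square norm is
      its \<open>i\<close>-th coordinate, that is 1 minus the squares of
      \<open>coord u i\<close>.\<close>
    have "inner (p i) (p i) = inner (ax i) (p i) - (\<Sum>u\<in>U. coord u i * inner u (p i))"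
      by (simp add: p_def inner_diff_left inner_sum_left)
    also have "\<dots> \<le> 1"
      by (simp add: orth) (simp add: p_def coord_ax coord_sum sum_nonneg)
    finally have "norm (p i) \<le> 1" by (simp add: norm_eq_sqrt_inner)
    then have "coord (B (p i)) i \<le> s"
      using s(2)[OF i pn] orth mult_left_mono[of "norm (p i)" 1 s] s(1) by force
    moreover have "B (ax i) = B (p i) + (\<Sum>u\<in>U. coord u i *\<^sub>R B u)"
      using B by (simp add: p_def linear_diff linear_sum linear_scale)
    ultimately show ?thesis by (simp add: coord_sum)
  qed
  have "(\<Sum>i<n. coord (B (ax i)) i) \<le> (\<Sum>i<n. s + (\<Sum>u\<in>U. coord u i * coord (B u) i))"
    using le by (intro sum_mono) auto
  also have "\<dots> = s * real n + (\<Sum>u\<in>U. \<Sum>i<n. coord u i * coord (B u) i)"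
    by (subst sum.swap) (simp add: sum.distrib)
  also have "(\<Sum>u\<in>U. \<Sum>i<n. coord u i * coord (B u) i) = (\<Sum>u\<in>U. inner u (B u))"
    using U(3) by (intro sum.cong) (auto simp: inner_first_coords)
  also have "\<dots> \<le> (\<Sum>u\<in>U. c)" using c by (intro sum_mono) auto
  finally show ?thesis by (simp add: mult.commute)
qed

text \<open>The supremum of \<open>inner w a\<close> over \<open>w \<in> K\<close> is a gauge on
  sequences. On the span of the \<open>u i\<close> it is at most \<open>s\<close> times the
  Euclidean norm, and at each \<open>u i\<close> this is attained up to the factor \<open>c\<close>,
  with witness \<open>z i\<close>.\<close>

definition almost_extremal ::
    "nat \<Rightarrow> nat \<Rightarrow> real \<Rightarrow> fin_seq set \<Rightarrow> real \<Rightarrow> (nat \<Rightarrow> fin_seq) \<Rightarrow> (nat \<Rightarrow> fin_seq) \<Rightarrow> bool"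
  where "almost_extremal m n c K s u z \<longleftrightarrow> s > 0 \<and>
    (\<forall>i<m. u i \<in> first_coords n \<and> norm (u i) = 1 \<and> z i \<in> K \<and> c * s \<le> inner (z i) (u i)) \<and>
    (\<forall>i<m. \<forall>j<m. i \<noteq> j \<longrightarrow> inner (u i) (u j) = 0) \<and>
    (\<forall>w\<in>K. \<forall>a\<in>span (u ` {..<m}). inner w a \<le> s * norm a)"

lemma almost_extremalD:
  assumes "almost_extremal m n c K s u z"
  shows "s > 0" "\<And>i. i < m \<Longrightarrow> u i \<in> first_coords n" "\<And>i. i < m \<Longrightarrow> norm (u i) = 1"
    "\<And>i. i < m \<Longrightarrow> z i \<in> K" "\<And>i. i < m \<Longrightarrow> c * s \<le> inner (z i) (u i)"
    "\<And>i j. i < m \<Longrightarrow> j < m \<Longrightarrow> i \<noteq> j \<Longrightarrow> inner (u i) (u j) = 0"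
    "\<And>w a. w \<in> K \<Longrightarrow> a \<in> span (u ` {..<m}) \<Longrightarrow> inner w a \<le> s * norm a"
  using assms unfolding almost_extremal_def by blast+

text \<open>Dvoretzky--Rogers by a greedy choice: the suprema over the orthogonal complements of the
  vectors chosen so far decrease from at most \<open>R\<close> to at least \<open>1/2\<close>, so over some window of
  \<open>m\<close> steps they hardly decrease at all.\<close>

lemma greedy_orthonormal:
  assumes K: "\<And>z. z \<in> K \<Longrightarrow> norm z \<le> R" "\<And>i. i < n \<Longrightarrow> ax i \<in> K"
    and n: "n = 2 * l * m" "m > 0" "l > 0" and \<eta>: "0 < \<eta>" "\<eta> < 1" "(1 - \<eta>) ^ l * R < 1 / 2"
  shows "\<exists>s u z. almost_extremal m n ((1 - \<eta>)\<^sup>2) K s u z"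
proof -
  define C where "C = (\<lambda>U. {inner w a | w a. w \<in> K \<and> a \<in> first_coords n \<and> norm a \<le> 1 \<and> (\<forall>u\<in>U. inner u a = 0)})"
  define \<sigma> where "\<sigma> = (\<lambda>U. Sup (C U))"
  have n0: "n > 0" using n by simp
  have R: "R \<ge> 0" using K(1)[OF K(2)[OF n0]] norm_ge_zero order_trans by blast
  have leR: "x \<le> R" if "x \<in> C U" for x U
  proof -
    obtain w a where wa: "x = inner w a" "w \<in> K" "norm a \<le> 1" using \<open>x \<in> C U\<close> by (auto simp: C_def)
    have "inner w a \<le> norm w * norm a" by (rule norm_cauchy_schwarz)
    also have "\<dots> \<le> R * 1" using K(1)[OF wa(2)] wa(3) R by (intro mult_mono) auto
    finally show ?thesis using wa by simp
  qed
  have bdd: "bdd_above (C U)" for U by (rule bdd_aboveI[OF leR])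
  have 0: "0 \<in> C U" for U
    unfolding C_def using K(2)[OF n0] subspace_0[OF subspace_first_coords]
    by (intro CollectI exI[of _ "ax 0"] exI[of _ 0]) auto
  have \<sigma>0: "\<sigma> U \<ge> 0" for U unfolding \<sigma>_def using bdd 0 by (intro cSup_upper) auto
  have \<sigma>R: "\<sigma> U \<le> R" for U unfolding \<sigma>_def using 0 leR by (intro cSup_least) auto
  have \<sigma>: "inner w a \<le> \<sigma> U * norm a" if "w \<in> K" "a \<in> first_coords n" "\<forall>u\<in>U. inner u a = 0" for w a U
  proof (cases "a = 0")
    case False
    have "inner w (a /\<^sub>R norm a) \<in> C U"
      unfolding C_def using that False
      by (intro CollectI exI[of _ w] exI[of _ "a /\<^sub>R norm a"]) (auto intro: subspace_scale subspace_first_coords)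
    then have "inner w (a /\<^sub>R norm a) \<le> \<sigma> U" unfolding \<sigma>_def using bdd by (rule cSup_upper)
    then show ?thesis using False by (simp add: field_simps)
  qed simp
  have anti: "\<sigma> V \<le> \<sigma> U" if "U \<subseteq> V" for U V
  proof -
    have "C V \<subseteq> C U" using that unfolding C_def by blast
    then show ?thesis unfolding \<sigma>_def using 0 bdd by (intro cSup_subset_mono) auto
  qed
  \<comment> \<open>The trace of the identity is \<open>n\<close>. As the \<open>ax i\<close> lie in
    \<open>K\<close>, it is at most \<open>\<sigma> U * n\<close> plus the number of vectors in
    \<open>U\<close>, and these are at most \<open>n / 2\<close>.\<close>
  have half: "1 / 2 \<le> \<sigma> U" if U: "finite U" "orthonormal U" "U \<subseteq> first_coords n" "2 * card U \<le> n" for U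
  proof -
    have "(\<Sum>i<n. coord (id (ax i)) i) \<le> \<sigma> U * real n + 1 * real (card U)"
    proof (rule trace_le[OF U(1-3) linear_id \<sigma>0])
      show "coord (id a) i \<le> \<sigma> U * norm a" if "i < n" "a \<in> first_coords n" "\<forall>u\<in>U. inner u a = 0" for i a
        using \<sigma>[OF K(2)[OF that(1)] that(2,3)] by simp
      show "inner u (id u) \<le> 1" if "u \<in> U" for u
        using U(2) that by (simp add: orthonormal_def dot_square_norm)
    qed
    then have "real n \<le> \<sigma> U * real n + real (card U)" by (simp add: coord_ax)
    moreover have "real (2 * card U) \<le> real n" using U(4) of_nat_le_iff by blast
    ultimately have "real n * (1 / 2) \<le> real n * \<sigma> U" by (simp add: mult.commute)
    then show ?thesis using n0 by simp
  qed
  have "\<exists>u z. \<sigma> U > 0 \<longrightarrow> u \<in> first_coords n \<and> norm u = 1 \<and> (\<forall>v\<in>U. inner v u = 0) \<and> z \<in> K \<and>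
      (1 - \<eta>) * \<sigma> U \<le> inner z u" for U
  proof (cases "\<sigma> U > 0")
    case True
    then have "(1 - \<eta>) * \<sigma> U < \<sigma> U" using \<eta> by simp
    then obtain x where x: "x \<in> C U" "(1 - \<eta>) * \<sigma> U < x"
      using less_cSupD[of "C U" "(1 - \<eta>) * \<sigma> U"] 0 unfolding \<sigma>_def by blast
    then obtain w a where wa: "x = inner w a" "w \<in> K" "a \<in> first_coords n" "norm a \<le> 1" "\<forall>u\<in>U. inner u a = 0"
      by (auto simp: C_def)
    have pos: "0 \<le> (1 - \<eta>) * \<sigma> U" using True \<eta> by simp
    then have a0: "a \<noteq> 0" using x wa by auto
    have "inner w a \<le> inner w a / norm a"
      using a0 wa(1,4) x(2) pos by (simp add: le_divide_eq mult_left_le)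
    then have "(1 - \<eta>) * \<sigma> U \<le> inner w (a /\<^sub>R norm a)"
      using x wa(1) by (simp add: field_simps)
    moreover have "a /\<^sub>R norm a \<in> first_coords n" using wa(3) by (intro subspace_scale subspace_first_coords)
    ultimately show ?thesis using wa a0
      by (intro exI[of _ "a /\<^sub>R norm a"] exI[of _ w]) auto
  qed auto
  then obtain fu fz where f: "\<And>U. \<sigma> U > 0 \<Longrightarrow> fu U \<in> first_coords n \<and> norm (fu U) = 1 \<and>
      (\<forall>v\<in>U. inner v (fu U) = 0) \<and> fz U \<in> K \<and> (1 - \<eta>) * \<sigma> U \<le> inner (fz U) (fu U)"
    by metis
  define V where "V = rec_nat {} (\<lambda>_ U. insert (fu U) U)"
  have V0: "V 0 = {}" and VS: "V (Suc k) = insert (fu (V k)) (V k)" for k by (simp_all add: V_def)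
  define u where "u = (\<lambda>k. fu (V k))"
  define z where "z = (\<lambda>k. fz (V k))"
  have Vu: "V k = u ` {..<k}" for k
    by (induction k) (auto simp: V0 VS u_def lessThan_Suc)
  have VV: "finite (V k) \<and> orthonormal (V k) \<and> V k \<subseteq> first_coords n \<and> card (V k) = k \<and> \<sigma> (V k) \<ge> 1/2"
    if "2 * k \<le> n" for k
    using that
  proof (induction k)
    case 0
    then show ?case using half[of "{}"] by (simp add: V0 orthonormal_def)
  next
    case (Suc k)
    then have IH: "finite (V k)" "orthonormal (V k)" "V k \<subseteq> first_coords n" "card (V k) = k" "\<sigma> (V k) \<ge> 1/2"
      by auto
    note fV = f[of "V k"]
    have fV: "fu (V k) \<in> first_coords n" "norm (fu (V k)) = 1" "\<And>v. v \<in> V k \<Longrightarrow> inner v (fu (V k)) = 0"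
      using fV IH(5) by auto
    have "fu (V k) \<notin> V k" using fV(2) fV(3)[of "fu (V k)"] by (auto simp: dot_square_norm)
    then have 1: "finite (V (Suc k))" "V (Suc k) \<subseteq> first_coords n" "card (V (Suc k)) = Suc k"
      using IH fV(1) by (auto simp: VS)
    moreover have 2: "orthonormal (V (Suc k))"
      using IH(2) fV(2,3) by (auto simp: VS orthonormal_def inner_commute)
    ultimately show ?case using half[OF 1(1) 2 1(2)] Suc.prems by simp
  qed
  \<comment> \<open>The factor 2 in \<open>n = 2 * l * m\<close> ensures that after all
    \<open>l\<close> windows, that is \<open>l * m\<close> choices, the lower bound
    \<open>1 / 2\<close> is still available.\<close>
  have "\<exists>j<l. (1 - \<eta>) * \<sigma> (V (j * m)) \<le> \<sigma> (V (Suc j * m))"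
  proof (rule ccontr)
    assume "\<not> ?thesis"
    then have lt: "\<And>j. j < l \<Longrightarrow> \<sigma> (V (Suc j * m)) < (1 - \<eta>) * \<sigma> (V (j * m))" by (meson not_le)
    have "\<sigma> (V (j * m)) \<le> (1 - \<eta>) ^ j * R" if "j \<le> l" for j
      using that
    proof (induction j)
      case (Suc j)
      have "\<sigma> (V (Suc j * m)) \<le> (1 - \<eta>) * \<sigma> (V (j * m))" using lt[of j] Suc.prems by simp
      also have "\<dots> \<le> (1 - \<eta>) * ((1 - \<eta>) ^ j * R)" using Suc \<eta> by (intro mult_left_mono) auto
      finally show ?case by simp
    qed (simp add: \<sigma>R)
    from this[of l] have "\<sigma> (V (l * m)) < 1/2" using \<eta>(3) by simp
    moreover have "\<sigma> (V (l * m)) \<ge> 1/2" using VV[of "l * m"] n by simp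
    ultimately show False by simp
  qed
  then obtain j where j: "j < l" "(1 - \<eta>) * \<sigma> (V (j * m)) \<le> \<sigma> (V (Suc j * m))" by blast
  have "Suc j * m \<le> l * m" using j(1) by (intro mult_right_mono) auto
  then have small: "2 * (j * m + i) \<le> n" "j * m + i < Suc j * m" if "i < m" for i
    using that n by auto
  have pos: "\<sigma> (V (j * m + i)) > 0" if "i < m" for i
    using VV[OF small(1)[OF that]] by simp
  have fi: "u (j * m + i) \<in> first_coords n" "norm (u (j * m + i)) = 1"
      "\<And>v. v \<in> V (j * m + i) \<Longrightarrow> inner v (u (j * m + i)) = 0"
      "z (j * m + i) \<in> K" "(1 - \<eta>) * \<sigma> (V (j * m + i)) \<le> inner (z (j * m + i)) (u (j * m + i))" if "i < m" for i
    using f[OF pos[OF that]] by (auto simp: u_def z_def)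
  define s where "s = \<sigma> (V (j * m))"
  have "almost_extremal m n ((1 - \<eta>)\<^sup>2) K s (\<lambda>i. u (j * m + i)) (\<lambda>i. z (j * m + i))"
    unfolding almost_extremal_def
  proof (intro conjI allI impI ballI)
    show "s > 0" using pos[of 0] n(2) by (simp add: s_def)
    fix i assume i: "i < m"
    show "u (j * m + i) \<in> first_coords n" "norm (u (j * m + i)) = 1" "z (j * m + i) \<in> K"
      using fi[OF i] by auto
    \<comment> \<open>One factor \<open>1 - \<eta>\<close> is lost within the window, the other
      because each supremum is only nearly attained.\<close>
    have "(1 - \<eta>) * s \<le> \<sigma> (V (Suc j * m))" using j(2) by (simp add: s_def)
    also have "\<dots> \<le> \<sigma> (V (j * m + i))" using small(2)[OF i] by (intro anti) (auto simp: Vu)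
    finally have "(1 - \<eta>) * ((1 - \<eta>) * s) \<le> (1 - \<eta>) * \<sigma> (V (j * m + i))"
      using \<eta> by (intro mult_left_mono) auto
    then show "(1 - \<eta>)\<^sup>2 * s \<le> inner (z (j * m + i)) (u (j * m + i))"
      using fi(5)[OF i] by (simp add: power2_eq_square)
    have lt: "inner (u (j * m + i')) (u (j * m + k)) = 0" if "i' < k" "k < m" for i' k
      using fi(3)[of k "u (j * m + i')"] that by (auto simp: Vu)
    fix k assume "k < m" "i \<noteq> k"
    then show "inner (u (j * m + i)) (u (j * m + k)) = 0"
      using lt[of i k] lt[of k i] i by (cases i k rule: linorder_cases) (auto simp: inner_commute)
  next
    fix w a assume w: "w \<in> K" and a: "a \<in> span ((\<lambda>i. u (j * m + i)) ` {..<m})"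
    have "subspace ({x. \<forall>v\<in>V (j * m). inner v x = 0} \<inter> first_coords n)"
      by (auto simp: subspace_def inner_add_right subspace_first_coords[unfolded subspace_def])
    moreover have "u (j * m + i) \<in> {x. \<forall>v\<in>V (j * m). inner v x = 0} \<inter> first_coords n" if "i < m" for i
      using fi(1,3)[OF that] by (auto simp: Vu)
    ultimately have "a \<in> {x. \<forall>v\<in>V (j * m). inner v x = 0} \<inter> first_coords n"
      using a span_minimal[of "(\<lambda>i. u (j * m + i)) ` {..<m}"] by blast
    then show "inner w a \<le> s * norm a" unfolding s_def using \<sigma>[OF w] by blast
  qed
  then show ?thesis by blast
qed

lemma orthonormal_basis_exists:
  fixes S :: "'b::real_inner set"
  assumes "finite S"
  obtains U where "finite U" "card U \<le> card S" "span U = span S" "orthonormal U"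
proof -
  obtain C where C: "finite C" "card C \<le> card S" "span C = span S" "pairwise orthogonal C"
    using basis_orthogonal[OF assms] by blast
  define U where "U = (\<lambda>x. x /\<^sub>R norm x) ` (C - {0})"
  have "card U \<le> card (C - {0})" unfolding U_def using C(1) by (intro card_image_le) auto
  also have "\<dots> \<le> card C" using C(1) by (intro card_mono) auto
  finally have 1: "card U \<le> card S" using C(2) by simp
  have "U \<subseteq> span C" unfolding U_def by (auto intro: span_scale span_base)
  moreover have "x \<in> span U" if x: "x \<in> C" for x
  proof (cases "x = 0")
    case False
    have "norm x *\<^sub>R (x /\<^sub>R norm x) \<in> span U"
      using x False by (intro span_scale span_base) (auto simp: U_def)
    then show ?thesis using False by simp
  qed (simp add: span_zero)
  ultimately have 2: "span U = span S" using C(3) by (metis span_eq subsetI)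
  have "orthonormal U"
    using C(4) by (auto simp: orthonormal_def U_def pairwise_def orthogonal_def)
  moreover have "finite U" using C(1) by (simp add: U_def)
  ultimately show thesis using that[of U] 1 2 by simp
qed

text \<open>A new vector must be orthogonal to at most \<open>2 * k\<close> vectors: the old
  \<open>v i\<close>, and representers that make its image orthogonal to theirs. If \<open>B\<close>
  were small on all such vectors, \<open>trace_le\<close> would bound the trace by
  \<open>\<beta> / 2 * m + 2 * k * c\<close>, too little for a diagonal of at least
  \<open>\<beta>\<close>. On the span of the resulting \<open>v i\<close> the map \<open>B\<close>
  is bounded below by \<open>\<beta> / 2\<close>.\<close>

lemma euclidean_image:
  assumes B: "linear B" and bd: "\<And>a. a \<in> first_coords m \<Longrightarrow> norm (B a) \<le> c * norm a"
    and diag: "\<And>i. i < m \<Longrightarrow> \<beta> \<le> coord (B (ax i)) i" and \<beta>: "\<beta> > 0" "c \<ge> 0" "4 * real N * c < \<beta> * real m"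
  shows "k \<le> N \<Longrightarrow> \<exists>v. (\<forall>i<k. v i \<in> first_coords m \<and> norm (v i) = 1 \<and> \<beta> / 2 \<le> norm (B (v i))) \<and>
    (\<forall>i<k. \<forall>j<k. i \<noteq> j \<longrightarrow> inner (v i) (v j) = 0 \<and> inner (B (v i)) (B (v j)) = 0)"
proof (induction k)
  case (Suc k)
  then have "\<exists>v. (\<forall>i<k. v i \<in> first_coords m \<and> norm (v i) = 1 \<and> \<beta> / 2 \<le> norm (B (v i))) \<and>
    (\<forall>i<k. \<forall>j<k. i \<noteq> j \<longrightarrow> inner (v i) (v j) = 0 \<and> inner (B (v i)) (B (v j)) = 0)" by simp
  then obtain v where v: "\<forall>i<k. v i \<in> first_coords m \<and> norm (v i) = 1 \<and> \<beta> / 2 \<le> norm (B (v i))"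
    "\<forall>i<k. \<forall>j<k. i \<noteq> j \<longrightarrow> inner (v i) (v j) = 0 \<and> inner (B (v i)) (B (v j)) = 0"
    by (elim exE conjE)
  \<comment> \<open>On the first \<open>m\<close> coordinates \<open>g l\<close> represents the
    functional \<open>a \<mapsto> inner (B a) (B (v l))\<close>; it is the adjoint of
    \<open>B\<close> applied to \<open>B (v l)\<close>.\<close>
  define g where "g = (\<lambda>l. \<Sum>i<m. inner (B (ax i)) (B (v l)) *\<^sub>R ax i)"
  have gm: "g l \<in> first_coords m" for l
    unfolding g_def by (intro subspace_sum subspace_scale subspace_first_coords ax_first_coords) auto
  have g: "inner (g l) a = inner (B a) (B (v l))" if a: "a \<in> first_coords m" for a l
  proof -
    have "B a = (\<Sum>i<m. coord a i *\<^sub>R B (ax i))"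
      using linear_eq_comb[OF B, of a] by (simp add: comb_first_coords[OF a])
    then show ?thesis by (simp add: g_def inner_sum_left mult.commute)
  qed
  define S where "S = v ` {..<k} \<union> g ` {..<k}"
  have Sm: "S \<subseteq> first_coords m" using v(1) gm by (auto simp: S_def)
  have "card S \<le> card (v ` {..<k}) + card (g ` {..<k})" unfolding S_def by (rule card_Un_le)
  also have "\<dots> \<le> 2 * k" using card_image_le[of "{..<k}" v] card_image_le[of "{..<k}" g] by simp
  finally have Sk: "card S \<le> 2 * k" .
  have "finite S" by (simp add: S_def)
  then obtain U where U: "finite U" "card U \<le> card S" "span U = span S" "orthonormal U"
    by (rule orthonormal_basis_exists)
  have Um: "U \<subseteq> first_coords m"
    using U(3) span_minimal[OF Sm subspace_first_coords] span_superset[of U] by auto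
  have "\<exists>a\<in>first_coords m. (\<forall>u\<in>U. inner u a = 0) \<and> \<beta> / 2 * norm a < norm (B a)"
  proof (rule ccontr)
    assume "\<not> ?thesis"
    then have no: "\<And>a. a \<in> first_coords m \<Longrightarrow> \<forall>u\<in>U. inner u a = 0 \<Longrightarrow> norm (B a) \<le> \<beta> / 2 * norm a"
      by (meson not_le)
    have "(\<Sum>i<m. coord (B (ax i)) i) \<le> \<beta> / 2 * real m + c * real (card U)"
    proof (rule trace_le[OF U(1,4) Um B])
      show "coord (B a) i \<le> \<beta> / 2 * norm a" if "i < m" "a \<in> first_coords m" "\<forall>u\<in>U. inner u a = 0" for i a
        using norm_cauchy_schwarz[of "ax i" "B a"] no[OF that(2,3)] by simp
      show "inner u (B u) \<le> c" if u: "u \<in> U" for u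
      proof -
        have "norm u = 1" "u \<in> first_coords m" using U(4) Um u by (auto simp: orthonormal_def)
        then show ?thesis using norm_cauchy_schwarz[of u "B u"] bd[of u] by simp
      qed
    qed (use \<beta> in auto)
    moreover have "\<beta> * real m \<le> (\<Sum>i<m. coord (B (ax i)) i)"
      using sum_mono[of "{..<m}" "\<lambda>_. \<beta>" "\<lambda>i. coord (B (ax i)) i"] diag by (simp add: mult.commute)
    moreover have "c * real (card U) \<le> c * (2 * real N)"
      using U(2) Sk Suc.prems \<beta>(2) by (intro mult_left_mono) auto
    ultimately show False using \<beta>(3) by (simp add: algebra_simps)
  qed
  then obtain a where a: "a \<in> first_coords m" "\<forall>u\<in>U. inner u a = 0" "\<beta> / 2 * norm a < norm (B a)"
    by blast
  have "S \<subseteq> {x. inner x a = 0}"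
  proof -
    have "subspace {x. inner x a = 0}" by (auto simp: subspace_def inner_add_left)
    then have "span U \<subseteq> {x. inner x a = 0}" using a(2) by (intro span_minimal) auto
    then show ?thesis using U(3) span_superset[of S] by auto
  qed
  then have av: "inner (v i) a = 0" "inner (B a) (B (v i)) = 0" if "i < k" for i
    using that g[OF a(1), of i] by (auto simp: S_def)
  have a0: "a \<noteq> 0" using a(3) linear_0[OF B] by auto
  define a' where "a' = a /\<^sub>R norm a"
  have a': "a' \<in> first_coords m" "norm a' = 1"
    using a(1) a0 by (auto simp: a'_def intro: subspace_scale subspace_first_coords)
  have Ba': "B a' = B a /\<^sub>R norm a" using B by (simp add: a'_def linear_scale)
  have "\<beta> / 2 \<le> norm (B a')" using a(3) a0 by (simp add: Ba' field_simps)
  moreover have "inner (v i) a' = 0" "inner (B (v i)) (B a') = 0" if "i < k" for i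
    unfolding Ba' using av[OF that] by (simp_all add: a'_def inner_commute)
  ultimately show ?case
    using v a' by (intro exI[of _ "v(k := a')"]) (auto simp: less_Suc_eq inner_commute)
qed simp

section \<open>Finite-codimensional subspaces\<close>

definition fin_functionals :: "('a::real_normed_vector \<Rightarrow> real) set \<Rightarrow> bool"
  where "fin_functionals \<Phi> \<longleftrightarrow> finite \<Phi> \<and> (\<forall>\<phi>\<in>\<Phi>. bounded_linear \<phi>)"

text \<open>Finite-codimensional subspaces are carried along as finite sets of functionals;
  intersecting them amounts to uniting these sets.\<close>

definition common_kernel :: "('a::real_normed_vector \<Rightarrow> real) set \<Rightarrow> 'a set"
  where "common_kernel \<Phi> = {x. \<forall>\<phi>\<in>\<Phi>. \<phi> x = 0}"

lemma fin_functionals_Un: "fin_functionals \<Phi> \<Longrightarrow> fin_functionals \<Psi> \<Longrightarrow> fin_functionals (\<Phi> \<union> \<Psi>)"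
  by (auto simp: fin_functionals_def)

lemma common_kernel_Un: "common_kernel (\<Phi> \<union> \<Psi>) = common_kernel \<Phi> \<inter> common_kernel \<Psi>"
  by (auto simp: common_kernel_def)

lemma subspace_common_kernel: "fin_functionals \<Phi> \<Longrightarrow> subspace (common_kernel \<Phi>)"
  by (auto simp: subspace_def common_kernel_def fin_functionals_def bounded_linear.linear
      linear_0 linear_add linear_scale)

lemma span_subset_common_kernel:
  "fin_functionals \<Phi> \<Longrightarrow> B \<subseteq> common_kernel \<Phi> \<Longrightarrow> span B \<subseteq> common_kernel \<Phi>"
  by (intro span_minimal subspace_common_kernel)

lemma bounded_linear_if_le_norm:
  fixes g :: "'a::real_normed_vector \<Rightarrow> real"
  assumes "linear g" "\<And>x. \<bar>g x\<bar> \<le> K * norm x"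
  shows "bounded_linear g"
  using assms by (intro bounded_linear.intro bounded_linear_axioms.intro exI[of _ K]) (auto simp: mult.commute)

lemma compact_finite_net:
  fixes S :: "'a::metric_space set"
  assumes "compact S" "e > 0"
  shows "\<exists>k. finite k \<and> S \<subseteq> (\<Union>p\<in>k. ball p e)"
  using assms unfolding compact_eq_totally_bounded by blast

text \<open>The property is stated by its consequence: the projection of the sum of \<open>V\<close>
  and the kernel onto \<open>V\<close> has norm at most 2.\<close>

definition norming :: "'a::real_normed_vector set \<Rightarrow> ('a \<Rightarrow> real) set \<Rightarrow> bool"
  where "norming V \<Psi> \<longleftrightarrow> (\<forall>x\<in>V. \<forall>y\<in>common_kernel \<Psi>. norm x \<le> 2 * norm (x + y))"

text \<open>Functionals norming the points \<open>p\<close> of a \<open>1 / 4\<close>-net of the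
  unit ball suffice. If \<open>e\<close> is a unit vector near \<open>p\<close>, then
  \<open>norm p\<close> exceeds \<open>3 / 4\<close> and \<open>g p e\<close> exceeds
  \<open>1 / 2\<close>.\<close>

lemma norming_exists:
  fixes B :: "'a::real_normed_vector set"
  assumes "finite B"
  shows "\<exists>\<Psi>. fin_functionals \<Psi> \<and> norming (span B) \<Psi>"
proof -
  have "compact {x \<in> span B. norm x \<le> 1}" by (rule compact_span_ball[OF assms])
  then have "\<exists>k. finite k \<and> {x \<in> span B. norm x \<le> 1} \<subseteq> (\<Union>p\<in>k. ball p (1/4))"
    by (rule compact_finite_net) simp
  then obtain k where k: "finite k" "{x \<in> span B. norm x \<le> 1} \<subseteq> (\<Union>p\<in>k. ball p (1/4))" by blast
  have "\<exists>g :: 'a \<Rightarrow> real. linear g \<and> (\<forall>x. \<bar>g x\<bar> \<le> norm x) \<and> g p = norm p" for p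
    using norming_functional[of p] by metis
  then obtain g :: "'a \<Rightarrow> 'a \<Rightarrow> real" where g: "\<And>p. linear (g p)" "\<And>p x. \<bar>g p x\<bar> \<le> norm x" "\<And>p. g p p = norm p"
    by metis
  have "fin_functionals (g ` k)"
    unfolding fin_functionals_def using k(1) g(1,2) by (auto intro!: bounded_linear_if_le_norm[of _ 1])
  moreover have "norm x \<le> 2 * norm (x + y)" if x: "x \<in> span B" and y: "y \<in> common_kernel (g ` k)" for x y
  proof (cases "x = 0")
    case False
    define e where "e = x /\<^sub>R norm x"
    have e: "e \<in> span B" "norm e = 1" using x False by (auto simp: e_def intro: span_scale)
    then obtain p where p: "p \<in> k" "norm (p - e) < 1/4" using k(2) by (force simp: dist_norm)
    have "norm p \<ge> norm e - norm (p - e)" using norm_triangle_ineq2[of e p] by (simp add: norm_minus_commute)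
    moreover have "g p e = norm p - g p (p - e)" using g(1,3) by (simp add: linear_diff)
    moreover have "\<bar>g p (p - e)\<bar> \<le> norm (p - e)" by (rule g)
    ultimately have "1 \<le> 2 * g p e" using p e by linarith
    moreover have "g p x = norm x * g p e" using False g(1) by (simp add: e_def linear_scale)
    ultimately have "norm x \<le> 2 * g p x" using mult_left_mono[of 1 "2 * g p e" "norm x"] by simp
    also have "g p x = g p (x + y)" using y p(1) g(1) by (simp add: common_kernel_def linear_add)
    also have "2 * \<dots> \<le> 2 * norm (x + y)" using g(2)[of p "x + y"] by simp
    finally show ?thesis .
  qed simp
  ultimately show ?thesis unfolding norming_def by blast
qed

text \<open>The bound 4 is twice the bound 2 for partial sums, because a single term is a difference
  of two of them.\<close>

definition biorthogonal :: "nat \<Rightarrow> (nat \<Rightarrow> 'a::real_normed_vector) \<Rightarrow> (nat \<Rightarrow> 'a \<Rightarrow> real) \<Rightarrow> bool"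
  where "biorthogonal n x \<psi> \<longleftrightarrow> (\<forall>i<n. norm (x i) = 1 \<and> linear (\<psi> i) \<and> (\<forall>y. \<bar>\<psi> i y\<bar> \<le> 4 * norm y) \<and>
    (\<forall>j<n. \<psi> i (x j) = (if i = j then 1 else 0)))"

text \<open>Mazur's construction: each vector lies in the kernels of functionals norming the span of its
  predecessors.\<close>

lemma biorthogonal_exists:
  fixes \<Phi> :: "('a::real_normed_vector \<Rightarrow> real) set"
  assumes nd: "\<And>\<Phi> :: ('a \<Rightarrow> real) set. fin_functionals \<Phi> \<Longrightarrow> \<exists>x\<in>common_kernel \<Phi>. x \<noteq> 0"
    and \<Phi>: "fin_functionals \<Phi>"
  shows "\<exists>x \<psi>. biorthogonal n x \<psi> \<and> x ` {..<n} \<subseteq> common_kernel \<Phi>"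
proof -
  \<comment> \<open>The arbitrary summand \<open>y\<close> from the kernel carries the induction:
    the multiple of the next vector is absorbed into it.\<close>
  have "\<exists>(x :: nat \<Rightarrow> 'a) \<Psi>. fin_functionals \<Psi> \<and> common_kernel \<Psi> \<subseteq> common_kernel \<Phi> \<and>
    (\<forall>i<n. x i \<in> common_kernel \<Phi> \<and> norm (x i) = 1) \<and>
    (\<forall>k\<le>n. \<forall>a. \<forall>y\<in>common_kernel \<Psi>. norm (\<Sum>i<k. a i *\<^sub>R x i) \<le> 2 * norm ((\<Sum>i<n. a i *\<^sub>R x i) + y))"
  proof (induction n)
    case 0
    show ?case using \<Phi> by (auto intro!: exI[of _ \<Phi>])
  next
    case (Suc n)
    then obtain x :: "nat \<Rightarrow> 'a" and \<Psi> where \<Psi>: "fin_functionals \<Psi>" "common_kernel \<Psi> \<subseteq> common_kernel \<Phi>"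
      and x: "\<forall>i<n. x i \<in> common_kernel \<Phi> \<and> norm (x i) = 1"
      and "\<forall>k\<le>n. \<forall>a. \<forall>y\<in>common_kernel \<Psi>.
        norm (\<Sum>i<k. a i *\<^sub>R x i) \<le> 2 * norm ((\<Sum>i<n. a i *\<^sub>R x i) + y)"
      by (elim exE conjE)
    note le = this(4)[rule_format] and x = x[rule_format]
    obtain z where z: "z \<in> common_kernel \<Psi>" "z \<noteq> 0" using nd[OF \<Psi>(1)] by blast
    define z' where "z' = z /\<^sub>R norm z"
    have z': "z' \<in> common_kernel \<Psi>" "norm z' = 1"
      using z subspace_scale[OF subspace_common_kernel[OF \<Psi>(1)]] by (auto simp: z'_def)
    define x' where "x' = x(n := z')"
    obtain \<Theta> where \<Theta>: "fin_functionals \<Theta>" "norming (span (x' ` {..<Suc n})) \<Theta>"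
      using norming_exists[of "x' ` {..<Suc n}"] by blast
    have eq: "(\<Sum>i<k. a i *\<^sub>R x' i) = (\<Sum>i<k. a i *\<^sub>R x i)" if "k \<le> n" for k and a :: "nat \<Rightarrow> real"
      using that by (intro sum.cong) (auto simp: x'_def)
    show ?case
    proof (intro exI[of _ x'] exI[of _ "\<Psi> \<union> \<Theta>"] conjI allI impI ballI)
      show "fin_functionals (\<Psi> \<union> \<Theta>)" using \<Psi> \<Theta> by (intro fin_functionals_Un)
      show "common_kernel (\<Psi> \<union> \<Theta>) \<subseteq> common_kernel \<Phi>" using \<Psi>(2) by (auto simp: common_kernel_Un)
      fix i assume "i < Suc n"
      then show "x' i \<in> common_kernel \<Phi>" "norm (x' i) = 1"
        using x[of i] z' \<Psi>(2) by (auto simp: x'_def)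
    next
      fix k a y assume k: "k \<le> Suc n" and y: "y \<in> common_kernel (\<Psi> \<union> \<Theta>)"
      show "norm (\<Sum>i<k. a i *\<^sub>R x' i) \<le> 2 * norm ((\<Sum>i<Suc n. a i *\<^sub>R x' i) + y)"
      proof (cases "k = Suc n")
        case True
        have "(\<Sum>i<Suc n. a i *\<^sub>R x' i) \<in> span (x' ` {..<Suc n})"
          by (intro span_sum span_scale span_base) auto
        then show ?thesis using \<Theta>(2) y True by (auto simp: norming_def common_kernel_Un)
      next
        case False
        have "a n *\<^sub>R z' + y \<in> common_kernel \<Psi>"
          using y z'(1) subspace_common_kernel[OF \<Psi>(1)]
          by (auto simp: common_kernel_Un intro: subspace_add subspace_scale)
        from le[OF _ this, of k a] show ?thesis using k False eq[of k a] eq[of n a]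
          by (simp add: x'_def add.assoc)
      qed
    qed
  qed
  then obtain x :: "nat \<Rightarrow> 'a" and \<Psi> where \<Psi>: "fin_functionals \<Psi>"
    and "common_kernel \<Psi> \<subseteq> common_kernel \<Phi>"
    and x: "\<forall>i<n. x i \<in> common_kernel \<Phi> \<and> norm (x i) = 1"
    and "\<forall>k\<le>n. \<forall>a. \<forall>y\<in>common_kernel \<Psi>.
        norm (\<Sum>i<k. a i *\<^sub>R x i) \<le> 2 * norm ((\<Sum>i<n. a i *\<^sub>R x i) + y)"
    by (elim exE conjE)
  note le = this(4)[rule_format] and x = x[rule_format]
  have "\<exists>\<psi>. linear \<psi> \<and> (\<forall>y. \<bar>\<psi> y\<bar> \<le> 4 * norm y) \<and> (\<forall>j<n. \<psi> (x j) = (if k = j then 1 else (0::real)))"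
    if k: "k < n" for k
  proof -
    \<comment> \<open>\<open>T\<close> is the span of the other vectors. Since the coefficient of
      \<open>x k\<close> is at most 4 times the norm of a combination, \<open>x k\<close> has
      distance at least \<open>1 / 4\<close> from \<open>T\<close>.\<close>
    define T where "T = {\<Sum>i<n. b i *\<^sub>R x i | b. b k = 0}"
    have T: "subspace T"
    proof (unfold subspace_def, intro conjI ballI allI)
      show "0 \<in> T" unfolding T_def by (intro CollectI exI[of _ "\<lambda>_. 0"]) auto
      fix u v c assume "u \<in> T" "v \<in> T"
      then obtain b b' where b: "u = (\<Sum>i<n. b i *\<^sub>R x i)" "b k = 0" and b': "v = (\<Sum>i<n. b' i *\<^sub>R x i)" "b' k = 0"
        unfolding T_def by blast
      show "u + v \<in> T" unfolding T_def using b b'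
        by (intro CollectI exI[of _ "\<lambda>i. b i + b' i"]) (auto simp: scaleR_add_left sum.distrib)
      show "c *\<^sub>R u \<in> T" unfolding T_def using b
        by (intro CollectI exI[of _ "\<lambda>i. c * b i"]) (auto simp: scaleR_sum_right)
    qed
    have xT: "x i \<in> T" if "i < n" "i \<noteq> k" for i
      unfolding T_def using that
      by (intro CollectI exI[of _ "\<lambda>j. if j = i then 1 else 0"]) (auto simp: if_distrib[of "\<lambda>c. c *\<^sub>R _"] cong: if_cong)
    have coef: "\<bar>a k\<bar> \<le> 4 * norm (\<Sum>i<n. a i *\<^sub>R x i)" for a
    proof -
      have "0 \<in> common_kernel \<Psi>" using subspace_0[OF subspace_common_kernel[OF \<Psi>]] .
      then have *: "norm (\<Sum>i<j. a i *\<^sub>R x i) \<le> 2 * norm (\<Sum>i<n. a i *\<^sub>R x i)" if "j \<le> n" for j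
        using le[OF that, of 0 a] by simp
      have "norm (a k *\<^sub>R x k) \<le> norm (\<Sum>i<Suc k. a i *\<^sub>R x i) + norm (\<Sum>i<k. a i *\<^sub>R x i)"
        using norm_triangle_ineq4[of "\<Sum>i<Suc k. a i *\<^sub>R x i" "\<Sum>i<k. a i *\<^sub>R x i"] by simp
      then show ?thesis using *[of k] *[of "Suc k"] k x[OF k] by simp
    qed
    have "1 / 4 \<le> infdist (x k) T"
    proof -
      have "T \<noteq> {}" using subspace_0[OF T] by blast
      moreover have "1 / 4 \<le> dist (x k) t" if t: "t \<in> T" for t
      proof -
        obtain b where b: "t = (\<Sum>i<n. b i *\<^sub>R x i)" "b k = 0" using t by (auto simp: T_def)
        have "(\<Sum>i<n. ((if i = k then 1 else 0) - b i) *\<^sub>R x i) = x k - t"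
          using k by (simp add: b(1) scaleR_diff_left sum_subtractf if_distrib[of "\<lambda>c. c *\<^sub>R _"] cong: if_cong)
        then show ?thesis
          using coef[of "\<lambda>i. (if i = k then 1 else 0) - b i"] b(2) by (simp add: dist_norm)
      qed
      ultimately show ?thesis unfolding infdist_notempty[OF \<open>T \<noteq> {}\<close>] by (rule cINF_greatest)
    qed
    moreover obtain g :: "'a \<Rightarrow> real" where g: "linear g" "\<And>x. \<bar>g x\<bar> \<le> norm x" "\<And>x. x \<in> T \<Longrightarrow> g x = 0"
        "g (x k) = infdist (x k) T"
      using hahn_banach_infdist[OF T] by metis
    ultimately have pos: "1 / 4 \<le> g (x k)" by simp
    show ?thesis
    proof (intro exI[of _ "\<lambda>y. g y / g (x k)"] conjI allI impI)
      show "linear (\<lambda>y. g y / g (x k))"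
        using g(1) by (intro linearI) (auto simp: linear_add linear_scale add_divide_distrib)
      show "\<bar>g y / g (x k)\<bar> \<le> 4 * norm y" for y
      proof -
        have "\<bar>g y\<bar> \<le> norm y * (4 * g (x k))"
          using g(2)[of y] mult_left_mono[of 1 "4 * g (x k)" "norm y"] pos by simp
        then show ?thesis using pos by (simp add: abs_divide divide_le_eq mult.commute mult.left_commute)
      qed
      show "g (x j) / g (x k) = (if k = j then 1 else 0)" if "j < n" for j
        using pos g(3)[OF xT[OF that]] by auto
    qed
  qed
  then obtain \<psi> where "\<And>k. k < n \<Longrightarrow> linear (\<psi> k) \<and> (\<forall>y. \<bar>\<psi> k y\<bar> \<le> 4 * norm y) \<and>
      (\<forall>j<n. \<psi> k (x j) = (if k = j then 1 else (0::real)))" by metis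
  then have "biorthogonal n x \<psi>" using x by (auto simp: biorthogonal_def)
  then show ?thesis using x by blast
qed

text \<open>The greedy choice needs \<open>(1 - \<eta>) ^ l * R < 1 / 2\<close>, but the a priori
  bound \<open>R = 4 * n = 8 * m * l\<close> of the set itself grows with \<open>l\<close>.
  Geometric decay beats this linear growth.\<close>

lemma geometric_window_length:
  fixes \<eta> C :: real
  assumes "0 < \<eta>" "\<eta> < 1"
  obtains l :: nat where "l > 0" "(1 - \<eta>) ^ l * (C * real l) < 1 / 2"
proof -
  have "(\<lambda>l. real l * (1 - \<eta>) ^ l) \<longlonglongrightarrow> 0" using assms by (intro powser_times_n_limit_0) auto
  then have "(\<lambda>l. C * (real l * (1 - \<eta>) ^ l)) \<longlonglongrightarrow> C * 0" by (intro tendsto_intros)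
  then have "\<forall>\<^sub>F l in sequentially. C * (real l * (1 - \<eta>) ^ l) < 1 / 2"
    by (rule order_tendstoD) simp
  then have "\<forall>\<^sub>F l in sequentially. C * (real l * (1 - \<eta>) ^ l) < 1 / 2 \<and> l > 0"
    using eventually_gt_at_top[of 0] by (rule eventually_conj)
  then obtain l where "C * (real l * (1 - \<eta>) ^ l) < 1 / 2" "l > 0"
    using eventually_happens by fastforce
  then show thesis using that[of l] by (simp add: mult.commute mult.left_commute)
qed

lemma linear_scaleR_fun: "linear f \<Longrightarrow> linear (\<lambda>x. (f x :: real) *\<^sub>R v)"
  by (intro linearI) (auto simp: linear_add linear_scale scaleR_add_left)

lemma norm_coordinate_sum_le:
  assumes "\<And>i. i < n \<Longrightarrow> \<bar>f i\<bar> \<le> 4"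
  shows "norm (\<Sum>i<n. f i *\<^sub>R ax i) \<le> 4 * real n"
proof -
  have "norm (\<Sum>i<n. f i *\<^sub>R ax i) \<le> (\<Sum>i<n. norm (f i *\<^sub>R ax i))" by (rule norm_sum)
  also have "\<dots> \<le> (\<Sum>i<n. 4)" using assms by (intro sum_mono) auto
  finally show ?thesis by simp
qed

section \<open>Systems with upper and lower 2-estimates\<close>

definition upper_system :: "nat \<Rightarrow> real \<Rightarrow> 'a::real_normed_vector set \<Rightarrow> (fin_seq \<Rightarrow> 'a) \<Rightarrow> (nat \<Rightarrow> 'a \<Rightarrow> real) \<Rightarrow> bool"
  where "upper_system m c V e \<phi> \<longleftrightarrow> linear e \<and> (\<forall>a\<in>first_coords m. e a \<in> V \<and> norm (e a) \<le> norm a) \<and>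
    (\<forall>i<m. linear (\<phi> i) \<and> (\<forall>x. \<bar>\<phi> i x\<bar> \<le> norm x) \<and> c \<le> \<phi> i (e (ax i)))"

text \<open>\<open>K\<close> consists of the coordinate vectors of functionals of norm at most 4
  along \<open>x\<close>, so its gauge at \<open>a\<close> is \<open>4 * norm (comb x a)\<close>;
  the number 4 lets the biorthogonal functionals in, which puts the \<open>ax i\<close> into
  \<open>K\<close>. Almost extremal vectors \<open>u i\<close> then give a contraction after
  division by \<open>s / 4\<close>, and the functionals behind the \<open>z i\<close>, divided by 4,
  are the required witnesses.\<close>

lemma upper_system_exists:
  fixes \<Phi> :: "('a::real_normed_vector \<Rightarrow> real) set"
  assumes nd: "\<And>\<Phi> :: ('a \<Rightarrow> real) set. fin_functionals \<Phi> \<Longrightarrow> \<exists>x\<in>common_kernel \<Phi>. x \<noteq> 0"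
    and \<Phi>: "fin_functionals \<Phi>" and m: "m > 0" and \<eta>: "0 < \<eta>" "\<eta> < 1"
  shows "\<exists>e \<phi>. upper_system m ((1 - \<eta>)\<^sup>2) (common_kernel \<Phi>) e \<phi>"
proof -
  obtain l :: nat where l: "l > 0" "(1 - \<eta>) ^ l * (8 * real m * real l) < 1 / 2"
    using geometric_window_length[OF \<eta>, of "8 * real m"] by blast
  define n where "n = 2 * l * m"
  obtain x \<psi> where bi: "biorthogonal n x \<psi>" and x\<Phi>: "x ` {..<n} \<subseteq> common_kernel \<Phi>"
    using biorthogonal_exists[OF nd \<Phi>, of n] by blast
  define J where "J = (\<lambda>f. \<Sum>i<n. f (x i) *\<^sub>R ax i)"
  define K where "K = {J f | f. linear f \<and> (\<forall>y. \<bar>f y\<bar> \<le> 4 * norm y)}"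
  have KR: "norm z \<le> 4 * real n" if "z \<in> K" for z
  proof -
    obtain f where f: "z = J f" "\<forall>y. \<bar>f y\<bar> \<le> 4 * norm y" using \<open>z \<in> K\<close> by (auto simp: K_def)
    have "\<bar>f (x i)\<bar> \<le> 4" if "i < n" for i
      using f(2)[rule_format, of "x i"] bi that by (simp add: biorthogonal_def)
    then show ?thesis unfolding f(1) J_def by (rule norm_coordinate_sum_le)
  qed
  have KA: "ax i \<in> K" if i: "i < n" for i
  proof -
    have "J (\<psi> i) = (\<Sum>j<n. if j = i then ax j else 0)"
      unfolding J_def using bi i by (intro sum.cong) (auto simp: biorthogonal_def)
    then have "ax i = J (\<psi> i)" using i by simp
    then show ?thesis using bi i unfolding K_def biorthogonal_def by blast
  qed
  have small: "(1 - \<eta>) ^ l * (4 * real n) < 1 / 2" using l(2) by (simp add: n_def mult.commute mult.left_commute)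
  obtain s u z where "almost_extremal m n ((1 - \<eta>)\<^sup>2) K s u z"
    using greedy_orthonormal[OF KR KA n_def m l(1) \<eta> small] by blast
  note ext = almost_extremalD[OF this]
  note s = ext(1) and u = ext(2,3,6) and z = ext(4,5) and le = ext(7)
  have f: "\<exists>f. z i = J f \<and> linear f \<and> (\<forall>y. \<bar>f y\<bar> \<le> 4 * norm y)" if "i < m" for i
    using z(1)[OF that] by (auto simp: K_def)
  then obtain f where f: "\<And>i. i < m \<Longrightarrow> z i = J (f i)" "\<And>i. i < m \<Longrightarrow> linear (f i)"
      "\<And>i y. i < m \<Longrightarrow> \<bar>f i y\<bar> \<le> 4 * norm y" by metis
  have J: "inner (J g) a = g (comb x a)" if "a \<in> first_coords n" "linear g" for g a
    unfolding J_def comb_first_coords[OF that(1)] using that(2)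
    by (simp add: inner_sum_left linear_sum linear_scale mult.commute)
  define e where "e = (\<lambda>a. (4 / s) *\<^sub>R comb x (comb u a))"
  have "linear e" unfolding e_def
    by (intro linear_compose_scale_right linear_compose[OF linear_comb linear_comb, unfolded o_def])
  moreover have "e a \<in> common_kernel \<Phi> \<and> norm (e a) \<le> norm a" if a: "a \<in> first_coords m" for a
  proof
    have un: "comb u a \<in> first_coords n"
      using u(1) a by (intro comb_in_subspace[OF subspace_first_coords]) auto
    have sp: "comb u a \<in> span (u ` {..<m})"
      using a by (intro comb_in_subspace[OF subspace_span]) (auto intro: span_base)
    have "comb x (comb u a) \<in> common_kernel \<Phi>"
      using x\<Phi> un by (intro comb_in_subspace[OF subspace_common_kernel[OF \<Phi>]]) auto
    then show "e a \<in> common_kernel \<Phi>"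
      unfolding e_def by (rule subspace_scale[OF subspace_common_kernel[OF \<Phi>]])
    obtain g :: "'a \<Rightarrow> real" where g: "linear g" "\<And>x. \<bar>g x\<bar> \<le> norm x" "g (comb x (comb u a)) = norm (comb x (comb u a))"
      using norming_functional[of "comb x (comb u a)"] by metis
    have g4: "linear (\<lambda>y. 4 * g y)" using g(1) linear_compose_scale_right[of g 4] by simp
    have "J (\<lambda>y. 4 * g y) \<in> K" unfolding K_def using g4 g(2) by (auto simp: abs_mult)
    from le[OF this sp] have "4 * norm (comb x (comb u a)) \<le> s * norm a"
      using J[OF un g4] g(3) norm_comb_orthonormal[OF u(3,2) a] by simp
    then show "norm (e a) \<le> norm a" using s by (simp add: e_def field_simps)
  qed
  moreover have "linear (\<lambda>y. f i y / 4)" "\<bar>f i y / 4\<bar> \<le> norm y" "(1 - \<eta>)\<^sup>2 \<le> f i (e (ax i)) / 4"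
    if i: "i < m" for i y
  proof -
    show "linear (\<lambda>y. f i y / 4)"
      using f(2)[OF i] by (intro linearI) (auto simp: linear_add linear_scale add_divide_distrib)
    show "\<bar>f i y / 4\<bar> \<le> norm y" using f(3)[OF i, of y] by simp
    have "f i (e (ax i)) = (4 / s) * inner (z i) (u i)"
      using J[OF u(1)[OF i] f(2)[OF i]] f(1,2)[OF i] by (simp add: e_def linear_scale)
    then have "s * (4 * (1 - \<eta>)\<^sup>2) \<le> s * f i (e (ax i))"
      using z(2)[OF i] s by (simp add: mult.commute)
    then show "(1 - \<eta>)\<^sup>2 \<le> f i (e (ax i)) / 4" using s by simp
  qed
  ultimately have "upper_system m ((1 - \<eta>)\<^sup>2) (common_kernel \<Phi>) e (\<lambda>i y. f i y / 4)"
    unfolding upper_system_def by blast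
  then show ?thesis by blast
qed

definition lower_system :: "nat \<Rightarrow> real \<Rightarrow> 'a::real_normed_vector set \<Rightarrow> (nat \<Rightarrow> 'a) \<Rightarrow> ('a \<Rightarrow> fin_seq) \<Rightarrow> bool"
  where "lower_system m c V f j \<longleftrightarrow> linear j \<and> (\<forall>x. j x \<in> first_coords m) \<and> (\<forall>x\<in>V. norm (j x) \<le> norm x) \<and>
    (\<forall>i<m. f i \<in> V \<and> norm (f i) \<le> 1 \<and> c \<le> coord (j (f i)) i)"

text \<open>Dual to the upper system: \<open>K\<close> is now the set of coordinate vectors of the
  unit ball of \<open>span B\<close>, and \<open>j y\<close> collects the components of
  \<open>J y\<close> along the \<open>u i\<close>, divided by \<open>s\<close>. Testing extremality
  at \<open>comb u (j y)\<close> gives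
  \<open>s * (norm (j y))\<^sup>2 \<le> s * norm y * norm (j y)\<close>.\<close>

lemma lower_system_exists:
  fixes \<Phi> :: "('a::real_normed_vector \<Rightarrow> real) set"
  assumes nd: "\<And>\<Phi> :: ('a \<Rightarrow> real) set. fin_functionals \<Phi> \<Longrightarrow> \<exists>x\<in>common_kernel \<Phi>. x \<noteq> 0"
    and \<Phi>: "fin_functionals \<Phi>" and m: "m > 0" and \<eta>: "0 < \<eta>" "\<eta> < 1"
  shows "\<exists>B f j. finite B \<and> B \<subseteq> common_kernel \<Phi> \<and> lower_system m ((1 - \<eta>)\<^sup>2) (span B) f j"
proof -
  obtain l :: nat where l: "l > 0" "(1 - \<eta>) ^ l * (8 * real m * real l) < 1 / 2"
    using geometric_window_length[OF \<eta>, of "8 * real m"] by blast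
  define n where "n = 2 * l * m"
  obtain x \<psi> where bi: "biorthogonal n x \<psi>" and x\<Phi>: "x ` {..<n} \<subseteq> common_kernel \<Phi>"
    using biorthogonal_exists[OF nd \<Phi>, of n] by blast
  define B where "B = x ` {..<n}"
  define J where "J = (\<lambda>y. \<Sum>i<n. \<psi> i y *\<^sub>R ax i)"
  have J: "linear J" unfolding J_def
    using bi by (intro linear_compose_sum ballI linear_scaleR_fun) (auto simp: biorthogonal_def)
  have Jn: "J y \<in> first_coords n" for y
    unfolding J_def by (intro subspace_sum subspace_scale subspace_first_coords ax_first_coords) auto
  define K where "K = {J y | y. y \<in> span B \<and> norm y \<le> 1}"
  have KR: "norm z \<le> 4 * real n" if "z \<in> K" for z
  proof -
    obtain y where y: "z = J y" "norm y \<le> 1" using \<open>z \<in> K\<close> by (auto simp: K_def)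
    have "\<bar>\<psi> i y\<bar> \<le> 4" if "i < n" for i
    proof -
      have "\<bar>\<psi> i y\<bar> \<le> 4 * norm y" using bi that by (simp add: biorthogonal_def)
      then show ?thesis using y(2) by simp
    qed
    then show ?thesis unfolding y(1) J_def by (rule norm_coordinate_sum_le)
  qed
  have KA: "ax i \<in> K" if i: "i < n" for i
  proof -
    have "J (x i) = (\<Sum>j<n. if j = i then ax j else 0)"
      unfolding J_def using bi i by (intro sum.cong) (auto simp: biorthogonal_def)
    then have "ax i = J (x i)" using i by simp
    moreover have "x i \<in> span B" "norm (x i) \<le> 1" using bi i by (auto simp: B_def biorthogonal_def intro: span_base)
    ultimately show ?thesis unfolding K_def by blast
  qed
  have small: "(1 - \<eta>) ^ l * (4 * real n) < 1 / 2" using l(2) by (simp add: n_def mult.commute mult.left_commute)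
  obtain s u z where "almost_extremal m n ((1 - \<eta>)\<^sup>2) K s u z"
    using greedy_orthonormal[OF KR KA n_def m l(1) \<eta> small] by blast
  note ext = almost_extremalD[OF this]
  note s = ext(1) and u = ext(2,3,6) and z = ext(4,5) and le = ext(7)
  have "\<exists>f. z i = J f \<and> f \<in> span B \<and> norm f \<le> 1" if "i < m" for i
    using z(1)[OF that] by (auto simp: K_def)
  then obtain f where f: "\<And>i. i < m \<Longrightarrow> z i = J (f i)" "\<And>i. i < m \<Longrightarrow> f i \<in> span B"
      "\<And>i. i < m \<Longrightarrow> norm (f i) \<le> 1" by metis
  define j where "j = (\<lambda>y. \<Sum>i<m. (inner (u i) (J y) / s) *\<^sub>R ax i)"
  have cj: "coord (j y) i = inner (u i) (J y) / s" if "i < m" for i y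
  proof -
    have "coord (j y) i = (\<Sum>k<m. if k = i then inner (u k) (J y) / s else 0)"
      unfolding j_def coord_sum by (intro sum.cong) (auto simp: coord_ax)
    then show ?thesis using that by simp
  qed
  have lin: "linear j"
  proof -
    have "linear (\<lambda>y. inner (u i) (J y) / s)" for i
      using J by (intro linearI) (auto simp: linear_add linear_scale inner_add_right add_divide_distrib)
    then show ?thesis unfolding j_def
      by (intro linear_compose_sum ballI linear_scaleR_fun)
  qed
  have jm: "j y \<in> first_coords m" for y
    unfolding j_def by (intro subspace_sum subspace_scale subspace_first_coords ax_first_coords) auto
  have jle: "norm (j y) \<le> norm y" if y: "y \<in> span B" for y
  proof (cases "y = 0")
    case False
    let ?a = "comb u (j y)"
    have sp: "?a \<in> span (u ` {..<m})"
      using jm[of y] by (intro comb_in_subspace[OF subspace_span]) (auto intro: span_base)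
    have na: "norm ?a = norm (j y)" by (rule norm_comb_orthonormal[OF u(3,2) jm])
    have "J (y /\<^sub>R norm y) \<in> K" unfolding K_def using y False
      by (intro CollectI exI[of _ "y /\<^sub>R norm y"]) (auto intro: span_scale)
    from le[OF this sp] have "inner (J y) ?a \<le> s * norm (j y) * norm y"
      using J False na by (simp add: linear_scale field_simps)
    moreover have "inner (J y) ?a = s * (norm (j y))\<^sup>2"
    proof -
      have "inner (J y) ?a = (\<Sum>i<m. coord (j y) i * inner (u i) (J y))"
        by (simp add: comb_first_coords[OF jm] inner_sum_right inner_commute)
      also have "\<dots> = (\<Sum>i<m. s * (coord (j y) i * coord (j y) i))"
        using s by (intro sum.cong) (auto simp: cj)
      also have "\<dots> = s * inner (j y) (j y)"
        by (simp add: inner_first_coords[OF jm] sum_distrib_left)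
      finally show ?thesis by (simp add: dot_square_norm)
    qed
    ultimately have "norm (j y) * norm (j y) \<le> norm y * norm (j y)"
      using s by (simp add: power2_eq_square mult.commute mult.left_commute)
    then show ?thesis using mult_right_le_imp_le[of "norm (j y)" "norm (j y)" "norm y"] by (cases "j y = 0") auto
  qed (use lin in \<open>simp add: linear_0\<close>)
  have "(1 - \<eta>)\<^sup>2 \<le> coord (j (f i)) i" if i: "i < m" for i
    using z(2)[OF i] s f(1)[OF i] by (simp add: cj[OF i] inner_commute field_simps)
  then have "lower_system m ((1 - \<eta>)\<^sup>2) (span B) f j"
    unfolding lower_system_def using lin jm jle f(2,3) by blast
  moreover have "finite B" "B \<subseteq> common_kernel \<Phi>" using x\<Phi> by (auto simp: B_def)
  ultimately show ?thesis by blast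
qed

section \<open>Complemented subspaces and Euclidean structure\<close>

lemma norm_le_norm_add_orthogonal:
  fixes x y :: "'b::real_inner"
  assumes "inner x y = 0"
  shows "norm x \<le> norm (x + y) \<and> norm y \<le> norm (x + y)"
proof -
  have "(norm (x + y))\<^sup>2 = (norm x)\<^sup>2 + (norm y)\<^sup>2"
    using assms by (intro norm_add_Pythagorean) (simp add: orthogonal_def)
  then have "(norm x)\<^sup>2 \<le> (norm (x + y))\<^sup>2" "(norm y)\<^sup>2 \<le> (norm (x + y))\<^sup>2" by simp_all
  then show ?thesis using power2_le_imp_le[OF _ norm_ge_zero] by blast
qed

definition complemented :: "real \<Rightarrow> 'a::real_normed_vector set \<Rightarrow> bool"
  where "complemented c V \<longleftrightarrow> (\<exists>P. linear P \<and> range P \<subseteq> V \<and> (\<forall>x\<in>V. P x = x) \<and> (\<forall>x. norm (P x) \<le> c * norm x))"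

text \<open>Symmetric form of a direct sum with bounded projections. The constant 3 is the 2 from
  \<open>norming\<close> for one summand plus 1 for the complementary projection.\<close>

definition transversal :: "'a::real_normed_vector set \<Rightarrow> 'a set \<Rightarrow> bool"
  where "transversal V W \<longleftrightarrow> (\<forall>x\<in>V. \<forall>y\<in>W. norm x \<le> 3 * norm (x + y) \<and> norm y \<le> 3 * norm (x + y))"

lemma transversal_sym:
  assumes "transversal V W"
  shows "transversal W V"
  unfolding transversal_def
proof (intro ballI)
  fix x y assume "x \<in> W" "y \<in> V"
  then have "norm y \<le> 3 * norm (y + x) \<and> norm x \<le> 3 * norm (y + x)"
    using assms by (simp add: transversal_def)
  then show "norm x \<le> 3 * norm (x + y) \<and> norm y \<le> 3 * norm (x + y)" by (simp add: add.commute)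
qed

lemma transversal_if_norming:
  assumes "norming V \<Psi>" "W \<subseteq> common_kernel \<Psi>"
  shows "transversal V W"
  unfolding transversal_def
proof (intro ballI)
  fix x y assume "x \<in> V" "y \<in> W"
  then have "norm x \<le> 2 * norm (x + y)" using assms unfolding norming_def by blast
  moreover have "norm y \<le> norm (x + y) + norm x" using norm_triangle_ineq4[of "x + y" x] by simp
  ultimately show "norm x \<le> 3 * norm (x + y) \<and> norm y \<le> 3 * norm (x + y)"
    using norm_ge_zero[of "x + y"] by linarith
qed

text \<open>Projecting onto the graph of \<open>T\<close> yields a map \<open>A\<close> which simultaneously splits the identity
  of \<open>span F\<close> as \<open>A + A T\<close> and is small where \<open>T\<close> is large.\<close>

lemma graph_projection:
  fixes T :: "'a::real_normed_vector \<Rightarrow> 'a"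
  assumes T: "linear T" and tr: "transversal (span F) W" and TW: "\<And>x. x \<in> span F \<Longrightarrow> T x \<in> W"
    and P: "complemented c (span ((\<lambda>x. x + T x) ` F))"
  shows "\<exists>A. linear A \<and> range A \<subseteq> span F \<and> (\<forall>x\<in>span F. A (x + T x) = x) \<and>
    (\<forall>z. norm (A z) \<le> 3 * c * norm z \<and> norm (T (A z)) \<le> 3 * c * norm z)"
proof -
  define G where "G = (\<lambda>x. x + T x)"
  have G: "linear G" unfolding G_def using T by (intro linear_compose_add linear_ident)
  have tr': "norm x \<le> 3 * norm (G x)" "norm (T x) \<le> 3 * norm (G x)" if "x \<in> span F" for x
    using tr TW[OF that] that by (auto simp: transversal_def G_def)
  have "inj_on G (span F)"
  proof (rule inj_onI)
    fix x y assume xy: "x \<in> span F" "y \<in> span F" "G x = G y"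
    then have "norm (x - y) \<le> 3 * norm (G (x - y))" by (intro tr' span_diff)
    then show "x = y" using xy(3) by (simp add: linear_diff[OF G])
  qed
  then obtain g where g: "range g \<subseteq> span F" "linear g" "\<forall>x\<in>span F. g (G x) = x"
    using linear_exists_left_inverse_on[OF G subspace_span] by metis
  obtain P where P: "linear P" "range P \<subseteq> span (G ` F)" "\<forall>x\<in>span (G ` F). P x = x" "\<And>x. norm (P x) \<le> c * norm x"
    using P unfolding complemented_def G_def by metis
  have GF: "span (G ` F) = G ` span F" by (rule linear_span_image[OF G])
  \<comment> \<open>Hence \<open>P z\<close> is the graph point over \<open>g (P z)\<close>, and
    transversality bounds both of its components by \<open>3 * norm (P z)\<close>, no matter how
    large \<open>T\<close> is.\<close>
  have Gg: "G (g (P z)) = P z" for z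
  proof -
    have "P z \<in> G ` span F" using P(2) GF by auto
    then show ?thesis using g(3) by auto
  qed
  show ?thesis
  proof (intro exI[of _ "g \<circ> P"] conjI ballI allI)
    show "linear (g \<circ> P)" using P(1) g(2) by (rule linear_compose)
    show "range (g \<circ> P) \<subseteq> span F" using g(1) by auto
    show "(g \<circ> P) (x + T x) = x" if "x \<in> span F" for x
      using P(3) GF g(3) that by (auto simp: G_def)
    fix z
    have gz: "g (P z) \<in> span F" using g(1) by auto
    show "norm ((g \<circ> P) z) \<le> 3 * c * norm z" "norm (T ((g \<circ> P) z)) \<le> 3 * c * norm z"
      using tr'[OF gz] P(4)[of z] by (simp_all add: Gg)
  qed
qed

text \<open>The second assumption is infinite dimensionality in the form used for choosing vectors:
  finitely many functionals never have a trivial common kernel.\<close>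

locale uniformly_complemented =
  fixes \<Phi>\<^sub>0 :: "('a::real_normed_vector \<Rightarrow> real) set" and c :: real
  assumes \<Phi>\<^sub>0: "fin_functionals \<Phi>\<^sub>0"
    and nontrivial: "\<And>\<Phi> :: ('a \<Rightarrow> real) set. fin_functionals \<Phi> \<Longrightarrow> \<exists>x\<in>common_kernel \<Phi>. x \<noteq> 0"
    and compl: "\<And>B. finite B \<Longrightarrow> B \<subseteq> common_kernel \<Phi>\<^sub>0 \<Longrightarrow> complemented c (span B)"
    and c_ge_1: "1 \<le> c"
begin

lemma graph_projection':
  assumes "linear T" "finite F" "F \<subseteq> common_kernel \<Phi>\<^sub>0" "transversal (span F) W"
    and TW: "\<And>x. x \<in> span F \<Longrightarrow> T x \<in> W" and W: "W \<subseteq> common_kernel \<Phi>\<^sub>0"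
  obtains A where "linear A" "\<And>z. A z \<in> span F" "\<And>x. x \<in> span F \<Longrightarrow> A (x + T x) = x"
    "\<And>z. norm (A z) \<le> 3 * c * norm z" "\<And>z. norm (T (A z)) \<le> 3 * c * norm z"
proof -
  have "(\<lambda>x. x + T x) ` F \<subseteq> common_kernel \<Phi>\<^sub>0"
    using assms(3) TW W by (auto intro!: subspace_add[OF subspace_common_kernel[OF \<Phi>\<^sub>0]] simp: span_base subset_iff)
  then have "complemented c (span ((\<lambda>x. x + T x) ` F))" using assms(2) by (intro compl) auto
  then have "\<exists>A. linear A \<and> range A \<subseteq> span F \<and> (\<forall>x\<in>span F. A (x + T x) = x) \<and>
      (\<forall>z. norm (A z) \<le> 3 * c * norm z \<and> norm (T (A z)) \<le> 3 * c * norm z)"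
    by (intro graph_projection[OF assms(1,4) TW])
  then obtain A where A: "linear A" "range A \<subseteq> span F"
    "\<forall>x\<in>span F. A (x + T x) = x" "\<forall>z. norm (A z) \<le> 3 * c * norm z \<and> norm (T (A z)) \<le> 3 * c * norm z"
    by (elim exE conjE)
  show thesis by (rule that[OF A(1)]) (use A in auto)
qed

section \<open>Uniform copies of Euclidean spaces\<close>

definition euclidean_copy :: "nat \<Rightarrow> real \<Rightarrow> real \<Rightarrow> 'a set \<Rightarrow> (fin_seq \<Rightarrow> 'a) \<Rightarrow> bool"
  where "euclidean_copy n l u V h \<longleftrightarrow> linear h \<and>
    (\<forall>a\<in>first_coords n. h a \<in> V \<and> l * norm a \<le> norm (h a) \<and> norm (h a) \<le> u * norm a)"

text \<open>For \<open>\<alpha>\<close> large compared with \<open>c\<close>, the graph of \<open>\<alpha> e j\<close> forces the diagonal of \<open>j A e\<close>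
  to be bounded below, so this operator on Euclidean space is bounded below on a subspace of
  large dimension and therefore factors a Euclidean norm through \<open>'a\<close>.\<close>

lemma euclidean_copies_exist:
  assumes \<Phi>: "fin_functionals \<Phi>"
  shows "\<exists>h. euclidean_copy N (1 / (48 * c)) (3 * c) (common_kernel \<Phi>) h"
proof -
  define k where "k = 3 * c"
  have k: "k \<ge> 1" using c_ge_1 by (simp add: k_def)
  \<comment> \<open>Chosen so that the accumulated error
    \<open>\<epsilon> * (2 + 4 * k\<^sup>2)\<close> in the estimate of the diagonal is exactly
    \<open>1 / 4\<close>.\<close>
  define \<epsilon> where "\<epsilon> = 1 / (8 + 16 * k\<^sup>2)"
  have k2: "8 + 16 * k\<^sup>2 > 0" by (intro add_pos_nonneg) auto
  then have eps1: "\<epsilon> * (8 + 16 * k\<^sup>2) = 1" by (simp add: \<epsilon>_def)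
  have eps0: "\<epsilon> > 0" using k2 by (simp add: \<epsilon>_def)
  then have "\<epsilon> * 8 \<le> \<epsilon> * (8 + 16 * k\<^sup>2)" by (intro mult_left_mono) auto
  then have "\<epsilon> * 8 \<le> 1" by (simp only: eps1)
  then have \<epsilon>: "\<epsilon> > 0" "\<epsilon> \<le> 1/8" "\<epsilon> * (2 + 4 * k\<^sup>2) = 1/4"
    using eps0 eps1 by (auto simp: algebra_simps)
  \<comment> \<open>With \<open>\<delta> = 2 * \<eta>\<close> one has
    \<open>(1 - \<eta>)\<^sup>2 \<ge> 1 - \<delta>\<close>, and a vector of norm at most 1 whose
    \<open>i\<close>-th coordinate is at least \<open>1 - \<delta>\<close> has distance at most
    \<open>sqrt (2 * \<delta>) = \<epsilon>\<close> from \<open>ax i\<close>.\<close>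
  define \<eta> where "\<eta> = \<epsilon>\<^sup>2 / 4"
  have e2: "\<epsilon>\<^sup>2 \<le> \<epsilon>" using \<epsilon> by (simp add: power2_eq_square mult_left_le)
  have \<eta>: "0 < \<eta>" "\<eta> < 1" using \<epsilon> e2 by (auto simp: \<eta>_def)
  define \<delta> where "\<delta> = \<epsilon>\<^sup>2 / 2"
  have \<delta>: "1 - \<delta> \<le> (1 - \<eta>)\<^sup>2" "\<delta> \<le> \<epsilon>"
    using e2 \<epsilon> by (auto simp: \<delta>_def \<eta>_def power2_eq_square algebra_simps)
  define \<beta> where "\<beta> = 1 / (8 * k)"
  have \<beta>: "\<beta> > 0" using k by (simp add: \<beta>_def)
  \<comment> \<open>\<open>m\<close> is taken so large that \<open>euclidean_image\<close> can find
    \<open>N\<close> vectors for the bound \<open>k\<close> and the diagonal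
    \<open>\<beta>\<close>.\<close>
  obtain m' :: nat where m': "4 * real N * k / \<beta> < real m'" using reals_Archimedean2 by blast
  define m where "m = Suc m'"
  have m: "m > 0" "4 * real N * k < \<beta> * real m"
  proof -
    have "4 * real N * k / \<beta> < real m" using m' by (simp add: m_def)
    then show "4 * real N * k < \<beta> * real m" using \<beta> by (simp add: field_simps)
  qed (simp add: m_def)
  have \<Phi>1: "fin_functionals (\<Phi> \<union> \<Phi>\<^sub>0)" by (intro fin_functionals_Un \<Phi> \<Phi>\<^sub>0)
  let ?Y = "common_kernel (\<Phi> \<union> \<Phi>\<^sub>0)"
  have Y0: "?Y \<subseteq> common_kernel \<Phi>\<^sub>0" and Y1: "?Y \<subseteq> common_kernel \<Phi>" by (auto simp: common_kernel_Un)
  obtain e \<phi> where us: "upper_system m ((1 - \<eta>)\<^sup>2) ?Y e \<phi>"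
    using upper_system_exists[OF nontrivial \<Phi>1 m(1) \<eta>] by blast
  have e: "linear e" "\<And>a. a \<in> first_coords m \<Longrightarrow> e a \<in> ?Y" "\<And>a. a \<in> first_coords m \<Longrightarrow> norm (e a) \<le> norm a"
    and \<phi>: "\<And>i. i < m \<Longrightarrow> linear (\<phi> i)" "\<And>i x. i < m \<Longrightarrow> \<bar>\<phi> i x\<bar> \<le> norm x"
      "\<And>i. i < m \<Longrightarrow> 1 - \<delta> \<le> \<phi> i (e (ax i))"
    using us \<delta>(1) by (auto simp: upper_system_def intro: order_trans)
  define W where "W = span ((\<lambda>i. e (ax i)) ` {..<m})"
  have eW: "e a \<in> W" if "a \<in> first_coords m" for a
    unfolding linear_eq_comb[OF e(1), of a] W_def using that
    by (intro comb_in_subspace[OF subspace_span]) (auto intro: span_base)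
  have WY: "W \<subseteq> ?Y" unfolding W_def
    using e(2) by (intro span_subset_common_kernel \<Phi>1) (auto intro: ax_first_coords)
  \<comment> \<open>Choosing \<open>F\<close> in the kernel of functionals norming \<open>W\<close>
    makes the domain of the graph map transversal to its range.\<close>
  obtain \<Psi> where \<Psi>: "fin_functionals \<Psi>" "norming W \<Psi>"
    unfolding W_def using norming_exists by blast
  have \<Phi>2: "fin_functionals (\<Phi> \<union> \<Phi>\<^sub>0 \<union> \<Psi>)" by (intro fin_functionals_Un \<Phi>1 \<Psi>)
  obtain F f j where F: "finite F" "F \<subseteq> common_kernel (\<Phi> \<union> \<Phi>\<^sub>0 \<union> \<Psi>)"
    and ls: "lower_system m ((1 - \<eta>)\<^sup>2) (span F) f j"
    using lower_system_exists[OF nontrivial \<Phi>2 m(1) \<eta>] by blast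
  have j: "linear j" "\<And>x. j x \<in> first_coords m" "\<And>x. x \<in> span F \<Longrightarrow> norm (j x) \<le> norm x"
    and f: "\<And>i. i < m \<Longrightarrow> f i \<in> span F" "\<And>i. i < m \<Longrightarrow> norm (f i) \<le> 1"
      "\<And>i. i < m \<Longrightarrow> 1 - \<delta> \<le> coord (j (f i)) i"
    using ls \<delta>(1) by (auto simp: lower_system_def intro: order_trans)
  have FY: "span F \<subseteq> ?Y" "span F \<subseteq> common_kernel \<Psi>"
    using span_subset_common_kernel[OF \<Phi>2 F(2)] by (auto simp: common_kernel_Un)
  have tr: "transversal (span F) W"
    using transversal_if_norming[OF \<Psi>(2) FY(2)] by (rule transversal_sym)
  \<comment> \<open>\<open>T A\<close> is bounded by \<open>k\<close> whatever
    \<open>\<alpha>\<close> is, so this value leaves a contribution of at most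
    \<open>k / \<alpha> = 1 / 2\<close> from the summand \<open>A\<close> of the splitting.\<close>
  define \<alpha> where "\<alpha> = 2 * k"
  define T where "T = (\<lambda>x. \<alpha> *\<^sub>R e (j x))"
  have T: "linear T" unfolding T_def
    using linear_compose[OF j(1) e(1)] by (intro linear_compose_scale_right) (simp add: o_def)
  have TW: "T x \<in> W" for x unfolding T_def using eW[OF j(2)] by (simp add: W_def span_scale)
  obtain A where A: "linear A" "\<And>z. A z \<in> span F" "\<And>x. x \<in> span F \<Longrightarrow> A (x + T x) = x"
    "\<And>z. norm (A z) \<le> 3 * c * norm z" "\<And>z. norm (T (A z)) \<le> 3 * c * norm z"
    by (rule graph_projection'[OF T F(1) _ tr TW]) (use F(2) WY in \<open>auto simp: common_kernel_Un\<close>)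
  define B where "B = (\<lambda>a. j (A (e a)))"
  have B: "linear B" unfolding B_def
    using linear_compose[OF linear_compose[OF e(1) A(1)] j(1)] by (simp add: o_def)
  have hle: "norm (A (e a)) \<le> k * norm a" if "a \<in> first_coords m" for a
  proof -
    have "norm (A (e a)) \<le> k * norm (e a)" using A(4)[of "e a"] by (simp add: k_def)
    also have "\<dots> \<le> k * norm a" using e(3)[OF that] k by (intro mult_left_mono) auto
    finally show ?thesis .
  qed
  have Bk: "norm (B a) \<le> k * norm a" if "a \<in> first_coords m" for a
    using j(3)[OF A(2)[of "e a"]] hle[OF that] by (simp add: B_def)
  have near: "norm (y - ax i) \<le> \<epsilon>" if "norm y \<le> 1" "1 - \<delta> \<le> coord y i" for y i
  proof -
    have "(norm (y - ax i))\<^sup>2 = (norm y)\<^sup>2 - 2 * coord y i + 1"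
      by (simp add: power2_norm_eq_inner inner_diff_left inner_diff_right coord_ax)
    also have "\<dots> \<le> 1 - 2 * (1 - \<delta>) + 1"
      using that power_le_one[OF norm_ge_zero that(1), of 2] by simp
    also have "\<dots> = \<epsilon>\<^sup>2" by (simp add: \<delta>_def)
    finally show ?thesis by (rule power2_le_imp_le) (use \<epsilon>(1) in simp)
  qed
  have diag: "\<beta> \<le> coord (B (ax i)) i" if i: "i < m" for i
  proof -
    define y where "y = j (f i)"
    \<comment> \<open>The vector \<open>z\<close> represents the functional
      \<open>a \<mapsto> \<phi> i (e a)\<close> on the first \<open>m\<close> coordinates; like
      \<open>y\<close>, it is close to \<open>ax i\<close>.\<close>
    define z where "z = (\<Sum>l<m. \<phi> i (e (ax l)) *\<^sub>R ax l)"
    have zm: "z \<in> first_coords m"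
      unfolding z_def by (intro subspace_sum subspace_scale subspace_first_coords ax_first_coords) auto
    have z: "inner z a = \<phi> i (e a)" if a: "a \<in> first_coords m" for a
    proof -
      have "\<phi> i (e a) = (\<Sum>l<m. coord a l * \<phi> i (e (ax l)))"
        using linear_eq_comb[OF e(1), of a] \<phi>(1)[OF i]
        by (simp add: comb_first_coords[OF a] linear_sum linear_scale)
      then show ?thesis by (simp add: z_def inner_sum_left mult.commute)
    qed
    have z1: "norm z \<le> 1"
    proof -
      have "norm z * norm z = \<phi> i (e z)" using z[OF zm] by (metis power2_eq_square power2_norm_eq_inner)
      also have "\<dots> \<le> 1 * norm z" using \<phi>(2)[OF i, of "e z"] e(3)[OF zm] by simp
      finally show ?thesis using mult_right_le_imp_le[of "norm z" "norm z" 1] by (cases "z = 0") auto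
    qed
    have ym: "y \<in> first_coords m" and y1: "norm y \<le> 1"
      using j(3)[OF f(1)[OF i]] f(2)[OF i] j(2) by (auto simp: y_def intro: order_trans)
    have nz: "norm (z - ax i) \<le> \<epsilon>"
      using z1 z[OF ax_first_coords[OF i]] \<phi>(3)[OF i] by (intro near) auto
    have ny: "norm (y - ax i) \<le> \<epsilon>" using y1 f(3)[OF i] by (intro near) (auto simp: y_def)
    \<comment> \<open>Pairing this splitting of \<open>y\<close> with \<open>z\<close> gives nearly
      1 on the left and at most \<open>1 / 2\<close> from the first summand, so the second one,
      essentially \<open>\<alpha>\<close> times the diagonal entry, must be large.\<close>
    have "j (A (f i + T (f i))) = y" using A(3)[OF f(1)[OF i]] by (simp add: y_def)
    then have split: "y = j (A (f i)) + \<alpha> *\<^sub>R B y"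
      using A(1) j(1) by (simp add: linear_add linear_scale T_def B_def y_def)
    have "\<alpha> * inner z (j (A (f i))) = \<phi> i (T (A (f i)))"
      using z[OF j(2)] \<phi>(1)[OF i] by (simp add: T_def linear_scale)
    also have "\<dots> \<le> norm (T (A (f i)))" using \<phi>(2)[OF i, of "T (A (f i))"] by simp
    also have "\<dots> \<le> k * norm (f i)" using A(5) by (simp add: k_def)
    also have "\<dots> \<le> k" using f(2)[OF i] k by (simp add: mult_left_le)
    finally have 1: "inner z (j (A (f i))) \<le> 1/2" using k by (simp add: \<alpha>_def)
    have "inner z y = inner (z - ax i) y + coord y i" by (simp add: inner_diff_left)
    moreover have "\<bar>inner (z - ax i) y\<bar> \<le> \<epsilon> * 1"
      using Cauchy_Schwarz_ineq2[of "z - ax i" y] mult_mono[OF nz y1] \<epsilon>(1) by simp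
    ultimately have 2: "inner z y \<ge> 1 - 2 * \<epsilon>"
      using f(3)[OF i] \<delta>(2) by (simp add: y_def)
    have By: "norm (B y) \<le> k"
      using order_trans[OF Bk[OF ym] mult_left_mono[OF y1, of k]] k by simp
    have ydm: "y - ax i \<in> first_coords m"
      using ym i by (intro subspace_diff subspace_first_coords ax_first_coords)
    have "norm (B (y - ax i)) \<le> k * \<epsilon>"
      using order_trans[OF Bk[OF ydm] mult_left_mono[OF ny, of k]] k by simp
    then have "\<bar>coord (B (y - ax i)) i\<bar> \<le> k * \<epsilon>"
      using Cauchy_Schwarz_ineq2[of "ax i" "B (y - ax i)"] by simp
    moreover have "\<bar>inner (z - ax i) (B y)\<bar> \<le> \<epsilon> * k"
      using Cauchy_Schwarz_ineq2[of "z - ax i" "B y"] mult_mono[OF nz By] \<epsilon>(1) by simp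
    moreover have "inner z (B y) = inner (z - ax i) (B y) + coord (B (y - ax i)) i + coord (B (ax i)) i"
      using B by (simp add: inner_diff_left linear_diff)
    ultimately have 3: "inner z (B y) \<le> 2 * k * \<epsilon> + coord (B (ax i)) i" by (simp add: mult.commute)
    have "inner z y = inner z (j (A (f i))) + \<alpha> * inner z (B y)"
      using split by (metis inner_add_right inner_scaleR_right)
    also have "\<dots> \<le> 1/2 + \<alpha> * (2 * k * \<epsilon> + coord (B (ax i)) i)"
      using 1 3 k by (intro add_mono mult_left_mono) (auto simp: \<alpha>_def)
    finally have "1 - 2 * \<epsilon> \<le> 1/2 + \<alpha> * (2 * k * \<epsilon> + coord (B (ax i)) i)" using 2 by simp
    also have "\<alpha> * (2 * k * \<epsilon> + coord (B (ax i)) i) = \<epsilon> * (4 * k\<^sup>2) + 2 * k * coord (B (ax i)) i"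
      by (simp add: \<alpha>_def algebra_simps power2_eq_square)
    finally have "1/4 \<le> 2 * k * coord (B (ax i)) i"
      using \<epsilon>(3) by (simp add: algebra_simps)
    then show ?thesis using k by (simp add: \<beta>_def field_simps)
  qed
  have "\<exists>v. (\<forall>i<N. v i \<in> first_coords m \<and> norm (v i) = 1 \<and> \<beta> / 2 \<le> norm (B (v i))) \<and>
    (\<forall>i<N. \<forall>j<N. i \<noteq> j \<longrightarrow> inner (v i) (v j) = 0 \<and> inner (B (v i)) (B (v j)) = 0)"
    using euclidean_image[OF B Bk diag \<beta> _ m(2) order_refl] k by simp
  then obtain v where v: "\<forall>i<N. v i \<in> first_coords m \<and> norm (v i) = 1 \<and> \<beta> / 2 \<le> norm (B (v i))"
    "\<forall>i<N. \<forall>j<N. i \<noteq> j \<longrightarrow> inner (v i) (v j) = 0 \<and> inner (B (v i)) (B (v j)) = 0"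
    by (elim exE conjE)
  define h where "h = (\<lambda>a. A (e (comb v a)))"
  have "linear h" unfolding h_def
    using linear_compose[OF linear_compose[OF linear_comb e(1)] A(1)] by (simp add: o_def)
  moreover have "h a \<in> common_kernel \<Phi>" for a
    using A(2) FY(1) Y1 by (auto simp: h_def)
  moreover have "norm (h a) \<le> 3 * c * norm a" if a: "a \<in> first_coords N" for a
  proof -
    have "comb v a \<in> first_coords m"
      using v a by (intro comb_in_subspace[OF subspace_first_coords]) auto
    moreover have "norm (comb v a) = norm a" using v by (intro norm_comb_orthonormal[OF _ _ a]) auto
    ultimately show ?thesis using hle[of "comb v a"] by (simp add: h_def k_def)
  qed
  moreover have "1 / (48 * c) * norm a \<le> norm (h a)" if a: "a \<in> first_coords N" for a
  proof -
    have "inner (B (comb v a)) (B (comb v a)) = (\<Sum>i<N. coord a i * coord a i * inner (B (v i)) (B (v i)))"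
    proof -
      have "B (comb v a) = comb (\<lambda>i. B (v i)) a"
        using B by (simp add: comb_def linear_sum linear_scale)
      then show ?thesis using v(2) by (simp add: inner_comb_orthogonal[OF _ a a])
    qed
    also have "\<dots> \<ge> (\<Sum>i<N. coord a i * coord a i * (\<beta> / 2)\<^sup>2)"
    proof (intro sum_mono mult_left_mono)
      fix i assume "i \<in> {..<N}"
      then have "(\<beta> / 2)\<^sup>2 \<le> (norm (B (v i)))\<^sup>2" using v(1) \<beta> by (intro power_mono) auto
      then show "(\<beta> / 2)\<^sup>2 \<le> inner (B (v i)) (B (v i))" by (simp add: power2_norm_eq_inner)
    qed auto
    also have "(\<Sum>i<N. coord a i * coord a i * (\<beta> / 2)\<^sup>2) = (\<beta> / 2 * norm a)\<^sup>2"
      unfolding power_mult_distrib power2_norm_eq_inner inner_first_coords[OF a] sum_distrib_left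
      by (simp add: mult.commute)
    finally have "(\<beta> / 2 * norm a)\<^sup>2 \<le> (norm (B (comb v a)))\<^sup>2" by (simp add: power2_norm_eq_inner)
    then have "\<beta> / 2 * norm a \<le> norm (B (comb v a))" by (rule power2_le_imp_le) simp
    also have "\<dots> \<le> norm (h a)" using j(3)[OF A(2)] by (simp add: B_def h_def)
    \<comment> \<open>Here \<open>\<beta> / 2 = 1 / (16 * k)\<close> with \<open>k = 3 * c\<close>,
      which is the constant \<open>1 / (48 * c)\<close>.\<close>
    finally show ?thesis by (simp add: \<beta>_def k_def)
  qed
  ultimately show ?thesis unfolding euclidean_copy_def by blast
qed

section \<open>Bounded Euclidean distortion\<close>

definition euclidean_distortion :: "'a set \<Rightarrow> real \<Rightarrow> bool"
  where "euclidean_distortion V d \<longleftrightarrow> 1 \<le> d \<and> (\<exists>t n. linear t \<and> range t \<subseteq> first_coords n \<and>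
    (\<forall>x\<in>V. norm (t x) \<le> norm x \<and> norm x \<le> d * norm (t x)))"

text \<open>Coordinates give some finite distortion, depending on the subspace. It only serves to
  make the infimum in \<open>euclidean_distortion_bounded\<close> meaningful.\<close>

lemma euclidean_distortion_finite:
  assumes "finite B"
  shows "\<exists>d. euclidean_distortion (span B) d"
proof -
  obtain n b \<phi> where co: "span_coordinates B n b \<phi>" using finite_span_coordinates[OF assms] by blast
  note \<phi> = span_coordinatesD(2)[OF co] and eq = span_coordinatesD(3)[OF co]
  define K where "K = 1 + (\<Sum>i<n. onorm (\<phi> i))"
  have K: "K \<ge> 1" by (auto simp: K_def intro!: sum_nonneg onorm_pos_le \<phi>)
  define t where "t = (\<lambda>x. (1 / K) *\<^sub>R (\<Sum>i<n. \<phi> i x *\<^sub>R ax i))"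
  have "linear t" unfolding t_def
    using \<phi> by (intro linear_compose_scale_right linear_compose_sum ballI linear_scaleR_fun)
      (auto simp: bounded_linear.linear)
  moreover have tn: "t x \<in> first_coords n" for x
    unfolding t_def by (intro subspace_sum subspace_scale subspace_first_coords ax_first_coords) auto
  moreover have "norm (t x) \<le> norm x" for x
  proof -
    have "norm (\<Sum>i<n. \<phi> i x *\<^sub>R ax i) \<le> (\<Sum>i<n. norm (\<phi> i x *\<^sub>R ax i))" by (rule norm_sum)
    also have "\<dots> \<le> (\<Sum>i<n. onorm (\<phi> i) * norm x)"
      using onorm[OF \<phi>, of _ x] by (intro sum_mono) auto
    also have "\<dots> \<le> K * norm x" by (simp add: K_def sum_distrib_right distrib_right)
    finally show ?thesis using K by (simp add: t_def field_simps)
  qed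
  moreover have "norm x \<le> (1 + K * (\<Sum>i<n. norm (b i))) * norm (t x)" if x: "x \<in> span B" for x
  proof -
    have ct: "coord (t x) i = \<phi> i x / K" if "i < n" for i
    proof -
      have "(\<Sum>l<n. coord (\<phi> l x *\<^sub>R ax l) i) = (\<Sum>l<n. if l = i then \<phi> l x else 0)"
        by (intro sum.cong) (auto simp: coord_ax)
      then show ?thesis using that by (simp add: t_def coord_sum)
    qed
    have "norm x \<le> (\<Sum>i<n. norm (\<phi> i x *\<^sub>R b i))" using eq[OF x] norm_sum by metis
    also have "\<dots> \<le> (\<Sum>i<n. K * norm (t x) * norm (b i))"
    proof (intro sum_mono)
      fix i assume i: "i \<in> {..<n}"
      have "\<bar>\<phi> i x\<bar> / K \<le> norm (t x)"
        using Cauchy_Schwarz_ineq2[of "ax i" "t x"] i K by (simp add: ct abs_divide)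
      then have "\<bar>\<phi> i x\<bar> \<le> K * norm (t x)" using K by (simp add: field_simps)
      then show "norm (\<phi> i x *\<^sub>R b i) \<le> K * norm (t x) * norm (b i)" by (simp add: mult_right_mono)
    qed
    also have "\<dots> = (K * (\<Sum>i<n. norm (b i))) * norm (t x)"
      by (simp add: sum_distrib_left sum_distrib_right mult.commute mult.left_commute)
    also have "\<dots> \<le> (1 + K * (\<Sum>i<n. norm (b i))) * norm (t x)" by (intro mult_right_mono) auto
    finally show ?thesis .
  qed
  moreover have "1 \<le> 1 + K * (\<Sum>i<n. norm (b i))" using K by (simp add: sum_nonneg)
  ultimately show ?thesis unfolding euclidean_distortion_def
    by (intro exI[of _ "1 + K * (\<Sum>i<n. norm (b i))"] conjI exI[of _ t] exI[of _ n] ballI) auto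
qed

text \<open>This is \<open>2 * (u / l + u * u)\<close>, where \<open>l\<close> and \<open>u\<close>
  are the constants of the Euclidean copies. The 2 comes from the two summands of \<open>x\<close>,
  the bracket from the two blocks of the new Euclidean map.\<close>

definition distortion_const :: real
  where "distortion_const = 2 * (3 * c / (1 / (48 * c)) + 3 * c * (3 * c))"

lemma distortion_const_ge_1: "1 \<le> distortion_const"
proof -
  have "1 \<le> c * c" using c_ge_1 mult_mono[of 1 c 1 c] by simp
  then show ?thesis by (simp add: distortion_const_def)
qed

text \<open>Kadec--Mityagin: project onto the graph of \<open>sqrt d\<close> times an embedding of the subspace into a
  far away Euclidean space.\<close>

lemma euclidean_distortion_improve:
  assumes B: "finite B" "B \<subseteq> common_kernel \<Phi>\<^sub>0" and d: "euclidean_distortion (span B) d"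
  shows "euclidean_distortion (span B) (distortion_const * sqrt d)"
proof -
  obtain t n where d1: "1 \<le> d" and t: "linear t" "\<And>x. t x \<in> first_coords n"
    "\<And>x. x \<in> span B \<Longrightarrow> norm (t x) \<le> norm x" "\<And>x. x \<in> span B \<Longrightarrow> norm x \<le> d * norm (t x)"
    using d unfolding euclidean_distortion_def by (auto simp: image_subset_iff)
  obtain \<Psi> where \<Psi>: "fin_functionals \<Psi>" "norming (span B) \<Psi>" using norming_exists[OF B(1)] by blast
  define l u where "l = 1 / (48 * c)" and "u = 3 * c"
  have l: "l > 0" and u: "u \<ge> 1" using c_ge_1 by (auto simp: l_def u_def)
  obtain h where "euclidean_copy n l u (common_kernel (\<Phi>\<^sub>0 \<union> \<Psi>)) h"
    unfolding l_def u_def using euclidean_copies_exist[OF fin_functionals_Un[OF \<Phi>\<^sub>0 \<Psi>(1)]] by blast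
  then have h: "linear h" "\<And>a. a \<in> first_coords n \<Longrightarrow> h a \<in> common_kernel (\<Phi>\<^sub>0 \<union> \<Psi>)"
    "\<And>a. a \<in> first_coords n \<Longrightarrow> l * norm a \<le> norm (h a)"
    "\<And>a. a \<in> first_coords n \<Longrightarrow> norm (h a) \<le> u * norm a"
    by (auto simp: euclidean_copy_def)
  \<comment> \<open>For a general factor \<open>\<alpha>\<close> the two blocks of \<open>S\<close>
    have sizes of order \<open>d / \<alpha>\<close> and \<open>\<alpha>\<close>; the square root
    balances them.\<close>
  define \<alpha> where "\<alpha> = sqrt d"
  have \<alpha>: "\<alpha> \<ge> 1" "\<alpha> * \<alpha> = d" using d1 by (auto simp: \<alpha>_def)
  define T where "T = (\<lambda>x. \<alpha> *\<^sub>R h (t x))"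
  have T: "linear T" unfolding T_def
    using linear_compose[OF t(1) h(1)] by (intro linear_compose_scale_right) (simp add: o_def)
  let ?W = "common_kernel (\<Phi>\<^sub>0 \<union> \<Psi>)"
  have TW: "T x \<in> ?W" for x
    unfolding T_def by (intro subspace_scale subspace_common_kernel fin_functionals_Un \<Phi>\<^sub>0 \<Psi>(1) h(2) t(2))
  have tr: "transversal (span B) ?W"
    by (rule transversal_if_norming[OF \<Psi>(2)]) (auto simp: common_kernel_Un)
  obtain A where A: "linear A" "\<And>z. A z \<in> span B" "\<And>x. x \<in> span B \<Longrightarrow> A (x + T x) = x"
    "\<And>z. norm (A z) \<le> u * norm z" "\<And>z. norm (T (A z)) \<le> u * norm z"
    unfolding u_def by (rule graph_projection'[OF T B tr TW]) (auto simp: common_kernel_Un)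
  \<comment> \<open>Shifting by \<open>n\<close> coordinates makes the second block orthogonal to
    the first, so \<open>norm (S x)\<close> dominates each block separately.\<close>
  define J where "J = comb (\<lambda>i. ax (n + i))"
  have J: "linear J" unfolding J_def by (rule linear_comb)
  have J_norm: "norm (J a) = norm a" if "a \<in> first_coords n" for a
    unfolding J_def by (rule norm_comb_orthonormal[OF _ _ that]) (auto simp: coord_ax)
  have J_range: "J a \<in> first_coords (n + n)" if "a \<in> first_coords n" for a
    unfolding J_def by (rule comb_in_subspace[OF subspace_first_coords _ that]) (simp add: ax_first_coords)
  have orth: "inner a (J b) = 0" if a: "a \<in> first_coords n" and b: "b \<in> first_coords n" for a b
    unfolding J_def comb_first_coords[OF b] using a
    by (auto simp: inner_sum_right first_coords_def intro!: sum.neutral)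
  define w where "w = u * u"
  \<comment> \<open>Each block controls one summand of \<open>x = A x + A (T x)\<close>: the first
    through \<open>norm (A x) \<le> d * norm (t (A x))\<close>, the second because \<open>A\<close>
    and \<open>h\<close> are both bounded by \<open>u\<close>.\<close>
  define S where "S = (\<lambda>x. d *\<^sub>R t (A x) + J ((\<alpha> * w) *\<^sub>R t x))"
  have S: "linear S" unfolding S_def
    using linear_compose[OF A(1) t(1)] linear_compose[OF linear_compose_scale_right[OF t(1)] J]
    by (intro linear_compose_add linear_compose_scale_right) (auto simp: o_def)
  have Sn: "S x \<in> first_coords (n + n)" for x
    unfolding S_def using first_coords_mono[OF t(2), of "n + n"] t(2)
    by (intro subspace_add subspace_scale subspace_first_coords J_range) auto
  have norm_S: "norm (d *\<^sub>R t (A x)) \<le> norm (S x)" "norm (J ((\<alpha> * w) *\<^sub>R t x)) \<le> norm (S x)" for x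
  proof -
    have "inner (d *\<^sub>R t (A x)) (J ((\<alpha> * w) *\<^sub>R t x)) = 0"
      using orth t(2) by (simp add: subspace_scale[OF subspace_first_coords])
    then show "norm (d *\<^sub>R t (A x)) \<le> norm (S x)" "norm (J ((\<alpha> * w) *\<^sub>R t x)) \<le> norm (S x)"
      unfolding S_def using norm_le_norm_add_orthogonal by blast+
  qed
  have nJ: "norm (J ((\<alpha> * w) *\<^sub>R t x)) = \<alpha> * w * norm (t x)" for x
    using J_norm[OF subspace_scale[OF subspace_first_coords t(2)]] \<alpha> u by (simp add: w_def abs_mult)
  define \<kappa> where "\<kappa> = \<alpha> * (u / l + w)"
  have w: "w \<ge> 1" using u mult_mono[of 1 u 1 u] by (simp add: w_def)
  have \<kappa>: "\<kappa> \<ge> 1"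
  proof -
    have "1 \<le> u / l + w" using w u l by (smt (verit) divide_nonneg_pos)
    then show ?thesis using \<alpha>(1) mult_mono[of 1 \<alpha> 1 "u / l + w"] by (simp add: \<kappa>_def)
  qed
  have upper: "norm (S x) \<le> \<kappa> * norm x" if x: "x \<in> span B" for x
  proof -
    have "\<alpha> * (l * norm (t (A x))) \<le> \<alpha> * norm (h (t (A x)))"
      using h(3)[OF t(2)] \<alpha>(1) by (intro mult_left_mono) auto
    also have "\<dots> = norm (T (A x))" using \<alpha>(1) by (simp add: T_def)
    also have "\<dots> \<le> u * norm x" by (rule A(5))
    finally have "\<alpha> * (\<alpha> * norm (t (A x))) \<le> \<alpha> * (u / l * norm x)"
      using l \<alpha>(1) by (simp add: field_simps)
    then have 1: "norm (d *\<^sub>R t (A x)) \<le> \<alpha> * (u / l * norm x)"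
      using d1 \<alpha>(2) by (simp flip: mult.assoc)
    have "norm (S x) \<le> norm (d *\<^sub>R t (A x)) + norm (J ((\<alpha> * w) *\<^sub>R t x))"
      unfolding S_def by (rule norm_triangle_ineq)
    also have "\<dots> \<le> \<alpha> * (u / l * norm x) + \<alpha> * w * norm x"
      unfolding nJ using 1 t(3)[OF x] \<alpha>(1) w by (intro add_mono mult_left_mono) auto
    also have "\<dots> = \<kappa> * norm x" by (simp add: \<kappa>_def algebra_simps)
    finally show ?thesis .
  qed
  have lower: "norm x \<le> 2 * norm (S x)" if x: "x \<in> span B" for x
  proof -
    have "x = A x + \<alpha> *\<^sub>R A (h (t x))"
      using A(1) A(3)[OF x] by (simp add: T_def linear_add linear_scale)
    then have "norm x \<le> norm (A x) + norm (\<alpha> *\<^sub>R A (h (t x)))" by (metis norm_triangle_ineq)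
    moreover have "norm (A x) \<le> norm (S x)"
      using t(4)[OF A(2), of x] norm_S(1)[of x] d1 by simp
    moreover have "norm (\<alpha> *\<^sub>R A (h (t x))) \<le> norm (S x)"
    proof -
      have "norm (A (h (t x))) \<le> u * (u * norm (t x))"
        using A(4)[of "h (t x)"] mult_left_mono[OF h(4)[OF t(2)], of u] u by (meson order_trans zero_le_one)
      then have "\<alpha> * norm (A (h (t x))) \<le> \<alpha> * (u * (u * norm (t x)))"
        using \<alpha>(1) by (intro mult_left_mono) auto
      also have "\<dots> = norm (J ((\<alpha> * w) *\<^sub>R t x))" unfolding nJ by (simp add: w_def)
      also have "\<dots> \<le> norm (S x)" by (rule norm_S)
      finally show ?thesis using \<alpha>(1) by simp
    qed
    ultimately show ?thesis by simp
  qed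
  have dc: "distortion_const * sqrt d = 2 * \<kappa>"
    by (simp add: distortion_const_def \<kappa>_def \<alpha>_def l_def u_def w_def algebra_simps)
  show ?thesis
    unfolding euclidean_distortion_def dc
  proof (intro conjI exI[of _ "\<lambda>x. (1 / \<kappa>) *\<^sub>R S x"] exI[of _ "n + n"] ballI)
    show "1 \<le> 2 * \<kappa>" using \<kappa> by simp
    show "linear (\<lambda>x. (1 / \<kappa>) *\<^sub>R S x)" using S by (rule linear_compose_scale_right)
    show "range (\<lambda>x. (1 / \<kappa>) *\<^sub>R S x) \<subseteq> first_coords (n + n)"
      using Sn by (auto intro: subspace_scale subspace_first_coords)
    fix x assume x: "x \<in> span B"
    show "norm ((1 / \<kappa>) *\<^sub>R S x) \<le> norm x" using upper[OF x] \<kappa> by (simp add: field_simps)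
    show "norm x \<le> 2 * \<kappa> * norm ((1 / \<kappa>) *\<^sub>R S x)" using lower[OF x] \<kappa> by simp
  qed
qed

text \<open>The infimum of the distortions need not be attained, so some \<open>d\<close> below
  twice the infimum is improved once: \<open>d \<le> 2 * C * sqrt d\<close> bounds \<open>d\<close>
  by \<open>4 * C\<^sup>2\<close>, independently of the subspace.\<close>

lemma euclidean_distortion_bounded:
  assumes B: "finite B" "B \<subseteq> common_kernel \<Phi>\<^sub>0"
  shows "euclidean_distortion (span B) (4 * distortion_const\<^sup>2)"
proof -
  define C where "C = distortion_const"
  have C: "C \<ge> 1" using distortion_const_ge_1 by (simp add: C_def)
  define D where "D = {d. euclidean_distortion (span B) d}"
  have ne: "D \<noteq> {}" using euclidean_distortion_finite[OF B(1)] by (auto simp: D_def)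
  have bdd: "bdd_below D" by (intro bdd_belowI[of _ 1]) (auto simp: D_def euclidean_distortion_def)
  have D1: "1 \<le> Inf D" using ne by (intro cInf_greatest) (auto simp: D_def euclidean_distortion_def)
  obtain d where d: "d \<in> D" "d < 2 * Inf D" using cInf_lessD[OF ne, of "2 * Inf D"] D1 by auto
  have d0: "d \<ge> 1" using d(1) by (auto simp: D_def euclidean_distortion_def)
  have "C * sqrt d \<in> D" using euclidean_distortion_improve[OF B] d(1) by (auto simp: D_def C_def)
  then have "Inf D \<le> C * sqrt d" using bdd by (intro cInf_lower)
  then have "d \<le> 2 * (C * sqrt d)" using d(2) by simp
  then have "sqrt d * sqrt d \<le> (2 * C) * sqrt d" using d0 by simp
  then have "sqrt d \<le> 2 * C" using d0 mult_right_le_imp_le[of "sqrt d" "sqrt d" "2 * C"] by simp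
  then have "(sqrt d)\<^sup>2 \<le> (2 * C)\<^sup>2" using d0 by (intro power_mono) auto
  then have "d \<le> (2 * C)\<^sup>2" using d0 by simp
  then have le: "d \<le> 4 * C\<^sup>2" by (simp add: power_mult_distrib)
  obtain t n where t: "linear t" "range t \<subseteq> first_coords n"
    "\<forall>x\<in>span B. norm (t x) \<le> norm x \<and> norm x \<le> d * norm (t x)"
    using d(1) by (auto simp: D_def euclidean_distortion_def)
  have "norm x \<le> 4 * C\<^sup>2 * norm (t x)" if "x \<in> span B" for x
    using t(3) that mult_right_mono[OF le, of "norm (t x)"] by (meson norm_ge_zero order_trans)
  then show ?thesis
    using t le d0 unfolding euclidean_distortion_def C_def[symmetric] by (intro conjI exI[of _ t] exI[of _ n]) auto
qed

end

section \<open>Equivalent inner products\<close>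

definition equivalent_inner :: "'a::real_normed_vector set \<Rightarrow> ('a \<Rightarrow> 'a \<Rightarrow> real) \<Rightarrow> bool"
  where "equivalent_inner V q \<longleftrightarrow> (\<forall>x\<in>V. \<forall>y\<in>V. q x y = q y x) \<and>
    (\<forall>x\<in>V. \<forall>y\<in>V. \<forall>z\<in>V. q (x + y) z = q x z + q y z) \<and>
    (\<forall>x\<in>V. \<forall>y\<in>V. \<forall>c. q (c *\<^sub>R x) y = c * q x y) \<and>
    (\<exists>l>0. \<exists>u. \<forall>x\<in>V. l * (norm x)\<^sup>2 \<le> q x x \<and> q x x \<le> u * (norm x)\<^sup>2)"

text \<open>The Euclidean maps of different finite sets are unrelated, so only a generalized limit
  of their inner products exists. Each bilinear identity involves finitely many vectors and holds as
  soon as \<open>span B\<close> contains them; the value 0 before that does not affect the limit.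
  The common bound \<open>D\<close> preserves both norm estimates.\<close>

lemma (in uniformly_complemented) equivalent_inner_exists:
  "\<exists>q. equivalent_inner (common_kernel \<Phi>\<^sub>0) q"
proof -
  define Y where "Y = common_kernel \<Phi>\<^sub>0"
  have Y: "subspace Y" unfolding Y_def by (rule subspace_common_kernel[OF \<Phi>\<^sub>0])
  define D where "D = 4 * distortion_const\<^sup>2"
  have "1 \<le> distortion_const\<^sup>2" using distortion_const_ge_1 by (rule one_le_power)
  then have D: "D \<ge> 1" by (simp add: D_def)
  have "\<exists>t :: 'a \<Rightarrow> fin_seq. linear t \<and> (\<forall>x\<in>span B. norm (t x) \<le> norm x \<and> norm x \<le> D * norm (t x))"
    if "finite B \<and> B \<subseteq> Y" for B
    using euclidean_distortion_bounded[of B] that unfolding euclidean_distortion_def Y_def D_def by blast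
  then obtain t :: "'a set \<Rightarrow> 'a \<Rightarrow> fin_seq" where t: "\<And>B. finite B \<and> B \<subseteq> Y \<Longrightarrow> linear (t B)"
    "\<And>B x. finite B \<and> B \<subseteq> Y \<Longrightarrow> x \<in> span B \<Longrightarrow> norm (t B x) \<le> norm x \<and> norm x \<le> D * norm (t B x)"
    by metis
  let ?F = "finite_subsets_at_top Y"
  obtain m where m: "is_mean ?F m" using generalized_limit[OF finite_subsets_at_top_neq_bot] by blast
  define g where "g = (\<lambda>x y B. if finite B \<and> B \<subseteq> Y \<and> x \<in> span B \<and> y \<in> span B then inner (t B x) (t B y) else 0)"
  have ev: "\<forall>\<^sub>F B in ?F. finite B \<and> B \<subseteq> Y \<and> x \<in> span B" if "x \<in> Y" for x
    unfolding eventually_finite_subsets_at_top using that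
    by (intro exI[of _ "{x}"]) (auto intro: span_base)
  have g_le: "\<bar>g x y B\<bar> \<le> norm x * norm y" for x y B
  proof (cases "finite B \<and> B \<subseteq> Y \<and> x \<in> span B \<and> y \<in> span B")
    case True
    have "\<bar>inner (t B x) (t B y)\<bar> \<le> norm (t B x) * norm (t B y)" by (rule Cauchy_Schwarz_ineq2)
    also have "\<dots> \<le> norm x * norm y" using t(2)[of B] True by (intro mult_mono) auto
    finally show ?thesis using True by (simp add: g_def)
  next
    case False
    then have "g x y B = 0" unfolding g_def by (rule if_not_P)
    then show ?thesis by simp
  qed
  have Bg: "Bfun (g x y) ?F" for x y by (rule BfunI[of _ "norm x * norm y"]) (simp add: g_le)
  define q where "q = (\<lambda>x y. m (g x y))"
  have "q x y = q y x" for x y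
  proof -
    have "g x y = g y x" by (auto simp: g_def fun_eq_iff inner_commute)
    then show ?thesis by (simp add: q_def)
  qed
  moreover have "q (x + y) z = q x z + q y z" if "x \<in> Y" "y \<in> Y" "z \<in> Y" for x y z
  proof -
    have "\<forall>\<^sub>F B in ?F. g (x + y) z B = g x z B + g y z B"
      using ev[OF that(1)] ev[OF that(2)] ev[OF that(3)]
      by eventually_elim (simp add: g_def span_add t(1) linear_add inner_add_left)
    from is_mean_cong[OF m Bfun_add[OF Bg Bg] this] show ?thesis
      unfolding q_def using is_mean_add[OF m Bg Bg] by simp
  qed
  moreover have "q (c *\<^sub>R x) y = c * q x y" if "x \<in> Y" "y \<in> Y" for x y c
  proof -
    have "\<forall>\<^sub>F B in ?F. g (c *\<^sub>R x) y B = c * g x y B"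
      using ev[OF that(1)] ev[OF that(2)]
      by eventually_elim (simp add: g_def span_scale t(1) linear_scale)
    from is_mean_cong[OF m Bfun_bounded_linear[OF bounded_linear_mult_right Bg] this] show ?thesis
      unfolding q_def using is_mean_scale[OF m Bg] by simp
  qed
  moreover have "(1 / D\<^sup>2) * (norm x)\<^sup>2 \<le> q x x \<and> q x x \<le> 1 * (norm x)\<^sup>2" if x: "x \<in> Y" for x
  proof
    have "\<forall>\<^sub>F B in ?F. (1 / D\<^sup>2) * (norm x)\<^sup>2 \<le> g x x B"
      using ev[OF x]
    proof eventually_elim
      case (elim B)
      have "(norm x)\<^sup>2 \<le> (D * norm (t B x))\<^sup>2" using t(2)[of B x] elim by (intro power_mono) auto
      then show ?case using elim D
        by (simp add: g_def power_mult_distrib power2_norm_eq_inner field_simps)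
    qed
    then show "(1 / D\<^sup>2) * (norm x)\<^sup>2 \<le> q x x" unfolding q_def by (rule is_mean_ge[OF m Bg])
    have "g x x B \<le> 1 * (norm x)\<^sup>2" for B using g_le[of x x B] by (simp add: power2_eq_square)
    then show "q x x \<le> 1 * (norm x)\<^sup>2" unfolding q_def by (intro is_mean_le[OF m Bg]) auto
  qed
  moreover have "1 / D\<^sup>2 > 0" using D by simp
  ultimately have "equivalent_inner Y q" unfolding equivalent_inner_def by blast
  then show ?thesis unfolding Y_def by blast
qed

text \<open>If \<open>\<phi>\<close> is not zero on \<open>V\<close>, a vector \<open>z\<close> with
  \<open>\<phi> z = 1\<close> splits \<open>V\<close> into the kernel part and the line through
  \<open>z\<close>; the new form is the orthogonal sum of \<open>q\<close> and the product of the
  \<open>\<phi>\<close>-components.\<close>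

lemma equivalent_inner_insert:
  fixes \<phi> :: "'a::real_normed_vector \<Rightarrow> real"
  assumes \<phi>: "bounded_linear \<phi>" and V: "subspace V" and q: "equivalent_inner (V \<inter> {x. \<phi> x = 0}) q"
  shows "\<exists>q. equivalent_inner V q"
proof (cases "\<forall>x\<in>V. \<phi> x = 0")
  case True
  then have "V \<inter> {x. \<phi> x = 0} = V" by auto
  then show ?thesis using q by metis
next
  case False
  then obtain z' where z': "z' \<in> V" "\<phi> z' \<noteq> 0" by blast
  have lin: "linear \<phi>" using \<phi> by (rule bounded_linear.linear)
  define z where "z = z' /\<^sub>R \<phi> z'"
  have z: "z \<in> V" "\<phi> z = 1" using z' lin by (auto simp: z_def linear_scale intro: subspace_scale[OF V])
  define p where "p = (\<lambda>x. x - \<phi> x *\<^sub>R z)"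
  let ?W = "V \<inter> {x. \<phi> x = 0}"
  have pW: "p x \<in> ?W" if "x \<in> V" for x
    using that z V lin by (auto simp: p_def linear_diff linear_scale intro: subspace_diff subspace_scale)
  have p: "p (x + y) = p x + p y" "p (c *\<^sub>R x) = c *\<^sub>R p x" for x y c
    using lin by (simp_all add: p_def linear_add linear_scale algebra_simps)
  obtain K where K: "K > 0" "\<And>x. \<bar>\<phi> x\<bar> \<le> norm x * K"
    using bounded_linear.pos_bounded[OF \<phi>] by auto
  obtain l u where sym: "\<forall>x\<in>?W. \<forall>y\<in>?W. q x y = q y x"
    and add: "\<forall>x\<in>?W. \<forall>y\<in>?W. \<forall>z\<in>?W. q (x + y) z = q x z + q y z"
    and scale: "\<forall>x\<in>?W. \<forall>y\<in>?W. \<forall>c. q (c *\<^sub>R x) y = c * q x y"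
    and l: "l > 0" and lu: "\<forall>x\<in>?W. l * (norm x)\<^sup>2 \<le> q x x \<and> q x x \<le> u * (norm x)\<^sup>2"
    using q unfolding equivalent_inner_def by (elim exE conjE)
  define q' where "q' = (\<lambda>x y. q (p x) (p y) + \<phi> x * \<phi> y)"
  define M where "M = 1 + K * norm z"
  have sq: "(\<phi> x)\<^sup>2 \<le> K\<^sup>2 * (norm x)\<^sup>2" for x
  proof -
    have "\<bar>\<phi> x\<bar>\<^sup>2 \<le> (norm x * K)\<^sup>2" using K(2)[of x] by (intro power_mono) auto
    then show ?thesis by (simp add: power_mult_distrib mult.commute)
  qed
  have pM: "norm (p x) \<le> M * norm x" for x
  proof -
    have "norm (p x) \<le> norm x + \<bar>\<phi> x\<bar> * norm z" unfolding p_def using norm_triangle_ineq4[of x "\<phi> x *\<^sub>R z"] by simp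
    also have "\<dots> \<le> norm x + (norm x * K) * norm z" using K(2)[of x] by (intro add_left_mono mult_right_mono) auto
    finally show ?thesis by (simp add: M_def algebra_simps)
  qed
  \<comment> \<open>From \<open>norm x \<le> norm (p x) + \<bar>\<phi> x\<bar> * norm z\<close>,
    squared at the cost of a factor 2; both resulting coefficients are bounded by the sum
    \<open>1 / l + (norm z)\<^sup>2\<close>.\<close>
  define l' where "l' = 1 / (2 * (1 / l + (norm z)\<^sup>2))"
  have den: "1 / l + (norm z)\<^sup>2 > 0" using l by (simp add: add_pos_nonneg)
  have bounds: "l' * (norm x)\<^sup>2 \<le> q' x x \<and> q' x x \<le> (\<bar>u\<bar> * M\<^sup>2 + K\<^sup>2) * (norm x)\<^sup>2" if x: "x \<in> V" for x
  proof
    have qx: "l * (norm (p x))\<^sup>2 \<le> q (p x) (p x)" "q (p x) (p x) \<le> u * (norm (p x))\<^sup>2"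
      using lu pW[OF x] by blast+
    have "norm x \<le> norm (p x) + norm (\<phi> x *\<^sub>R z)"
      using norm_triangle_ineq[of "p x" "\<phi> x *\<^sub>R z"] by (simp add: p_def)
    then have "(norm x)\<^sup>2 \<le> (norm (p x) + \<bar>\<phi> x\<bar> * norm z)\<^sup>2" by (intro power_mono) auto
    also have "\<dots> \<le> 2 * ((norm (p x))\<^sup>2 + (\<bar>\<phi> x\<bar> * norm z)\<^sup>2)"
      using sum_squares_bound[of "norm (p x)" "\<bar>\<phi> x\<bar> * norm z"] by (simp add: power2_sum)
    also have "\<dots> = 2 * ((1 / l) * (l * (norm (p x))\<^sup>2) + (norm z)\<^sup>2 * (\<phi> x)\<^sup>2)"
      using l by (simp add: power_mult_distrib mult.commute)
    also have "\<dots> \<le> 2 * ((1 / l) * q (p x) (p x) + (norm z)\<^sup>2 * (\<phi> x)\<^sup>2)"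
      using qx(1) l by (intro mult_left_mono add_right_mono) auto
    also have "\<dots> \<le> 2 * ((1 / l + (norm z)\<^sup>2) * q' x x)"
    proof -
      have "0 \<le> q (p x) (p x)" using qx(1) l by (meson mult_nonneg_nonneg less_imp_le order_trans zero_le_power2)
      then have "0 \<le> (norm z)\<^sup>2 * q (p x) (p x)" "0 \<le> (1 / l) * (\<phi> x)\<^sup>2" using l by auto
      moreover have "(1 / l + (norm z)\<^sup>2) * q' x x = (1 / l) * q (p x) (p x) + (norm z)\<^sup>2 * (\<phi> x)\<^sup>2 +
          ((norm z)\<^sup>2 * q (p x) (p x) + (1 / l) * (\<phi> x)\<^sup>2)"
        by (simp add: q'_def algebra_simps power2_eq_square add_divide_distrib)
      ultimately show ?thesis by (intro mult_left_mono) simp_all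
    qed
    finally show "l' * (norm x)\<^sup>2 \<le> q' x x" using den by (simp add: l'_def field_simps)
    have "u * (norm (p x))\<^sup>2 \<le> \<bar>u\<bar> * (M * norm x)\<^sup>2"
      using pM[of x] by (intro mult_mono power_mono) auto
    then have "q (p x) (p x) \<le> \<bar>u\<bar> * (M * norm x)\<^sup>2" using qx(2) by linarith
    then have "q' x x \<le> \<bar>u\<bar> * (M * norm x)\<^sup>2 + K\<^sup>2 * (norm x)\<^sup>2"
      using sq[of x] by (simp add: q'_def power2_eq_square[symmetric])
    then show "q' x x \<le> (\<bar>u\<bar> * M\<^sup>2 + K\<^sup>2) * (norm x)\<^sup>2"
      by (simp add: power_mult_distrib algebra_simps)
  qed
  have "l' > 0" using den by (simp add: l'_def)
  moreover have "q' x y = q' y x" if "x \<in> V" "y \<in> V" for x y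
    using sym pW that by (simp add: q'_def)
  moreover have "q' (x + y) z = q' x z + q' y z" if "x \<in> V" "y \<in> V" "z \<in> V" for x y z
    using add[rule_format, OF pW[OF that(1)] pW[OF that(2)] pW[OF that(3)]] lin
    by (simp add: q'_def p(1) linear_add algebra_simps)
  moreover have "q' (c *\<^sub>R x) y = c * q' x y" if "x \<in> V" "y \<in> V" for x y c
    using scale[rule_format, OF pW[OF that(1)] pW[OF that(2)]] lin
    by (simp add: q'_def p(2) linear_scale algebra_simps)
  ultimately have "equivalent_inner V q'" unfolding equivalent_inner_def using bounds by blast
  then show ?thesis by blast
qed

lemma equivalent_inner_UNIV:
  fixes \<Phi> :: "('a::real_normed_vector \<Rightarrow> real) set"
  assumes "fin_functionals \<Phi>" "equivalent_inner (common_kernel \<Phi>) q"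
  shows "\<exists>q :: 'a \<Rightarrow> 'a \<Rightarrow> real. equivalent_inner UNIV q"
proof -
  have "finite \<Phi>" using assms by (simp add: fin_functionals_def)
  then show ?thesis using assms
  proof (induction \<Phi> arbitrary: q)
    case empty
    then show ?case by (auto simp: common_kernel_def)
  next
    case (insert \<phi> \<Phi>)
    have "common_kernel (insert \<phi> \<Phi>) = common_kernel \<Phi> \<inter> {x. \<phi> x = 0}" by (auto simp: common_kernel_def)
    moreover have \<Phi>: "fin_functionals \<Phi>" "bounded_linear \<phi>"
      using insert.prems(1) by (auto simp: fin_functionals_def)
    ultimately obtain q' where "equivalent_inner (common_kernel \<Phi>) q'"
      using equivalent_inner_insert[OF \<Phi>(2) subspace_common_kernel[OF \<Phi>(1)]] insert.prems(2) by metis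
    then show ?case using insert.IH \<Phi>(1) by blast
  qed
qed

section \<open>Nearest point retractions\<close>

locale equivalent_inner_product =
  fixes q :: "'a::real_normed_vector \<Rightarrow> 'a \<Rightarrow> real" and l u :: real
  assumes sym: "q x y = q y x" and add: "q (x + y) z = q x z + q y z"
    and scale: "q (c *\<^sub>R x) y = c * q x y"
    and l: "l > 0" and lower: "l * (norm x)\<^sup>2 \<le> q x x" and upper: "q x x \<le> u * (norm x)\<^sup>2"
begin

lemma nonneg: "0 \<le> q x x"
  using lower[of x] l by (meson mult_nonneg_nonneg less_imp_le order_trans zero_le_power2)

lemma add': "q z (x + y) = q z x + q z y"
  by (metis sym add)

lemma scale': "q y (c *\<^sub>R x) = c * q y x"
  by (metis sym scale)

lemma minus: "q (- x) y = - q x y" and minus': "q y (- x) = - q y x"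
  using scale[of "-1" x y] scale'[of y "-1" x] by simp_all

lemma diff: "q (x - y) z = q x z - q y z" and diff': "q z (x - y) = q z x - q z y"
  using add[of x "- y" z] add'[of z x "- y"] by (simp_all add: minus minus')

lemma cauchy_schwarz: "(q x y)\<^sup>2 \<le> q x x * q y y"
proof (cases "q y y = 0")
  case True
  then have "l * (norm y)\<^sup>2 \<le> 0" using lower[of y] by simp
  then have "y = 0" using l by (simp add: mult_le_0_iff)
  then show ?thesis using scale'[of x 0 0] scale'[of 0 0 0] by simp
next
  case False
  then have pos: "q y y > 0" using nonneg[of y] by simp
  have "0 \<le> q (q y y *\<^sub>R x - q x y *\<^sub>R y) (q y y *\<^sub>R x - q x y *\<^sub>R y)" by (rule nonneg)
  also have "\<dots> = q y y * (q x x * q y y - (q x y)\<^sup>2)"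
    by (simp add: diff diff' scale scale' sym[of y x] power2_eq_square algebra_simps)
  finally show ?thesis using pos by (simp add: zero_le_mult_iff)
qed

lemma abs_le: "\<bar>q x y\<bar> \<le> \<bar>u\<bar> * norm x * norm y"
proof -
  have "q z z \<le> \<bar>u\<bar> * (norm z)\<^sup>2" for z
    using upper[of z] mult_right_mono[OF abs_ge_self[of u], of "(norm z)\<^sup>2"] by simp
  then have "q x x * q y y \<le> (\<bar>u\<bar> * (norm x)\<^sup>2) * (\<bar>u\<bar> * (norm y)\<^sup>2)"
    by (intro mult_mono nonneg) auto
  then have "\<bar>q x y\<bar>\<^sup>2 \<le> (\<bar>u\<bar> * norm x * norm y)\<^sup>2"
    using cauchy_schwarz[of x y] by (simp add: power_mult_distrib power2_eq_square ac_simps)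
  then show ?thesis by (rule power2_le_imp_le) simp
qed

lemma bounded_bilinear: "bounded_bilinear q"
proof
  show "\<exists>K. \<forall>x y. norm (q x y) \<le> norm x * norm y * K"
    using abs_le by (intro exI[of _ "\<bar>u\<bar>"]) (simp add: mult_ac)
qed (simp_all add: add add' scale scale')

lemma minkowski: "sqrt (q (x + y) (x + y)) \<le> sqrt (q x x) + sqrt (q y y)"
proof (rule real_le_lsqrt)
  have "\<bar>q x y\<bar> \<le> sqrt (q x x) * sqrt (q y y)"
    using real_sqrt_le_mono[OF cauchy_schwarz[of x y]] by (simp add: real_sqrt_mult)
  then show "q (x + y) (x + y) \<le> (sqrt (q x x) + sqrt (q y y))\<^sup>2"
    using nonneg[of x] nonneg[of y] by (simp add: add add' sym[of y x] power2_sum)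
  show "0 \<le> sqrt (q x x) + sqrt (q y y)" using nonneg by simp
qed

text \<open>Compactness gives a point of \<open>K\<close> nearest in the norm of \<open>q\<close>.
  Adding its variational inequalities for \<open>x\<close> and \<open>y\<close> gives
  \<open>q (P x - P y) (P x - P y) \<le> q (x - y) (P x - P y)\<close>; comparison of the norms
  turns this into the Lipschitz constant \<open>\<bar>u\<bar> / l\<close>.\<close>

lemma lipschitz_retract_compact_convex:
  fixes K :: "'a set"
  assumes K: "convex K" "compact K" "K \<noteq> {}"
  shows "lipschitz_retract K"
proof -
  interpret B: bounded_bilinear q by (rule bounded_bilinear)
  have "\<exists>p\<in>K. \<forall>y\<in>K. q (x - p) (x - p) \<le> q (x - y) (x - y)" for x
    using K by (intro continuous_attains_inf B.continuous_on continuous_intros) auto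
  then obtain P where P: "\<And>x. P x \<in> K" "\<And>x y. y \<in> K \<Longrightarrow> q (x - P x) (x - P x) \<le> q (x - y) (x - y)"
    by metis
  have var: "q (x - P x) (y - P x) \<le> 0" if y: "y \<in> K" for x y
  proof -
    \<comment> \<open>Moving from \<open>P x\<close> towards \<open>y\<close> by a fraction
      \<open>t\<close> cannot decrease the distance; after division by \<open>t\<close> the limit at
      0 remains.\<close>
    have "2 * q (x - P x) (y - P x) \<le> t * q (y - P x) (y - P x)" if t: "0 < t" "t < 1" for t
    proof -
      have "(1 - t) *\<^sub>R P x + t *\<^sub>R y \<in> K" using K(1) P(1) y t by (auto simp: convex_alt)
      moreover have "x - ((1 - t) *\<^sub>R P x + t *\<^sub>R y) = (x - P x) - t *\<^sub>R (y - P x)" by (simp add: algebra_simps)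
      ultimately have "q (x - P x) (x - P x) \<le> q ((x - P x) - t *\<^sub>R (y - P x)) ((x - P x) - t *\<^sub>R (y - P x))"
        using P(2) by metis
      also have "\<dots> = q (x - P x) (x - P x) - 2 * t * q (x - P x) (y - P x) + t * (t * q (y - P x) (y - P x))"
        unfolding diff[of "x - P x"] diff'[of _ "x - P x"] scale scale' sym[of "y - P x" "x - P x"]
        by (simp add: algebra_simps)
      finally have "t * (2 * q (x - P x) (y - P x)) \<le> t * (t * q (y - P x) (y - P x))" by simp
      then show ?thesis using t by simp
    qed
    then have "\<forall>\<^sub>F t in at_right 0. 2 * q (x - P x) (y - P x) \<le> t * q (y - P x) (y - P x)"
      unfolding eventually_at_right_field by (intro exI[of _ 1]) auto
    moreover have "((\<lambda>t. t * q (y - P x) (y - P x)) \<longlongrightarrow> 0 * q (y - P x) (y - P x)) (at_right 0)"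
      by (intro tendsto_intros)
    ultimately have "2 * q (x - P x) (y - P x) \<le> 0 * q (y - P x) (y - P x)"
      by (intro tendsto_lowerbound) auto
    then show ?thesis by simp
  qed
  have lip: "norm (P x - P y) \<le> (\<bar>u\<bar> / l) * norm (x - y)" for x y
  proof (cases "P x = P y")
    case False
    have "q (x - P x) (P y - P x) + q (y - P y) (P x - P y) \<le> 0"
      using var[OF P(1), of x y] var[OF P(1), of y x] by simp
    then have "q (P x - P y) (P x - P y) \<le> q (x - y) (P x - P y)"
      by (simp add: diff diff' sym[of "P x" "P y"])
    then have "l * (norm (P x - P y))\<^sup>2 \<le> \<bar>u\<bar> * norm (x - y) * norm (P x - P y)"
      using lower[of "P x - P y"] abs_le[of "x - y" "P x - P y"] by linarith
    then have "l * norm (P x - P y) \<le> \<bar>u\<bar> * norm (x - y)"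
      using False by (simp add: power2_eq_square)
    then show ?thesis using l by (simp add: field_simps)
  qed (use l in simp)
  have "P x = x" if "x \<in> K" for x
  proof -
    have "l * (norm (x - P x))\<^sup>2 \<le> 0" using P(2)[OF that, of x] lower[of "x - P x"] scale[of 0 0 0] by simp
    then show ?thesis using l by (simp add: mult_le_0_iff)
  qed
  moreover have "(\<bar>u\<bar> / l)-lipschitz_on UNIV P"
    using lip l by (intro lipschitz_onI) (auto simp: dist_norm)
  ultimately show ?thesis unfolding lipschitz_retract_def using P(1) by blast
qed

end

section \<open>From equivalent inner products to Hilbert spaces and back\<close>

lemma equivalent_inner_product_if:
  assumes "equivalent_inner UNIV q"
  obtains l u where "equivalent_inner_product q l u"
proof -
  obtain l u where "\<forall>x y. q x y = q y x" "\<forall>x y z. q (x + y) z = q x z + q y z"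
    "\<forall>x y c. q (c *\<^sub>R x) y = c * q x y" "l > 0" "\<forall>x. l * (norm x)\<^sup>2 \<le> q x x \<and> q x x \<le> u * (norm x)\<^sup>2"
    using assms unfolding equivalent_inner_def by auto
  then have "equivalent_inner_product q l u" by unfold_locales auto
  then show thesis by (rule that)
qed

text \<open>The Hilbert space is the space itself with the form \<open>q\<close>, and the
  isomorphism is the identity. Two-sided comparison of the metrics identifies the topologies and
  transfers completeness.\<close>

lemma isomorphic_to_hilbert_space_if_equivalent_inner:
  fixes q :: "'a::banach \<Rightarrow> 'a \<Rightarrow> real"
  assumes "equivalent_inner UNIV q"
  shows "isomorphic_to_hilbert_space TYPE('a)"
proof -
  obtain l u where "equivalent_inner_product q l u" using assms by (rule equivalent_inner_product_if)
  then interpret equivalent_inner_product q l u .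
  define G :: "(real, 'a) module"
    where "G = \<lparr>carrier = UNIV, monoid.mult = (\<lambda>_ _. 0), one = 0, ring.zero = 0, add = (+),
      smult = (*\<^sub>R)\<rparr>"
  have G [simp]: "carrier G = UNIV" "x \<oplus>\<^bsub>G\<^esub> y = x + y" "\<zero>\<^bsub>G\<^esub> = 0" "r \<odot>\<^bsub>G\<^esub> x = r *\<^sub>R x" for x y r
    by (simp_all add: G_def)
  have mod: "module real_ring G"
  proof (intro moduleI abelian_groupI cring_real_ring)
    show "\<exists>y\<in>carrier G. y \<oplus>\<^bsub>G\<^esub> x = \<zero>\<^bsub>G\<^esub>" for x
      by (intro bexI[of _ "- x"]) auto
  qed (auto simp: algebra_simps)
  interpret G: module real_ring G by (rule mod)
  have Gm: "x \<ominus>\<^bsub>G\<^esub> y = x - y" for x y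
  proof -
    have "(x \<ominus>\<^bsub>G\<^esub> y) \<oplus>\<^bsub>G\<^esub> y = x"
      by (simp only: a_minus_def) (metis G(1) G.M.a_assoc G.M.a_inv_closed G.M.l_neg G.M.r_zero UNIV_I)
    then show ?thesis by (simp add: eq_diff_eq)
  qed
  define d where "d = ip_dist G q"
  have d: "d x y = sqrt (q (x - y) (x - y))" for x y by (simp add: d_def ip_dist_def Gm)
  \<comment> \<open>\<open>b\<close> replaces \<open>u\<close> in order to be positive even for the
    zero space.\<close>
  define b where "b = \<bar>u\<bar> + 1"
  have dl: "sqrt l * dist x y \<le> d x y" and du: "d x y \<le> sqrt b * dist x y" for x y
  proof -
    have "sqrt l * dist x y = sqrt (l * (norm (x - y))\<^sup>2)" by (simp add: real_sqrt_mult dist_norm)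
    also have "\<dots> \<le> d x y" unfolding d using lower by (rule real_sqrt_le_mono)
    finally show "sqrt l * dist x y \<le> d x y" .
    have "q (x - y) (x - y) \<le> b * (norm (x - y))\<^sup>2"
      using order_trans[OF upper[of "x - y"] mult_right_mono[of u b "(norm (x - y))\<^sup>2"]] by (simp add: b_def)
    then have "d x y \<le> sqrt (b * (norm (x - y))\<^sup>2)" unfolding d by (rule real_sqrt_le_mono)
    also have "\<dots> = sqrt b * dist x y" by (simp add: real_sqrt_mult dist_norm)
    finally show "d x y \<le> sqrt b * dist x y" .
  qed
  have sl: "sqrt l > 0" using l by simp
  have sb: "sqrt b > 0" by (simp add: b_def)
  interpret E: Metric_space UNIV d
  proof
    show "0 \<le> d x y" for x y using nonneg by (simp add: d)
    show "d x y = d y x" for x y unfolding d using minus[of "x - y" "x - y"] minus'[of "- (x - y)" "x - y"]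
      by (simp add: minus)
    show "d x y = 0 \<longleftrightarrow> x = y" for x y
    proof
      assume "d x y = 0"
      then have "sqrt l * dist x y \<le> 0" using dl[of x y] by simp
      then show "x = y" using sl by (simp add: mult_le_0_iff)
    qed (use scale[of 0 0 0] in \<open>simp add: d\<close>)
    show "d x z \<le> d x y + d y z" for x y z
      using minkowski[of "x - y" "y - z"] by (simp add: d)
  qed
  have "openin euclidean U \<longleftrightarrow> openin E.mtopology U" for U
  proof
    assume "openin euclidean U"
    then have U: "open U" by simp
    show "openin E.mtopology U"
      unfolding E.openin_mtopology
    proof (intro conjI allI impI)
      fix x assume "x \<in> U"
      then obtain e where e: "e > 0" "ball x e \<subseteq> U" using U open_contains_ball by blast
      have "E.mball x (sqrt l * e) \<subseteq> U"
      proof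
        fix y assume "y \<in> E.mball x (sqrt l * e)"
        then have "sqrt l * dist x y < sqrt l * e" using dl[of x y] by simp
        then show "y \<in> U" using e(2) sl by auto
      qed
      then show "\<exists>r>0. E.mball x r \<subseteq> U" using e(1) sl by (intro exI[of _ "sqrt l * e"]) auto
    qed simp
  next
    assume U: "openin E.mtopology U"
    have "\<exists>e>0. ball x e \<subseteq> U" if "x \<in> U" for x
    proof -
      obtain r where r: "r > 0" "E.mball x r \<subseteq> U" using U \<open>x \<in> U\<close> unfolding E.openin_mtopology by blast
      have "ball x (r / sqrt b) \<subseteq> U"
      proof
        fix y assume "y \<in> ball x (r / sqrt b)"
        then have "sqrt b * dist x y < r" using sb by (simp add: field_simps)
        then have "y \<in> E.mball x r" using du[of x y] by simp
        then show "y \<in> U" using r(2) by blast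
      qed
      then show ?thesis using r(1) sb by (intro exI[of _ "r / sqrt b"]) auto
    qed
    then show "openin euclidean U" by (simp add: open_contains_ball)
  qed
  then have top: "E.mtopology = euclidean" by (metis topology_eq)
  have "E.mcomplete"
    unfolding E.mcomplete_def
  proof (intro allI impI)
    fix s assume s: "E.MCauchy s"
    have "Cauchy s"
    proof (rule metric_CauchyI)
      fix e :: real assume "e > 0"
      then have "sqrt l * e > 0" using sl by simp
      then obtain N where N: "\<And>m n. N \<le> m \<Longrightarrow> N \<le> n \<Longrightarrow> d (s m) (s n) < sqrt l * e"
        using s unfolding E.MCauchy_def by meson
      have "dist (s m) (s n) < e" if "N \<le> m" "N \<le> n" for m n
      proof -
        have "sqrt l * dist (s m) (s n) < sqrt l * e" using dl N[OF that] by (rule le_less_trans)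
        then show ?thesis using sl by simp
      qed
      then show "\<exists>M. \<forall>m\<ge>M. \<forall>n\<ge>M. dist (s m) (s n) < e" by blast
    qed
    then obtain x where "s \<longlonglongrightarrow> x" using Cauchy_convergent convergent_def by blast
    then have "limitin E.mtopology s x sequentially" unfolding top by simp
    then show "\<exists>x. limitin E.mtopology s x sequentially" ..
  qed
  then have "real_hilbert_space G q"
    using mod
  proof (intro real_hilbert_space.intro real_hilbert_space_axioms.intro)
    show "x = \<zero>\<^bsub>G\<^esub>" if "q x x = 0" for x
    proof -
      have "l * (norm x)\<^sup>2 \<le> 0" using lower[of x] that by simp
      then show ?thesis using l by (simp add: mult_le_0_iff)
    qed
  qed (auto simp: add scale nonneg d_def intro: sym)
  moreover have "linear_homeomorphism G q id"
    using top by (simp add: linear_homeomorphism_def d_def)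
  ultimately show ?thesis
    unfolding isomorphic_to_hilbert_space_def by blast
qed

text \<open>The inner product is pulled back along \<open>T\<close>. Continuity of \<open>T\<close>
  and of its inverse at 0 compares one ball of each norm with a ball of the other; homogeneity turns
  this into the two quadratic estimates.\<close>

lemma equivalent_inner_if_isomorphic_to_hilbert_space:
  assumes "isomorphic_to_hilbert_space TYPE('a::real_normed_vector)"
  obtains q :: "'a::real_normed_vector \<Rightarrow> 'a \<Rightarrow> real" where "equivalent_inner UNIV q"
proof -
  obtain H :: "(real, 'a) module" and ip and T :: "'a \<Rightarrow> 'a" where HH: "real_hilbert_space H ip"
    and T: "linear_homeomorphism H ip T"
    using assms unfolding isomorphic_to_hilbert_space_def by blast
  interpret real_hilbert_space H ip by fact
  interpret D: Metric_space "carrier H" "ip_dist H ip" by (rule Metric_space_ip_dist)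
  have hom: "homeomorphic_map euclidean D.mtopology T"
    and Tadd: "T (x + y) = T x \<oplus>\<^bsub>H\<^esub> T y" and Tsc: "T (c *\<^sub>R x) = c \<odot>\<^bsub>H\<^esub> T x" for x y c
    using T by (auto simp: linear_homeomorphism_def)
  have im: "range T = carrier H" and injT: "inj T"
    using homeomorphic_imp_surjective_map[OF hom] homeomorphic_imp_injective_map[OF hom] by auto
  have c: "T z \<in> carrier H" for z using im by auto
  define q where "q = (\<lambda>x y. ip (T x) (T y))"
  have qs: "q (c *\<^sub>R x) y = c * q x y" "q x (c *\<^sub>R y) = c * q x y" for c x y
    using c by (simp_all add: q_def Tsc ip_smult_left ip_smult_right)
  have dist: "ip_dist H ip (T x) (T y) = sqrt (q (x - y) (x - y))" for x y
    using c by (simp add: ip_dist_def q_def linear_homeomorphism_minus[OF HH T])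
  have open_iff: "open U \<longleftrightarrow> openin D.mtopology (T ` U)" for U
    using homeomorphic_map_openness[OF hom, of U] by simp
  have "D.mball (T 0) 1 \<subseteq> range T" using im by auto
  then have "T ` {x. T x \<in> D.mball (T 0) 1} = D.mball (T 0) 1" by blast
  then have "open {x. T x \<in> D.mball (T 0) 1}" unfolding open_iff by (simp add: D.openin_mball)
  then obtain e where e: "e > 0" "ball 0 e \<subseteq> {x. T x \<in> D.mball (T 0) 1}"
    using open_contains_ball c by (metis (no_types, lifting) D.centre_in_mball_iff mem_Collect_eq zero_less_one)
  have up1: "q x x < 1" if "norm x < e" for x
  proof -
    have "ip_dist H ip (T x) (T 0) < 1" using e(2) that by (force simp: D.commute)
    then show ?thesis by (simp add: dist)
  qed
  have "openin D.mtopology (T ` ball 0 1)" using open_iff[of "ball 0 1"] by simp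
  moreover have "T 0 \<in> T ` ball 0 1" by simp
  ultimately obtain r where r: "r > 0" "D.mball (T 0) r \<subseteq> T ` ball 0 1"
    unfolding D.openin_mtopology by blast
  have lo1: "norm x < 1" if "sqrt (q x x) < r" for x
  proof -
    have "T x \<in> D.mball (T 0) r" using that c dist[of x 0] by (simp add: D.commute)
    then show ?thesis using r(2) injT by (auto simp: inj_eq subset_iff image_iff)
  qed
  have q0: "0 \<le> q x x" for x using c by (simp add: q_def ip_ge_zero)
  have upper: "q x x \<le> (4 / e\<^sup>2) * (norm x)\<^sup>2" for x
  proof (cases "x = 0")
    case False
    define t where "t = e / (2 * norm x)"
    have t: "t > 0" using False e(1) by (simp add: t_def)
    have "norm (t *\<^sub>R x) < e" using False e(1) by (simp add: t_def)
    from up1[OF this] have "t\<^sup>2 * q x x < 1" by (simp add: qs power2_eq_square mult.assoc)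
    then have "q x x \<le> 1 / t\<^sup>2" using t by (simp add: field_simps)
    also have "1 / t\<^sup>2 = (4 / e\<^sup>2) * (norm x)\<^sup>2" by (simp add: t_def power_divide power_mult_distrib)
    finally show ?thesis .
  qed (use qs[of 0 0 0] in simp)
  have lower: "(r\<^sup>2 / 4) * (norm x)\<^sup>2 \<le> q x x" for x
  proof (rule ccontr)
    assume "\<not> ?thesis"
    then have lt: "q x x < (r\<^sup>2 / 4) * (norm x)\<^sup>2" by simp
    then have x0: "x \<noteq> 0" using q0[of x] by auto
    define t where "t = 1 / norm x"
    have t: "t > 0" using x0 by (simp add: t_def)
    have "q (t *\<^sub>R x) (t *\<^sub>R x) = t\<^sup>2 * q x x" by (simp add: qs power2_eq_square)
    also have "\<dots> < t\<^sup>2 * ((r\<^sup>2 / 4) * (norm x)\<^sup>2)" using lt t by simp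
    also have "\<dots> = (r / 2)\<^sup>2" using x0 by (simp add: t_def power_divide)
    finally have "sqrt (q (t *\<^sub>R x) (t *\<^sub>R x)) < sqrt ((r / 2)\<^sup>2)" by (rule real_sqrt_less_mono)
    then have "sqrt (q (t *\<^sub>R x) (t *\<^sub>R x)) < r" using r(1) by simp
    from lo1[OF this] show False using x0 by (simp add: t_def)
  qed
  have "equivalent_inner UNIV q"
    unfolding equivalent_inner_def
  proof (intro conjI ballI allI)
    show "q x y = q y x" for x y using c by (simp add: q_def ip_commute)
    show "q (x + y) z = q x z + q y z" for x y z using c by (simp add: q_def Tadd ip_add_left)
    show "q (c *\<^sub>R x) y = c * q x y" for x y c by (rule qs)
    have "r\<^sup>2 / 4 > 0" using r(1) by simp
    then show "\<exists>l>0. \<exists>u. \<forall>x\<in>UNIV. l * (norm x)\<^sup>2 \<le> q x x \<and> q x x \<le> u * (norm x)\<^sup>2"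
      using upper lower by blast
  qed
  then show thesis by (rule that)
qed

section \<open>Gluing badly complemented subspaces\<close>

definition decomposition :: "(nat \<Rightarrow> 'a::real_normed_vector set) \<Rightarrow> 'a \<Rightarrow> (nat \<Rightarrow> 'a) \<Rightarrow> bool"
  where "decomposition D s x \<longleftrightarrow> (\<forall>i. x i \<in> D i) \<and> (\<exists>n. (\<forall>i\<ge>n. x i = 0) \<and> s = (\<Sum>i<n. x i))"

lemma decomposition_sum:
  assumes "decomposition D s x"
  obtains n where "\<And>m. m \<ge> n \<Longrightarrow> s = (\<Sum>i<m. x i)" "\<And>i. i \<ge> n \<Longrightarrow> x i = 0"
proof -
  obtain n where n: "\<forall>i\<ge>n. x i = 0" "s = (\<Sum>i<n. x i)" using assms by (auto simp: decomposition_def)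
  have "s = (\<Sum>i<m. x i)" if "m \<ge> n" for m
    unfolding n(2) using n(1) that by (intro sum.mono_neutral_left) auto
  then show thesis using that n(1) by blast
qed

text \<open>Summable radii make the set of all finite sums totally bounded. Any positive radius
  serves for the later linearization.\<close>

definition geometric_balls :: "(nat \<Rightarrow> 'a::real_normed_vector set) \<Rightarrow> nat \<Rightarrow> 'a set"
  where "geometric_balls B i = {x \<in> span (B i). norm x \<le> (1/2) ^ i}"

lemma convex_geometric_balls: "convex (geometric_balls B i)"
proof -
  have "geometric_balls B i = span (B i) \<inter> cball 0 ((1/2) ^ i)" by (auto simp: geometric_balls_def)
  then show ?thesis by (simp add: convex_Int subspace_imp_convex)
qed

lemma zero_in_geometric_balls: "0 \<in> geometric_balls B i"
  by (simp add: geometric_balls_def span_zero)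

lemma compact_partial_sums:
  assumes "\<And>i. finite (B i)"
  shows "compact {\<Sum>i<n. x i | x. \<forall>i. x i \<in> geometric_balls B i}"
proof (induction n)
  case 0
  have "{\<Sum>i<0. x i | x. \<forall>i. x i \<in> geometric_balls B i} = {0}"
    using zero_in_geometric_balls by (auto intro!: exI[of _ "\<lambda>_. 0"])
  then show ?case by simp
next
  case (Suc n)
  let ?K = "\<lambda>n. {\<Sum>i<n. x i | x. \<forall>i. x i \<in> geometric_balls B i}"
  have "compact (geometric_balls B n)" unfolding geometric_balls_def by (rule compact_span_ball[OF assms])
  from compact_sums[OF Suc this] have "compact {x + y |x y. x \<in> ?K n \<and> y \<in> geometric_balls B n}" .
  also have "\<dots> = ?K (Suc n)"
  proof (intro equalityI subsetI)
    fix z assume "z \<in> {x + y |x y. x \<in> ?K n \<and> y \<in> geometric_balls B n}"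
    then obtain v y where z: "z = v + y" "v \<in> ?K n" and y: "y \<in> geometric_balls B n" by blast
    obtain x where x: "v = (\<Sum>i<n. x i)" "\<forall>i. x i \<in> geometric_balls B i" using z(2) by blast
    then show "z \<in> ?K (Suc n)" using z(1) y by (intro CollectI exI[of _ "x(n := y)"]) auto
  next
    fix z assume "z \<in> ?K (Suc n)"
    then obtain x where x: "z = (\<Sum>i<n. x i) + x n" "\<forall>i. x i \<in> geometric_balls B i" by auto
    then have "(\<Sum>i<n. x i) \<in> ?K n" "x n \<in> geometric_balls B n" by auto
    then show "z \<in> {x + y |x y. x \<in> ?K n \<and> y \<in> geometric_balls B n}" using x(1) by blast
  qed
  finally show ?case .
qed

lemma sum_half_powers_tail: "(\<Sum>i\<in>{N..<n}. (1/2::real) ^ i) \<le> 2 * (1/2) ^ N"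
proof (induction n)
  case (Suc n)
  show ?case
  proof (cases "N \<le> n")
    case True
    have "(\<Sum>i\<in>{N..<n}. (1/2::real) ^ i) = 2 * (1/2) ^ N - 2 * (1/2) ^ n"
      using True by (induction n rule: dec_induct) auto
    then show ?thesis using True by simp
  qed auto
qed simp

text \<open>Up to a tail of norm at most \<open>2 * (1/2) ^ N\<close>, each sum lies in the compact
  set of sums of \<open>N\<close> terms, so a finite net of that set serves for all.\<close>

lemma compact_closure_decomposition:
  fixes B :: "nat \<Rightarrow> 'a::banach set"
  assumes B: "\<And>i. finite (B i)"
  shows "compact (closure {s. \<exists>x. decomposition (geometric_balls B) s x})"
proof -
  define S where "S = {s. \<exists>x. decomposition (geometric_balls B) s x}"
  have "\<exists>k. finite k \<and> closure S \<subseteq> (\<Union>x\<in>k. ball x \<epsilon>)" if \<epsilon>: "\<epsilon> > 0" for \<epsilon>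
  proof -
    obtain N where N: "(1/2::real) ^ N < \<epsilon> / 6" using real_arch_pow_inv[of "\<epsilon> / 6" "1/2"] \<epsilon> by auto
    let ?K = "{\<Sum>i<N. x i | x. \<forall>i. x i \<in> geometric_balls B i}"
    have "compact ?K" by (rule compact_partial_sums[OF B])
    then have "\<exists>k. finite k \<and> ?K \<subseteq> (\<Union>x\<in>k. ball x (\<epsilon> / 3))"
      by (rule compact_finite_net) (use \<epsilon> in simp)
    then obtain k where k: "finite k" "?K \<subseteq> (\<Union>x\<in>k. ball x (\<epsilon> / 3))" by blast
    \<comment> \<open>Closed balls are used because their finite union is closed and so contains the
      closure of \<open>S\<close>; the slack to \<open>\<epsilon>\<close> then permits open
      balls.\<close>
    have "S \<subseteq> (\<Union>x\<in>k. cball x (2 * \<epsilon> / 3))"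
    proof
      fix s assume "s \<in> S"
      then obtain x where x: "decomposition (geometric_balls B) s x" by (auto simp: S_def)
      obtain n where n: "\<And>m. m \<ge> n \<Longrightarrow> s = (\<Sum>i<m. x i)" using decomposition_sum[OF x] by metis
      have xD: "x i \<in> geometric_balls B i" for i using x by (simp add: decomposition_def)
      define v where "v = (\<Sum>i<N. x i)"
      have "s = (\<Sum>i<max n N. x i)" by (rule n) simp
      also have "\<dots> = v + (\<Sum>i\<in>{N..<max n N}. x i)"
      proof -
        have "{..<max n N} = {..<N} \<union> {N..<max n N}" by auto
        then show ?thesis unfolding v_def by (simp add: sum.union_disjoint ivl_disj_int)
      qed
      finally have "norm (s - v) \<le> (\<Sum>i\<in>{N..<max n N}. norm (x i))" by (simp add: norm_sum)
      also have "\<dots> \<le> (\<Sum>i\<in>{N..<max n N}. (1/2) ^ i)"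
        using xD by (intro sum_mono) (simp add: geometric_balls_def)
      also have "\<dots> \<le> 2 * (1/2) ^ N" by (rule sum_half_powers_tail)
      finally have sv: "dist s v \<le> \<epsilon> / 3" using N by (simp add: dist_norm)
      have "v \<in> ?K" unfolding v_def using xD by blast
      then obtain p where p: "p \<in> k" "dist p v < \<epsilon> / 3" using k(2) by auto
      have "dist p s \<le> 2 * \<epsilon> / 3" using dist_triangle[of p s v] sv p(2) by (simp add: dist_commute)
      then show "s \<in> (\<Union>x\<in>k. cball x (2 * \<epsilon> / 3))" using p(1) by auto
    qed
    moreover have "closed (\<Union>x\<in>k. cball x (2 * \<epsilon> / 3))" using k(1) by (intro closed_UN) auto
    ultimately have "closure S \<subseteq> (\<Union>x\<in>k. cball x (2 * \<epsilon> / 3))" by (rule closure_minimal)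
    also have "\<dots> \<subseteq> (\<Union>x\<in>k. ball x \<epsilon>)" using \<epsilon> by (intro UN_mono) auto
    finally show ?thesis using k(1) by blast
  qed
  moreover have "complete (closure S)" by (simp add: complete_eq_closed)
  ultimately show ?thesis unfolding S_def compact_eq_totally_bounded by blast
qed

lemma convex_decomposition: "convex {s. \<exists>x. decomposition (geometric_balls B) s x}"
proof (rule convexI)
  fix s s' and a b :: real
  assume "s \<in> {s. \<exists>x. decomposition (geometric_balls B) s x}" "s' \<in> {s. \<exists>x. decomposition (geometric_balls B) s x}"
    and ab: "0 \<le> a" "0 \<le> b" "a + b = 1"
  then obtain x x' where x: "decomposition (geometric_balls B) s x" and x': "decomposition (geometric_balls B) s' x'"
    by blast
  obtain n where n: "\<And>m. m \<ge> n \<Longrightarrow> s = (\<Sum>i<m. x i)" "\<And>i. i \<ge> n \<Longrightarrow> x i = 0"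
    using decomposition_sum[OF x] by metis
  obtain n' where n': "\<And>m. m \<ge> n' \<Longrightarrow> s' = (\<Sum>i<m. x' i)" "\<And>i. i \<ge> n' \<Longrightarrow> x' i = 0"
    using decomposition_sum[OF x'] by metis
  have "decomposition (geometric_balls B) (a *\<^sub>R s + b *\<^sub>R s') (\<lambda>i. a *\<^sub>R x i + b *\<^sub>R x' i)"
    unfolding decomposition_def
  proof (intro conjI allI exI[of _ "max n n'"] impI)
    show "a *\<^sub>R x i + b *\<^sub>R x' i \<in> geometric_balls B i" for i
      using x x' ab by (intro convexD[OF convex_geometric_balls]) (auto simp: decomposition_def)
    show "a *\<^sub>R x i + b *\<^sub>R x' i = 0" if "max n n' \<le> i" for i using that n(2) n'(2) by simp
    show "a *\<^sub>R s + b *\<^sub>R s' = (\<Sum>i<max n n'. a *\<^sub>R x i + b *\<^sub>R x' i)"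
      using n(1)[of "max n n'"] n'(1)[of "max n n'"] by (simp add: sum.distrib scaleR_sum_right)
  qed
  then show "a *\<^sub>R s + b *\<^sub>R s' \<in> {s. \<exists>x. decomposition (geometric_balls B) s x}" by blast
qed

text \<open>On sums of vectors from the balls, the \<open>k\<close>-th component is 4-Lipschitz, by
  the bound on decompositions, and it extends to the closure. Composed with one retraction onto the
  closure it retracts the space onto a ball of \<open>span (B k)\<close> with constant
  \<open>4 * L\<close>, the same for all \<open>k\<close>.\<close>

lemma uniformly_complemented_if_lipschitz_retracts:
  fixes B :: "nat \<Rightarrow> 'a::banach set"
  assumes B: "\<And>i. finite (B i)"
    and bound: "\<And>x n k. (\<And>i. x i \<in> span (B i)) \<Longrightarrow> k < n \<Longrightarrow> norm (x k) \<le> 4 * norm (\<Sum>i<n. x i)"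
    and retract: "\<And>K :: 'a set. convex K \<Longrightarrow> compact K \<Longrightarrow> K \<noteq> {} \<Longrightarrow> lipschitz_retract K"
  shows "\<exists>c. \<forall>k. complemented c (span (B k))"
proof -
  define S where "S = {s. \<exists>x. decomposition (geometric_balls B) s x}"
  have single: "decomposition (geometric_balls B) y (\<lambda>i. if i = k then y else 0)"
    if y: "y \<in> geometric_balls B k" for y k
    unfolding decomposition_def using y zero_in_geometric_balls
    by (auto intro!: exI[of _ "Suc k"])
  have "0 \<in> S" using single[OF zero_in_geometric_balls, of 0] by (auto simp: S_def)
  then have "closure S \<noteq> {}" by auto
  moreover have "convex (closure S)" unfolding S_def by (intro convex_closure convex_decomposition)
  moreover have "compact (closure S)" unfolding S_def by (rule compact_closure_decomposition[OF B])
  ultimately obtain R L where R: "L-lipschitz_on UNIV R" "range R \<subseteq> closure S" "\<forall>x\<in>closure S. R x = x"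
    using retract unfolding lipschitz_retract_def by metis
  have "complemented (4 * L) (span (B k))" for k
  proof -
    \<comment> \<open>The choice is harmless: \<open>lip\<close> for \<open>s = s'\<close> shows
      that the \<open>k\<close>-th component does not depend on the decomposition.\<close>
    define Q where "Q = (\<lambda>s. (SOME x. decomposition (geometric_balls B) s x) k)"
    have Q: "\<exists>x. decomposition (geometric_balls B) s x \<and> Q s = x k" if "s \<in> S" for s
      using that someI_ex[of "decomposition (geometric_balls B) s"] unfolding S_def Q_def by blast
    have lip: "norm (x k - x' k) \<le> 4 * norm (s - s')"
      if x: "decomposition (geometric_balls B) s x" and x': "decomposition (geometric_balls B) s' x'" for s s' x x'
    proof -
      obtain n where n: "\<And>m. m \<ge> n \<Longrightarrow> s = (\<Sum>i<m. x i)" using decomposition_sum[OF x] by metis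
      obtain n' where n': "\<And>m. m \<ge> n' \<Longrightarrow> s' = (\<Sum>i<m. x' i)" using decomposition_sum[OF x'] by metis
      define m where "m = max (max n n') (Suc k)"
      have "norm (x k - x' k) \<le> 4 * norm (\<Sum>i<m. x i - x' i)"
        using x x' by (intro bound[of "\<lambda>i. x i - x' i"])
          (auto simp: m_def decomposition_def geometric_balls_def intro: span_diff)
      also have "(\<Sum>i<m. x i - x' i) = s - s'" using n[of m] n'[of m] by (simp add: m_def sum_subtractf)
      finally show ?thesis .
    qed
    have "4-lipschitz_on S Q"
    proof (rule lipschitz_onI)
      fix s s' assume "s \<in> S" "s' \<in> S"
      then show "dist (Q s) (Q s') \<le> 4 * dist s s'" using Q lip by (metis dist_norm)
    qed simp
    then obtain g where g: "4-lipschitz_on (closure S) g" "\<forall>s\<in>S. g s = Q s"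
      using lipschitz_extend_closure by blast
    have "compact (geometric_balls B k)" unfolding geometric_balls_def by (rule compact_span_ball[OF B])
    then have "closed (geometric_balls B k)" by (rule compact_imp_closed)
    moreover have "g ` S \<subseteq> geometric_balls B k"
    proof
      fix y assume "y \<in> g ` S"
      then obtain s where "s \<in> S" "y = Q s" using g(2) by auto
      then show "y \<in> geometric_balls B k" using Q[of s] by (auto simp: decomposition_def)
    qed
    ultimately have gk: "g ` closure S \<subseteq> geometric_balls B k"
      using image_closure_subset[OF lipschitz_on_continuous_on[OF g(1)]] by blast
    have gid: "g y = y" if y: "y \<in> geometric_balls B k" for y
    proof -
      have yS: "y \<in> S" using single[OF y] by (auto simp: S_def)
      then obtain x where x: "decomposition (geometric_balls B) y x" "Q y = x k" using Q by blast
      then have "norm (x k - y) \<le> 4 * norm (y - y)" using lip[OF x(1) single[OF y]] by simp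
      then show ?thesis using g(2) yS x(2) by simp
    qed
    have "(4 * L)-lipschitz_on UNIV (g \<circ> R)"
      using lipschitz_on_compose[OF R(1) lipschitz_on_subset[OF g(1) R(2)]] .
    moreover have "(g \<circ> R) x \<in> span (B k)" for x
    proof -
      have "g (R x) \<in> geometric_balls B k" using gk R(2) by blast
      then show ?thesis by (simp add: geometric_balls_def)
    qed
    moreover have "(g \<circ> R) x = x" if "x \<in> span (B k)" "norm x \<le> (1/2) ^ k" for x
    proof -
      have x: "x \<in> geometric_balls B k" using that by (simp add: geometric_balls_def)
      then have "x \<in> closure S" using single[OF x] closure_subset by (force simp: S_def)
      then show ?thesis using R(3) gid[OF x] by simp
    qed
    ultimately obtain P where "linear P" "\<And>x. P x \<in> span (B k)" "\<And>x. x \<in> span (B k) \<Longrightarrow> P x = x"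
      "\<And>x. norm (P x) \<le> (4 * L) * norm x"
      using linear_projection_from_retraction[OF B, of "4 * L" "g \<circ> R" k "(1/2) ^ k"]
      by (metis zero_less_power half_gt_zero zero_less_one)
    then show ?thesis unfolding complemented_def by (intro exI[of _ P]) auto
  qed
  then show ?thesis by blast
qed

lemma complemented_mono:
  assumes "complemented c V" "c \<le> d"
  shows "complemented d V"
proof -
  obtain P where P: "linear P" "range P \<subseteq> V" "\<forall>x\<in>V. P x = x" "\<forall>x. norm (P x) \<le> c * norm x"
    using assms(1) unfolding complemented_def by blast
  have "norm (P x) \<le> d * norm x" for x
    using P(4) mult_right_mono[OF assms(2) norm_ge_zero[of x]] order_trans by blast
  then show ?thesis unfolding complemented_def using P by blast
qed

text \<open>Badly complemented subspaces chosen one after the other in the kernels of functionals norming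
  the previous ones would form a finite-dimensional decomposition.\<close>

lemma uniformly_complemented_kernel_exists:
  assumes retract: "\<And>K :: 'a::banach set. convex K \<Longrightarrow> compact K \<Longrightarrow> K \<noteq> {} \<Longrightarrow> lipschitz_retract K"
  shows "\<exists>(\<Phi> :: ('a \<Rightarrow> real) set) c. fin_functionals \<Phi> \<and>
    (\<forall>B. finite B \<longrightarrow> B \<subseteq> common_kernel \<Phi> \<longrightarrow> complemented c (span B))"
proof (rule ccontr)
  assume "\<not> ?thesis"
  then have "\<forall>(\<Phi> :: ('a \<Rightarrow> real) set) c. \<exists>B. fin_functionals \<Phi> \<longrightarrow>
      finite B \<and> B \<subseteq> common_kernel \<Phi> \<and> \<not> complemented c (span B)" by blast
  then obtain bad :: "('a \<Rightarrow> real) set \<Rightarrow> real \<Rightarrow> 'a set" where bad: "\<And>\<Phi> c. fin_functionals \<Phi> \<Longrightarrow>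
      finite (bad \<Phi> c) \<and> bad \<Phi> c \<subseteq> common_kernel \<Phi> \<and> \<not> complemented c (span (bad \<Phi> c))"
    by metis
  have "\<forall>B :: 'a set. \<exists>\<Psi>. finite B \<longrightarrow> fin_functionals \<Psi> \<and> norming (span B) \<Psi>"
    using norming_exists by blast
  then obtain \<Psi> where \<Psi>: "\<And>B :: 'a set. finite B \<Longrightarrow> fin_functionals (\<Psi> B) \<and> norming (span B) (\<Psi> B)"
    by metis
  \<comment> \<open>The state holds the vectors chosen so far and the functionals that later choices
    must annihilate. Stage \<open>n\<close> picks a subspace that is bad for the constant
    \<open>n\<close>, so no single constant can serve all stages.\<close>
  define step where "step = (\<lambda>(n::nat) (A, \<Phi>). let A' = A \<union> bad \<Phi> (real n) in (A', \<Phi> \<union> \<Psi> A'))"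
  define st where "st = rec_nat ({}, \<Psi> {}) step"
  define A where "A = (\<lambda>n. fst (st n))"
  define \<Phi> where "\<Phi> = (\<lambda>n. snd (st n))"
  define B where "B = (\<lambda>n. bad (\<Phi> n) (real n))"
  have A0: "A 0 = {}" and \<Phi>0: "\<Phi> 0 = \<Psi> {}" by (simp_all add: A_def \<Phi>_def st_def)
  have AS: "A (Suc n) = A n \<union> B n" and \<Phi>S: "\<Phi> (Suc n) = \<Phi> n \<union> \<Psi> (A (Suc n))" for n
    by (simp_all add: A_def \<Phi>_def B_def st_def step_def Let_def case_prod_beta)
  have fin: "finite (A n) \<and> fin_functionals (\<Phi> n)" for n
  proof (induction n)
    case (Suc n)
    then have "finite (A (Suc n))" using bad by (simp add: AS B_def)
    then show ?case using Suc \<Psi> by (simp add: \<Phi>S fin_functionals_Un)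
  qed (use \<Psi> in \<open>simp add: A0 \<Phi>0\<close>)
  have B: "finite (B n)" "B n \<subseteq> common_kernel (\<Phi> n)" "\<not> complemented (real n) (span (B n))" for n
    using bad[of "\<Phi> n" "real n"] fin[of n] by (simp_all add: B_def)
  have \<Psi>\<Phi>: "\<Psi> (A n) \<subseteq> \<Phi> n" for n by (cases n) (auto simp: A0 \<Phi>0 \<Phi>S)
  have mono: "\<Phi> m \<subseteq> \<Phi> n" if "m \<le> n" for m n
    using that by (induction rule: dec_induct) (auto simp: \<Phi>S)
  have BA: "B i \<subseteq> A n" if "i < n" for i n
    using that by (induction n) (auto simp: AS less_Suc_eq)
  \<comment> \<open>The terms before \<open>k\<close> lie in \<open>span (A k)\<close>, the others
    in the kernel of functionals norming this span.\<close>
  have partial: "norm (\<Sum>i<k. x i) \<le> 2 * norm (\<Sum>i<n. x i)" if x: "\<And>i. x i \<in> span (B i)" and k: "k \<le> n" for x k n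
  proof -
    have "x i \<in> span (A k)" if "i < k" for i
      using x[of i] span_mono[OF BA[OF that]] by blast
    then have "(\<Sum>i<k. x i) \<in> span (A k)" by (intro span_sum) auto
    moreover have "(\<Sum>i\<in>{k..<n}. x i) \<in> common_kernel (\<Psi> (A k))"
    proof (intro subspace_sum subspace_common_kernel)
      show "fin_functionals (\<Psi> (A k))" using \<Psi> fin by blast
      fix i assume i: "i \<in> {k..<n}"
      have "span (B i) \<subseteq> common_kernel (\<Phi> i)"
        using B(2) fin by (intro span_subset_common_kernel) auto
      moreover have "\<Psi> (A k) \<subseteq> \<Phi> i" using \<Psi>\<Phi>[of k] mono[of k i] i by auto
      ultimately show "x i \<in> common_kernel (\<Psi> (A k))" using x[of i] by (auto simp: common_kernel_def)
    qed
    ultimately have "norm (\<Sum>i<k. x i) \<le> 2 * norm ((\<Sum>i<k. x i) + (\<Sum>i\<in>{k..<n}. x i))"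
      using \<Psi> fin unfolding norming_def by blast
    moreover have "(\<Sum>i<n. x i) = (\<Sum>i<k. x i) + (\<Sum>i\<in>{k..<n}. x i)"
    proof -
      have "{..<n} = {..<k} \<union> {k..<n}" using k by auto
      then show ?thesis by (simp add: sum.union_disjoint ivl_disj_int)
    qed
    ultimately show ?thesis by simp
  qed
  have bound: "norm (x k) \<le> 4 * norm (\<Sum>i<n. x i)" if x: "\<And>i. x i \<in> span (B i)" and k: "k < n" for x k n
  proof -
    have "norm (x k) \<le> norm (\<Sum>i<Suc k. x i) + norm (\<Sum>i<k. x i)"
      using norm_triangle_ineq4[of "\<Sum>i<Suc k. x i" "\<Sum>i<k. x i"] by simp
    then show ?thesis using partial[OF x, of "Suc k" n] partial[OF x, of k n] k by simp
  qed
  have "\<exists>c. \<forall>k. complemented c (span (B k))"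
  proof (rule uniformly_complemented_if_lipschitz_retracts)
    show "finite (B i)" for i by (rule B)
    show "norm (x k) \<le> 4 * norm (\<Sum>i<n. x i)" if "\<And>i. x i \<in> span (B i)" "k < n" for x k n
      using that by (rule bound)
    show "lipschitz_retract K" if "convex K" "compact K" "K \<noteq> {}" for K :: "'a set"
      using that by (rule retract)
  qed
  then obtain c where c: "\<And>k. complemented c (span (B k))" by blast
  obtain n :: nat where "c \<le> real n" using real_arch_simple by blast
  then show False using complemented_mono[OF c] B(3) by blast
qed

theorem theorem6p1:
  shows "isomorphic_to_hilbert_space TYPE('a::banach) \<longleftrightarrow>
    (\<forall>K :: 'a set. convex K \<and> compact K \<and> K \<noteq> {} \<longrightarrow> lipschitz_retract K)"
proof
  assume "isomorphic_to_hilbert_space TYPE('a)"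
  then obtain q :: "'a \<Rightarrow> 'a \<Rightarrow> real" where "equivalent_inner UNIV q"
    by (rule equivalent_inner_if_isomorphic_to_hilbert_space)
  then obtain l u where "equivalent_inner_product q l u" by (rule equivalent_inner_product_if)
  then show "\<forall>K :: 'a set. convex K \<and> compact K \<and> K \<noteq> {} \<longrightarrow> lipschitz_retract K"
    using equivalent_inner_product.lipschitz_retract_compact_convex by blast
next
  assume "\<forall>K :: 'a set. convex K \<and> compact K \<and> K \<noteq> {} \<longrightarrow> lipschitz_retract K"
  then obtain \<Phi> :: "('a \<Rightarrow> real) set" and c where \<Phi>: "fin_functionals \<Phi>"
    and c: "\<And>B. finite B \<Longrightarrow> B \<subseteq> common_kernel \<Phi> \<Longrightarrow> complemented c (span B)"
    using uniformly_complemented_kernel_exists by blast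
  have "\<exists>(\<Phi>' :: ('a \<Rightarrow> real) set) q. fin_functionals \<Phi>' \<and> equivalent_inner (common_kernel \<Phi>') q"
  proof (cases "\<forall>\<Phi>' :: ('a \<Rightarrow> real) set. fin_functionals \<Phi>' \<longrightarrow> (\<exists>x\<in>common_kernel \<Phi>'. x \<noteq> 0)")
    case True
    then interpret uniformly_complemented \<Phi> "max c 1"
      using \<Phi> c by unfold_locales (auto intro: complemented_mono[OF _ max.cobounded1])
    show ?thesis using \<Phi> equivalent_inner_exists by blast
  next
    \<comment> \<open>This is the finite-dimensional case: the kernel is trivial, so even the zero
      form is equivalent to the norm there.\<close>
    case False
    then obtain \<Phi>' :: "('a \<Rightarrow> real) set" where \<Phi>': "fin_functionals \<Phi>'" "\<forall>x\<in>common_kernel \<Phi>'. x = 0" by blast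
    then have "equivalent_inner (common_kernel \<Phi>') (\<lambda>_ _. 0)"
      by (auto simp: equivalent_inner_def intro!: exI[of _ 1])
    then show ?thesis using \<Phi>'(1) by blast
  qed
  then obtain q :: "'a \<Rightarrow> 'a \<Rightarrow> real" where "equivalent_inner UNIV q"
    using equivalent_inner_UNIV by blast
  then show "isomorphic_to_hilbert_space TYPE('a)"
    by (rule isomorphic_to_hilbert_space_if_equivalent_inner)
qed

end
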